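(* Let $a,b$ be positive constants and let $d\in L^\infty(x_L,x_R)$ satisfy $0<\underline d\le d(x)\le\overline d$ with constants $\underline d,\overline d$. Assume moreover that $d\in W^{1,\infty}(T_h)$. Let $(p,m)$ be a sufficiently smooth solution on $[0,T]$ of $$a\,\partial_t p+\partial_x m=f,\qquad b\,\partial_t m+\partial_x p+d\,m=g\qquad (x_L<x<x_R),\qquad p(x_L,t)=p(x_R,t)=0,$$ and let $(p_h,m_h)$ be a solution of the inexact Petrov-Galerkin method of order $k\ge 1$ on the mesh $T_h$ (as defined in the context). Then for all $0\le t\le T$, $$\|p(t)-p_h(t)\|+\|m(t)-m_h(t)\|\le C(p,m,T)\,h^{k+1},$$ with a constant $C(p,m,T)$ independent of the mesh size $h$.
   Context: Let $x_L<x_R$, $T>0$; $(\cdot,\cdot)$ and $\|\cdot\|$ denote the scalar product and norm of $L^2(x_L,x_R)$. Write $H^1_0=\{v\in H^1(x_L,x_R): v(x_L)=v(x_R)=0\}$ and $H(\mathrm{div})=H^1(x_L,x_R)$. The data satisfy $f,g\in L^2(0,T;L^2(x_L,x_R))$, $p(0)\in H^1_0$, $m(0)\in H(\mathrm{div})$. Mesh: $x_L=x_0<x_1<\dots<x_N=x_R$, elements $T_n=[x_{n-1},x_n]$, $T_h=\{T_n:1\le n\le N\}$, $h_n=|x_n-x_{n-1}|$, $h=\max_n h_n$. $P_k(T_h)$ is the space of functions in $L^2(x_L,x_R)$ whose restriction to each element is a polynomial of degree at most $k$. $W^{1,\infty}(T_h)$ is the space of functions whose restriction to each element $T\in T_h$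 belongs to $W^{1,\infty}(T)$, and its (piecewise) norm is the maximum of the $W^{1,\infty}(T)$ norms over $T \in T_h$. Fix $k\ge1$ and set $Q_h=P_k(T_h)\cap H^1_0$, $V_h=P_k(T_h)\cap H(\mathrm{div})$, $\widetilde Q_h=\widetilde V_h=P_{k-1}(T_h)$. $I_h^k:H^1(x_L,x_R)\to P_k(T_h)\cap H^1(x_L,x_R)$ is defined by $(I_h^kv)(x_n)=v(x_n)$ for $0\le n\le N$ and $(\partial_xI_h^kv,\widetilde v_h)=(\partial_xv,\widetilde v_h)$ for all $\widetilde v_h\in P_{k-1}(T_h)$. $\pi_h^{k-1}:L^2(x_L,x_R)\to P_{k-1}(T_h)$ is the $L^2$-orthogonal projection. Inexact Petrov-Galerkin method: find $p_h\in H^1(0,T;Q_h)$, $m_h\in H^1(0,T;V_h)$ with $p_h(0)=I_h^kp(0)$, $m_h(0)=I_h^km(0)$ such that for all $\widetilde q_h\in\widetilde Q_h$, $\widetilde v_h\in\widetilde V_h$ and all $0\le t\le T$ $$(a\,\partial_tp_h(t),\widetilde q_h)+(\partial_xm_h(t),\widetilde q_h)=(f(t),\widetilde q_h),$$ $$(b\,\partial_tm_h(t),\widetilde v_h)+(\partial_xp_h(t),\widetilde v_h)+(d\,\pi_h^{k-1}m_h(t),\widetilde v_h)=(g(t),\widetilde v_h).$$ "Sufficiently smooth" means that $p$ and $m$ have as many derivatives in space and time as needed; no specific regularity is prescribed. Besides its dependence on norms of $p,m$ and on $T$, the constant may depend on $a$, $b$, $d$ (through its bounds and its piecewise $W^{1,\infty}$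 norm), $k$ and the interval. *)

theory Defs
  imports "HOL-Analysis.Analysis" "HOL-Computational_Algebra.Polynomial"
begin

text \<open>Elements of Lebesgue and Sobolev spaces are represented by functions on the whole line whose
  values outside the interval in question are irrelevant.\<close>

subsection \<open>Lebesgue spaces\<close>

definition L2_space :: "'a::euclidean_space set \<Rightarrow> ('a \<Rightarrow> real) set" where
  "L2_space S = {v. set_borel_measurable lborel S v \<and> set_integrable lborel S (\<lambda>x. (v x)\<^sup>2)}"

definition L2_inner :: "real \<Rightarrow> real \<Rightarrow> (real \<Rightarrow> real) \<Rightarrow> (real \<Rightarrow> real) \<Rightarrow> real" where
  "L2_inner \<alpha> \<beta> u v = (LINT x:{\<alpha><..<\<beta>}|lborel. u x * v x)"

definition L2_norm :: "real \<Rightarrow> real \<Rightarrow> (real \<Rightarrow> real) \<Rightarrow> real" where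
  "L2_norm \<alpha> \<beta> v = sqrt (L2_inner \<alpha> \<beta> v v)"

definition Linf_space :: "real set \<Rightarrow> (real \<Rightarrow> real) set" where
  "Linf_space S = {v. set_borel_measurable lborel S v \<and>
     (\<exists>c. AE x in lborel. x \<in> S \<longrightarrow> \<bar>v x\<bar> \<le> c)}"

definition Linf_norm :: "real set \<Rightarrow> (real \<Rightarrow> real) \<Rightarrow> real" where
  "Linf_norm S v = Inf {c. 0 \<le> c \<and> (AE x in lborel. x \<in> S \<longrightarrow> \<bar>v x\<bar> \<le> c)}"

subsection \<open>Weak derivatives and Sobolev spaces on an interval\<close>

definition test_functions :: "real \<Rightarrow> real \<Rightarrow> (real \<Rightarrow> real) set" where
  "test_functions \<alpha> \<beta> = {\<phi>. \<phi> C1_differentiable_on UNIV \<and>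
     (\<exists>c d. \<alpha> < c \<and> c \<le> d \<and> d < \<beta> \<and> (\<forall>x. x \<notin> {c..d} \<longrightarrow> \<phi> x = 0))}"

definition weak_deriv :: "real \<Rightarrow> real \<Rightarrow> (real \<Rightarrow> real) \<Rightarrow> (real \<Rightarrow> real) \<Rightarrow> bool" where
  "weak_deriv \<alpha> \<beta> v w \<longleftrightarrow> (\<forall>\<phi>\<in>test_functions \<alpha> \<beta>.
     (LINT x:{\<alpha><..<\<beta>}|lborel. v x * deriv \<phi> x) = - (LINT x:{\<alpha><..<\<beta>}|lborel. w x * \<phi> x))"

text \<open>The weak derivative as a function; it is determined up to a null set.\<close>

definition weak_dx :: "real \<Rightarrow> real \<Rightarrow> (real \<Rightarrow> real) \<Rightarrow> real \<Rightarrow> real" where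
  "weak_dx \<alpha> \<beta> v = (SOME w. w \<in> L2_space {\<alpha><..<\<beta>} \<and> weak_deriv \<alpha> \<beta> v w)"

text \<open>In one dimension every \<open>H\<^sup>1\<close> class has a unique representative that is continuous on the closed
  interval. The set below consists of these representatives, so that point values, in particular
  boundary values, are meaningful. The space \<open>H(div)\<close> is \<open>H1\<close>.\<close>

definition H1 :: "real \<Rightarrow> real \<Rightarrow> (real \<Rightarrow> real) set" where
  "H1 \<alpha> \<beta> = {v. continuous_on {\<alpha>..\<beta>} v \<and> (\<exists>w\<in>L2_space {\<alpha><..<\<beta>}. weak_deriv \<alpha> \<beta> v w)}"

definition H10 :: "real \<Rightarrow> real \<Rightarrow> (real \<Rightarrow> real) set" where
  "H10 \<alpha> \<beta> = {v \<in> H1 \<alpha> \<beta>. v \<alpha> = 0 \<and> v \<beta> = 0}"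

definition W1inf :: "real \<Rightarrow> real \<Rightarrow> (real \<Rightarrow> real) set" where
  "W1inf \<alpha> \<beta> = {v \<in> Linf_space {\<alpha><..<\<beta>}. \<exists>w\<in>Linf_space {\<alpha><..<\<beta>}. weak_deriv \<alpha> \<beta> v w}"

definition W1inf_norm :: "real \<Rightarrow> real \<Rightarrow> (real \<Rightarrow> real) \<Rightarrow> real" where
  "W1inf_norm \<alpha> \<beta> v =
     max (Linf_norm {\<alpha><..<\<beta>} v) (Linf_norm {\<alpha><..<\<beta>} (weak_dx \<alpha> \<beta> v))"

subsection \<open>Meshes and piecewise spaces\<close>

text \<open>A mesh is given by the number \<open>N\<close> of elements and the nodes \<open>x 0, \<dots>, x N\<close>.\<close>

definition is_mesh :: "real \<Rightarrow> real \<Rightarrow> nat \<Rightarrow> (nat \<Rightarrow> real) \<Rightarrow> bool" where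
  "is_mesh xL xR N x \<longleftrightarrow> 1 \<le> N \<and> x 0 = xL \<and> x N = xR \<and> (\<forall>n\<in>{1..N}. x (n - 1) < x n)"

definition mesh_size :: "nat \<Rightarrow> (nat \<Rightarrow> real) \<Rightarrow> real" where
  "mesh_size N x = Max ((\<lambda>n. \<bar>x n - x (n - 1)\<bar>) ` {1..N})"

definition W1inf_mesh :: "nat \<Rightarrow> (nat \<Rightarrow> real) \<Rightarrow> (real \<Rightarrow> real) set" where
  "W1inf_mesh N x = {v. \<forall>n\<in>{1..N}. v \<in> W1inf (x (n - 1)) (x n)}"

definition W1inf_mesh_norm :: "nat \<Rightarrow> (nat \<Rightarrow> real) \<Rightarrow> (real \<Rightarrow> real) \<Rightarrow> real" where
  "W1inf_mesh_norm N x v = Max ((\<lambda>n. W1inf_norm (x (n - 1)) (x n) v) ` {1..N})"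

text \<open>Piecewise polynomials need not be continuous, and their values at the nodes are irrelevant.
  Being bounded and measurable, they belong to \<open>L\<^sup>2\<close>.\<close>

definition pw_poly :: "nat \<Rightarrow> nat \<Rightarrow> (nat \<Rightarrow> real) \<Rightarrow> (real \<Rightarrow> real) set" where
  "pw_poly k N x = {v. \<forall>n\<in>{1..N}. \<exists>q::real poly. degree q \<le> k \<and>
     (\<forall>y\<in>{x (n - 1)<..<x n}. v y = poly q y)}"

definition Q_space :: "nat \<Rightarrow> nat \<Rightarrow> (nat \<Rightarrow> real) \<Rightarrow> (real \<Rightarrow> real) set" where
  "Q_space k N x = pw_poly k N x \<inter> H10 (x 0) (x N)"

definition V_space :: "nat \<Rightarrow> nat \<Rightarrow> (nat \<Rightarrow> real) \<Rightarrow> (real \<Rightarrow> real) set" where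
  "V_space k N x = pw_poly k N x \<inter> H1 (x 0) (x N)"

definition interp :: "nat \<Rightarrow> nat \<Rightarrow> (nat \<Rightarrow> real) \<Rightarrow> (real \<Rightarrow> real) \<Rightarrow> real \<Rightarrow> real" where
  "interp k N x v = (SOME w. w \<in> pw_poly k N x \<inter> H1 (x 0) (x N) \<and>
     (\<forall>n\<in>{0..N}. w (x n) = v (x n)) \<and>
     (\<forall>q\<in>pw_poly (k - 1) N x.
        L2_inner (x 0) (x N) (weak_dx (x 0) (x N) w) q =
        L2_inner (x 0) (x N) (weak_dx (x 0) (x N) v) q))"

definition L2_proj :: "nat \<Rightarrow> nat \<Rightarrow> (nat \<Rightarrow> real) \<Rightarrow> (real \<Rightarrow> real) \<Rightarrow> real \<Rightarrow> real" where
  "L2_proj j N x v = (SOME w. w \<in> pw_poly j N x \<and>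
     (\<forall>q\<in>pw_poly j N x. L2_inner (x 0) (x N) w q = L2_inner (x 0) (x N) v q))"

subsection \<open>Functions of time\<close>

text \<open>\<open>H1_time T \<alpha> \<beta> X u u'\<close>: the function \<open>u\<close> belongs to \<open>H\<^sup>1(0,T;X)\<close> and has the weak time derivative
  \<open>u'\<close>. This is meant for finite-dimensional spaces \<open>X\<close> of functions that are continuous on
  \<open>[\<alpha>,\<beta>]\<close>; for such \<open>X\<close>, square integrability and weak differentiability with values in \<open>X\<close> are
  equivalent to the same properties of all point evaluations. As in \<open>H1\<close>, the representative of \<open>u\<close>
  is the one that is continuous in time.\<close>

definition H1_time ::
  "real \<Rightarrow> real \<Rightarrow> real \<Rightarrow> (real \<Rightarrow> real) set \<Rightarrow> (real \<Rightarrow> real \<Rightarrow> real) \<Rightarrow> (real \<Rightarrow> real \<Rightarrow> real) \<Rightarrow> bool"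
where
  "H1_time T \<alpha> \<beta> X u u' \<longleftrightarrow>
     (\<forall>t\<in>{0..T}. u t \<in> X \<and> u' t \<in> X) \<and>
     (\<forall>y\<in>{\<alpha>..\<beta>}. continuous_on {0..T} (\<lambda>t. u t y) \<and>
        (\<lambda>t. u' t y) \<in> L2_space {0<..<T} \<and>
        weak_deriv 0 T (\<lambda>t. u t y) (\<lambda>t. u' t y))"

text \<open>\<open>Cr_norm_le r T \<alpha> \<beta> u K\<close>: the function \<open>u\<close> of \<open>(t, y)\<close> is \<open>r\<close> times continuously differentiable
  on \<open>[0,T] \<times> [\<alpha>,\<beta>]\<close> (one-sided at the boundary), and all its partial derivatives \<open>D i j\<close>, of order
  \<open>i\<close> in time and \<open>j\<close> in space with \<open>i + j \<le> r\<close>, are bounded by \<open>K\<close>.\<close>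

definition Cr_norm_le ::
  "nat \<Rightarrow> real \<Rightarrow> real \<Rightarrow> real \<Rightarrow> (real \<Rightarrow> real \<Rightarrow> real) \<Rightarrow> real \<Rightarrow> bool"
where
  "Cr_norm_le r T \<alpha> \<beta> u K \<longleftrightarrow> (\<exists>D :: nat \<Rightarrow> nat \<Rightarrow> real \<Rightarrow> real \<Rightarrow> real.
     (\<forall>t\<in>{0..T}. \<forall>y\<in>{\<alpha>..\<beta>}. D 0 0 t y = u t y) \<and>
     (\<forall>i j. i + j < r \<longrightarrow> (\<forall>t\<in>{0..T}. \<forall>y\<in>{\<alpha>..\<beta>}.
        ((\<lambda>s. D i j s y) has_real_derivative D (Suc i) j t y) (at t within {0..T}) \<and>
        ((\<lambda>z. D i j t z) has_real_derivative D i (Suc j) t y) (at y within {\<alpha>..\<beta>}))) \<and>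
     (\<forall>i j. i + j \<le> r \<longrightarrow>
        continuous_on ({0..T} \<times> {\<alpha>..\<beta>}) (\<lambda>(t, y). D i j t y) \<and>
        (\<forall>t\<in>{0..T}. \<forall>y\<in>{\<alpha>..\<beta>}. \<bar>D i j t y\<bar> \<le> K)))"

subsection \<open>The continuous problem and the method\<close>

text \<open>The derivatives below are classical and are evaluated only at interior points. Since \<open>f\<close> and \<open>g\<close>
  are \<open>L\<^sup>2\<close> functions, and \<open>d\<close> is an \<open>L\<^sup>\<infinity>\<close> function, the equations hold almost everywhere.\<close>

definition exact_solution ::
  "real \<Rightarrow> real \<Rightarrow> (real \<Rightarrow> real) \<Rightarrow> real \<Rightarrow> real \<Rightarrow> real \<Rightarrow>
   (real \<Rightarrow> real \<Rightarrow> real) \<Rightarrow> (real \<Rightarrow> real \<Rightarrow> real) \<Rightarrow>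
   (real \<Rightarrow> real \<Rightarrow> real) \<Rightarrow> (real \<Rightarrow> real \<Rightarrow> real) \<Rightarrow> bool"
where
  "exact_solution a b d xL xR T f g p m \<longleftrightarrow>
     (AE t in lborel. t \<in> {0<..<T} \<longrightarrow> (AE y in lborel. y \<in> {xL<..<xR} \<longrightarrow>
        a * deriv (\<lambda>s. p s y) t + deriv (m t) y = f t y \<and>
        b * deriv (\<lambda>s. m s y) t + deriv (p t) y + d y * m t y = g t y)) \<and>
     (\<forall>t\<in>{0..T}. p t xL = 0 \<and> p t xR = 0)"

text \<open>Time derivatives of \<open>H\<^sup>1(0,T)\<close> functions are defined for almost every \<open>t\<close> only, so the
  variational equations are required for almost every \<open>t\<close>.\<close>

definition petrov_galerkin_solution ::
  "real \<Rightarrow> real \<Rightarrow> (real \<Rightarrow> real) \<Rightarrow> real \<Rightarrow> real \<Rightarrow> real \<Rightarrow>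
   (real \<Rightarrow> real \<Rightarrow> real) \<Rightarrow> (real \<Rightarrow> real \<Rightarrow> real) \<Rightarrow>
   (real \<Rightarrow> real) \<Rightarrow> (real \<Rightarrow> real) \<Rightarrow> nat \<Rightarrow> nat \<Rightarrow> (nat \<Rightarrow> real) \<Rightarrow>
   (real \<Rightarrow> real \<Rightarrow> real) \<Rightarrow> (real \<Rightarrow> real \<Rightarrow> real) \<Rightarrow> bool"
where
  "petrov_galerkin_solution a b d xL xR T f g p0 m0 k N x ph mh \<longleftrightarrow> (\<exists>ph' mh'.
     H1_time T xL xR (Q_space k N x) ph ph' \<and>
     H1_time T xL xR (V_space k N x) mh mh' \<and>
     (\<forall>y\<in>{xL..xR}. ph 0 y = interp k N x p0 y \<and> mh 0 y = interp k N x m0 y) \<and>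
     (AE t in lborel. t \<in> {0<..<T} \<longrightarrow>
        (\<forall>q\<in>pw_poly (k - 1) N x.
           L2_inner xL xR (\<lambda>y. a * ph' t y) q + L2_inner xL xR (weak_dx xL xR (mh t)) q
             = L2_inner xL xR (f t) q) \<and>
        (\<forall>v\<in>pw_poly (k - 1) N x.
           L2_inner xL xR (\<lambda>y. b * mh' t y) v + L2_inner xL xR (weak_dx xL xR (ph t)) v
             + L2_inner xL xR (\<lambda>y. d y * L2_proj (k - 1) N x (mh t) y) v
             = L2_inner xL xR (g t) v)))"

end

theory Submission
  imports Defs
begin

text \<open>
Let \<open>E = ph - I p\<close> and \<open>F = mh - I m\<close>, where \<open>I\<close> is the interpolant, let \<open>\<pi>\<close> be the \<open>L\<^sup>2\<close> projection onto
piecewise polynomials of degree \<open>k - 1\<close>, and let \<open>h\<close> be the mesh size. The derivative of \<open>I v\<close> is the projection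
of the derivative of \<open>v\<close>. Hence the derivatives in space of the interpolation errors drop out of the error
equations, which read, for piecewise polynomials \<open>q\<close> and \<open>v\<close> of degree \<open>k - 1\<close>,

  \<open>a (E', q) + (\<partial>F, q) = a (\<rho>, q)\<close>  and  \<open>b (F', v) + (\<partial>E, v) + (d \<pi> F, v) = b (\<sigma>, v) + (d (m - \<pi> I m), v)\<close>.

Here \<open>\<rho>\<close> and \<open>\<sigma>\<close> are the interpolation errors of the time derivatives of \<open>p\<close> and \<open>m\<close>, of order \<open>h\<close> to the power
\<open>k + 1\<close>. The last term is a priori one order worse because of \<open>m - \<pi> m\<close>. But the product of \<open>m - \<pi> m\<close> with a test
function has mean value zero on each element, and integrating it by parts against \<open>d\<close> recovers the missing
power of \<open>h\<close> (\<open>weighted_proj_error_le\<close>); this is where the derivative of \<open>d\<close> on each element enters.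

Now test with \<open>\<pi> E\<close> and \<open>\<pi> F\<close>. As \<open>\<partial>E\<close> and \<open>\<partial>F\<close> have degree \<open>k - 1\<close>, the projections may be dropped in
\<open>(\<partial>F, \<pi> E) + (\<partial>E, \<pi> F)\<close>, and the boundary values of \<open>E\<close> make the sum vanish (\<open>skew_symmetry\<close>). The energy
of \<open>(\<pi> E, \<pi> F)\<close> is therefore bounded by the residuals. This does not bound \<open>E\<close> and \<open>F\<close>, because \<open>\<pi>\<close> is not
stably invertible on continuous piecewise polynomials: oscillating functions have small projections. What
is missing is controlled by the derivatives, since the norm of \<open>E - \<pi> E\<close> is at most \<open>h\<close> times that of \<open>\<partial>E\<close>
(\<open>inner_self_poly_le\<close>), and by the error equations \<open>\<partial>E\<close> and \<open>\<partial>F\<close> are bounded once the time derivatives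
of \<open>\<pi> E\<close> and \<open>\<pi> F\<close> are. These obey a second energy estimate, for time differences instead of derivatives, as \<open>E\<close>
and \<open>F\<close> have only one derivative in time. Its initial value is bounded by the first estimate because
\<open>E\<close> and \<open>F\<close> vanish at time zero (\<open>stability\<close>).

All this is carried out in coordinates, the moments with respect to an orthonormal basis of polynomials on each
element. The moments of the discrete solution are continuously differentiable in time, since the equations
express their weak derivatives by continuous functions (\<open>discrete_coef_has_derivative\<close>). No inverse
inequality is used, so the constants do not depend on the mesh.

The tool for weak derivatives is \<open>weak_deriv_zero_boundary\<close>: the defining identity extends from compactly
supported test functions to continuously differentiable functions with zero boundary values. It gives both the
integration by parts against \<open>d\<close> and the regularity in time.
\<close>

section \<open>Square-integrable functions on an interval\<close>

lemma set_integrable_continuous_open: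
  fixes f :: "real \<Rightarrow> real"
  assumes "continuous_on {c..d} f"
  shows "set_integrable lborel {c<..<d} f"
  by (rule set_integrable_subset[OF borel_integrable_atLeastAtMost'[OF assms]]) auto

lemma set_lebesgue_integral_open_eq_integral:
  fixes f :: "real \<Rightarrow> real"
  assumes "continuous_on {c..d} f"
  shows "(LINT x:{c<..<d}|lborel. f x) = integral {c..d} f"
  using set_borel_integral_eq_integral(2)[OF set_integrable_continuous_open[OF assms]]
  by (simp add: integral_open_interval_real)

lemma L2_space_mult_integrable:
  fixes u v :: "'a::euclidean_space \<Rightarrow> real"
  assumes "u \<in> L2_space S" "v \<in> L2_space S"
  shows "set_integrable lborel S (\<lambda>x. u x * v x)"
proof -
  let ?I = "indicator S :: 'a \<Rightarrow> real"
  have m: "(\<lambda>x. ?I x *\<^sub>R u x) \<in> borel_measurable lborel" "(\<lambda>x. ?I x *\<^sub>R v x) \<in> borel_measurable lborel"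
    using assms unfolding L2_space_def set_borel_measurable_def by blast+
  have i: "integrable lborel (\<lambda>x. ?I x *\<^sub>R (u x)\<^sup>2 + ?I x *\<^sub>R (v x)\<^sup>2)"
    using assms unfolding L2_space_def set_integrable_def
    by (intro Bochner_Integration.integrable_add) blast+
  have e: "(\<lambda>x. (?I x *\<^sub>R u x) * (?I x *\<^sub>R v x)) = (\<lambda>x. ?I x *\<^sub>R (u x * v x))"
    by (rule ext) (simp add: indicator_def)
  have m': "(\<lambda>x. ?I x *\<^sub>R (u x * v x)) \<in> borel_measurable lborel"
    unfolding e[symmetric] by (rule borel_measurable_times[OF m])
  have b: "norm (?I x *\<^sub>R (u x * v x)) \<le> norm (?I x *\<^sub>R (u x)\<^sup>2 + ?I x *\<^sub>R (v x)\<^sup>2)" for x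
  proof -
    have "0 \<le> (\<bar>u x\<bar> - \<bar>v x\<bar>)\<^sup>2" by simp
    hence "2 * (\<bar>u x\<bar> * \<bar>v x\<bar>) \<le> (u x)\<^sup>2 + (v x)\<^sup>2" by (simp add: power2_diff)
    moreover have "0 \<le> \<bar>u x\<bar> * \<bar>v x\<bar>" by simp
    ultimately have "\<bar>u x * v x\<bar> \<le> (u x)\<^sup>2 + (v x)\<^sup>2" unfolding abs_mult by linarith
    then show ?thesis by (cases "x \<in> S") simp_all
  qed
  show ?thesis
    unfolding set_integrable_def by (rule Bochner_Integration.integrable_bound[OF i m' AE_I2[OF b]])
qed

lemma L2_spaceI_continuous:
  fixes u :: "real \<Rightarrow> real"
  assumes "continuous_on {c..d} u"
  shows "u \<in> L2_space {c<..<d}"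
  using set_integrable_continuous_open[OF assms]
    set_integrable_continuous_open[of c d "\<lambda>x. (u x)\<^sup>2"] assms
  by (auto simp: L2_space_def set_borel_measurable_def set_integrable_def intro!: continuous_intros)

lemma L2_space_scale:
  fixes u :: "real \<Rightarrow> real"
  assumes "u \<in> L2_space S"
  shows "(\<lambda>x. r * u x) \<in> L2_space S"
proof -
  have "(\<lambda>x. r * (indicator S x *\<^sub>R u x)) \<in> borel_measurable lborel"
    using assms by (auto simp: L2_space_def set_borel_measurable_def)
  thus ?thesis using assms
    by (auto simp: L2_space_def set_borel_measurable_def power_mult_distrib mult.left_commute)
qed

lemma L2_space_add:
  fixes u v :: "real \<Rightarrow> real"
  assumes "u \<in> L2_space S" "v \<in> L2_space S"
  shows "(\<lambda>x. u x + v x) \<in> L2_space S"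
proof -
  have "(\<lambda>x. (indicator S x *\<^sub>R u x) + (indicator S x *\<^sub>R v x)) \<in> borel_measurable lborel"
    using assms by (auto simp: L2_space_def set_borel_measurable_def)
  moreover have "set_integrable lborel S (\<lambda>x. (u x)\<^sup>2 + (v x)\<^sup>2 + 2 * (u x * v x))"
    using assms L2_space_mult_integrable[OF assms]
    by (auto simp: L2_space_def intro!: set_integral_add(1))
  ultimately show ?thesis
    by (auto simp: L2_space_def set_borel_measurable_def power2_sum scaleR_add_right algebra_simps)
qed

lemma L2_space_diff:
  fixes u v :: "real \<Rightarrow> real"
  assumes "u \<in> L2_space S" "v \<in> L2_space S"
  shows "(\<lambda>x. u x - v x) \<in> L2_space S"
  using L2_space_add[OF assms(1) L2_space_scale[OF assms(2), of "-1"]] by simp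

lemma L2_space_sum:
  fixes u :: "'i \<Rightarrow> real \<Rightarrow> real"
  assumes "\<And>i. i \<in> I \<Longrightarrow> u i \<in> L2_space S"
  shows "(\<lambda>x. \<Sum>i\<in>I. u i x) \<in> L2_space S"
proof -
  have "(\<lambda>x. 0) \<in> L2_space S"
    by (simp add: L2_space_def set_borel_measurable_def set_integrable_def)
  with assms show ?thesis
    by (induction I rule: infinite_finite_induct) (simp_all add: L2_space_add)
qed

lemma Linf_mult_L2_space:
  fixes d u :: "real \<Rightarrow> real"
  assumes "d \<in> Linf_space S" "u \<in> L2_space S"
  shows "(\<lambda>x. d x * u x) \<in> L2_space S"
proof -
  have m0: "(\<lambda>x. indicator S x *\<^sub>R u x) \<in> borel_measurable lborel"
    "(\<lambda>x. indicator S x *\<^sub>R d x) \<in> borel_measurable lborel"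
    using assms unfolding L2_space_def Linf_space_def set_borel_measurable_def by blast+
  obtain c where c: "AE x in lborel. x \<in> S \<longrightarrow> \<bar>d x\<bar> \<le> c"
    using assms by (auto simp: Linf_space_def)
  have m: "(\<lambda>x. (indicator S x *\<^sub>R d x) * (indicator S x *\<^sub>R u x)) \<in> borel_measurable lborel"
    "(\<lambda>x. ((indicator S x *\<^sub>R d x) * (indicator S x *\<^sub>R u x))\<^sup>2) \<in> borel_measurable lborel"
    by (rule borel_measurable_times borel_measurable_power m0)+
  have e: "(\<lambda>x. (indicator S x *\<^sub>R d x) * (indicator S x *\<^sub>R u x)) = (\<lambda>x. indicator S x *\<^sub>R (d x * u x))"
    "(\<lambda>x. ((indicator S x *\<^sub>R d x) * (indicator S x *\<^sub>R u x))\<^sup>2) = (\<lambda>x. indicator S x *\<^sub>R (d x * u x)\<^sup>2)"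
    by (auto simp: indicator_def)
  have "integrable lborel (\<lambda>x. c\<^sup>2 * (indicator S x *\<^sub>R (u x)\<^sup>2))"
    using assms by (auto simp: L2_space_def set_integrable_def)
  hence "integrable lborel (\<lambda>x. indicator S x *\<^sub>R (d x * u x)\<^sup>2)"
  proof (rule Bochner_Integration.integrable_bound)
    show "(\<lambda>x. indicator S x *\<^sub>R (d x * u x)\<^sup>2) \<in> borel_measurable lborel" using m(2) unfolding e .
    show "AE x in lborel. norm (indicator S x *\<^sub>R (d x * u x)\<^sup>2) \<le> norm (c\<^sup>2 * (indicator S x *\<^sub>R (u x)\<^sup>2))"
      using c
    proof eventually_elim
      case (elim x)
      have "x \<in> S \<Longrightarrow> (d x)\<^sup>2 \<le> c\<^sup>2" using elim power_mono[of "\<bar>d x\<bar>" c 2] by simp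
      thus ?case by (auto simp: indicator_def power_mult_distrib mult_right_mono)
    qed
  qed
  thus ?thesis using m(1) unfolding e L2_space_def set_borel_measurable_def set_integrable_def by blast
qed

lemma L2_space_integrable:
  fixes u :: "real \<Rightarrow> real"
  assumes "u \<in> L2_space {c<..<d}"
  shows "set_integrable lborel {c<..<d} u"
  using L2_space_mult_integrable[OF assms L2_spaceI_continuous[of c d "\<lambda>_. 1"]] by simp

lemma Linf_subset_L2:
  assumes "w \<in> Linf_space {c<..<d}"
  shows "w \<in> L2_space {c<..<d}"
  using Linf_mult_L2_space[OF assms L2_spaceI_continuous[of c d "\<lambda>_. 1"]] by simp

lemma L2_inner_commute: "L2_inner c d u v = L2_inner c d v u"
  by (simp add: L2_inner_def mult.commute)

lemma L2_inner_add_left: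
  assumes "u \<in> L2_space {c<..<d}" "u' \<in> L2_space {c<..<d}" "v \<in> L2_space {c<..<d}"
  shows "L2_inner c d (\<lambda>x. u x + u' x) v = L2_inner c d u v + L2_inner c d u' v"
  using L2_space_mult_integrable[OF assms(1,3)] L2_space_mult_integrable[OF assms(2,3)]
  by (simp add: L2_inner_def distrib_right)

lemma L2_inner_diff_left:
  assumes "u \<in> L2_space {c<..<d}" "u' \<in> L2_space {c<..<d}" "v \<in> L2_space {c<..<d}"
  shows "L2_inner c d (\<lambda>x. u x - u' x) v = L2_inner c d u v - L2_inner c d u' v"
  using L2_space_mult_integrable[OF assms(1,3)] L2_space_mult_integrable[OF assms(2,3)]
  by (simp add: L2_inner_def left_diff_distrib)

lemma L2_inner_scale_left: "L2_inner c d (\<lambda>x. r * u x) v = r * L2_inner c d u v"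
  by (simp add: L2_inner_def mult.assoc)

lemma L2_inner_zero_left [simp]: "L2_inner c d (\<lambda>x. 0) v = 0"
  by (simp add: L2_inner_def)

lemma L2_inner_sum_left:
  assumes "\<And>i. i \<in> I \<Longrightarrow> u i \<in> L2_space {c<..<d}" "v \<in> L2_space {c<..<d}"
  shows "L2_inner c d (\<lambda>x. \<Sum>i\<in>I. r i * u i x) v = (\<Sum>i\<in>I. r i * L2_inner c d (u i) v)"
  using assms(1)
proof (induction I rule: infinite_finite_induct)
  case (insert i I)
  have "L2_inner c d (\<lambda>x. r i * u i x + (\<Sum>i\<in>I. r i * u i x)) v
      = L2_inner c d (\<lambda>x. r i * u i x) v + L2_inner c d (\<lambda>x. \<Sum>i\<in>I. r i * u i x) v"
    using insert assms(2) by (intro L2_inner_add_left L2_space_scale L2_space_sum) auto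
  thus ?case using insert by (simp add: L2_inner_scale_left)
qed auto

lemma L2_inner_self_nonneg: "0 \<le> L2_inner c d u u"
  unfolding L2_inner_def set_lebesgue_integral_def
  by (intro integral_nonneg_AE) auto

lemma L2_inner_cong:
  assumes "\<And>x. x \<in> {c<..<d} \<Longrightarrow> u x = u' x" "\<And>x. x \<in> {c<..<d} \<Longrightarrow> v x = v' x"
  shows "L2_inner c d u v = L2_inner c d u' v'"
  unfolding L2_inner_def using assms by (intro set_lebesgue_integral_cong) auto

lemma L2_inner_cong_AE:
  fixes u u' v :: "real \<Rightarrow> real"
  assumes "set_borel_measurable lborel {c<..<d} u" "set_borel_measurable lborel {c<..<d} u'"
    "set_borel_measurable lborel {c<..<d} v"
    "AE x in lborel. x \<in> {c<..<d} \<longrightarrow> u x = u' x"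
  shows "L2_inner c d u v = L2_inner c d u' v"
proof -
  have m: "(\<lambda>x. indicator {c<..<d} x *\<^sub>R (h x * v x)) \<in> borel_measurable lborel"
    if "set_borel_measurable lborel {c<..<d} h" for h :: "real \<Rightarrow> real"
  proof -
    have "(\<lambda>x. (indicator {c<..<d} x *\<^sub>R h x) * (indicator {c<..<d} x *\<^sub>R v x)) \<in> borel_measurable lborel"
      using that assms(3) unfolding set_borel_measurable_def by (rule borel_measurable_times)
    moreover have "(\<lambda>x. (indicator {c<..<d} x *\<^sub>R h x) * (indicator {c<..<d} x *\<^sub>R v x))
       = (\<lambda>x. indicator {c<..<d} x *\<^sub>R (h x * v x))" by (auto simp: indicator_def)
    ultimately show ?thesis by simp
  qed
  show ?thesis unfolding L2_inner_def set_lebesgue_integral_def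
    using assms(4) by (intro integral_cong_AE m assms) (auto simp: indicator_def elim!: eventually_mono)
qed

lemma quadratic_nonneg_imp:
  fixes A B C :: real
  assumes "\<And>s. 0 \<le> A - 2 * s * B + s\<^sup>2 * C" "0 \<le> C"
  shows "B\<^sup>2 \<le> A * C"
proof (cases "C = 0")
  case True
  have "B = 0"
  proof (rule ccontr)
    assume "B \<noteq> 0"
    then have "2 * ((A + 1) / (2 * B)) * B = A + 1" by simp
    with assms(1)[of "(A + 1) / (2 * B)"] True show False by simp
  qed
  with True show ?thesis by simp
next
  case False
  hence C: "C > 0" using assms by simp
  have "0 \<le> C * (A - 2 * (B / C) * B + (B / C)\<^sup>2 * C)"
    using assms(1)[of "B / C"] C by (intro mult_nonneg_nonneg) auto
  also have "\<dots> = C * A - 2 * (B / C * C) * B + (B / C * C)\<^sup>2"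
    by (simp only: power2_eq_square algebra_simps)
  also have "\<dots> = A * C - B\<^sup>2" using C by (simp add: power2_eq_square)
  finally show ?thesis by simp
qed

lemma L2_Cauchy_Schwarz:
  assumes "u \<in> L2_space {c<..<d}" "v \<in> L2_space {c<..<d}"
  shows "(L2_inner c d u v)\<^sup>2 \<le> L2_inner c d u u * L2_inner c d v v"
proof (rule quadratic_nonneg_imp)
  fix s :: real
  note sv = L2_space_scale[OF assms(2), of s]
  note usv = L2_space_diff[OF assms(1) sv]
  have r: "L2_inner c d w (\<lambda>x. u x - s * v x) = L2_inner c d w u - s * L2_inner c d w v"
    if "w \<in> L2_space {c<..<d}" for w
    using L2_inner_diff_left[OF assms(1) sv that] L2_inner_scale_left[of c d s v w]
    by (simp add: L2_inner_commute[of c d w])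
  have "0 \<le> L2_inner c d (\<lambda>x. u x - s * v x) (\<lambda>x. u x - s * v x)"
    by (rule L2_inner_self_nonneg)
  also have "\<dots> = L2_inner c d u (\<lambda>x. u x - s * v x) - s * L2_inner c d v (\<lambda>x. u x - s * v x)"
    using L2_inner_diff_left[OF assms(1) sv usv] by (simp add: L2_inner_scale_left)
  also have "\<dots> = L2_inner c d u u - 2 * s * L2_inner c d u v + s\<^sup>2 * L2_inner c d v v"
    by (simp add: r[OF assms(1)] r[OF assms(2)] L2_inner_commute[of c d v u] power2_eq_square algebra_simps)
  finally show "0 \<le> L2_inner c d u u - 2 * s * L2_inner c d u v + s\<^sup>2 * L2_inner c d v v" .
qed (rule L2_inner_self_nonneg)

section \<open>Weak derivatives\<close>

text \<open>Open intervals generate the Borel sets and are closed under intersection, so that the vanishing of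
  the integral passes to all Borel sets by Dynkin's argument.\<close>

lemma AE_zero_if_interval_integrals_zero:
  fixes f :: "real \<Rightarrow> real"
  assumes int: "integrable lborel f"
    and zero: "\<And>s t. (LINT x:{s<..<t}|lborel. f x) = 0"
  shows "AE x in lborel. f x = 0"
proof (rule sigma_finite_measure.density_zero[OF lborel.sigma_finite_measure_axioms int])
  fix A :: "real set" assume "A \<in> sets lborel"
  have fm: "set_integrable lborel A f" if "A \<in> sets borel" for A
    using int that unfolding set_integrable_def by (intro integrable_mult_indicator) auto
  have U: "(LINT x:UNIV|lborel. f x) = 0"
  proof -
    have "(\<lambda>n::nat. LINT x:{- real n<..<real n}|lborel. f x) \<longlonglongrightarrow> (LINT x:(\<Union>n::nat. {- real n<..<real n})|lborel. f x)"
      by (rule set_integral_cont_up) (force simp: incseq_def fm sets.countable_UN)+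
    moreover have "(\<Union>n::nat. {- real n<..<real n}) = UNIV"
    proof -
      have "\<exists>n. - real n < x \<and> x < real n" for x
      proof -
        obtain n where "\<bar>x\<bar> < real n" using reals_Archimedean2 by blast
        then show ?thesis by (intro exI[of _ n]) linarith
      qed
      thus ?thesis by auto
    qed
    ultimately show ?thesis by (simp add: zero LIMSEQ_const_iff)
  qed
  let ?G = "range (\<lambda>(s, t). {s<..<t::real})"
  have G: "sigma_sets UNIV ?G = sets borel"
    by (simp add: borel_eq_box sets_measure_of)
  have A: "A \<in> sigma_sets UNIV ?G" using \<open>A \<in> sets lborel\<close> G by simp
  have "Int_stable ?G"
  proof (rule Int_stableI)
    fix a b :: "real set" assume "a \<in> ?G" "b \<in> ?G"
    then obtain s t s' t' where "a = {s<..<t}" "b = {s'<..<t'}" by auto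
    then have "a \<inter> b = {max s s'<..<min t t'}" by auto
    then show "a \<inter> b \<in> ?G" by (intro image_eqI[where x="(max s s', min t t')"]) simp_all
  qed
  moreover have "?G \<subseteq> Pow UNIV" by simp
  ultimately show "(LINT x:A|lborel. f x) = 0" using A
  proof (induction rule: sigma_sets_induct_disjoint)
    case (basic A) then show ?case using zero by auto
  next
    case empty then show ?case by (simp add: set_lebesgue_integral_def)
  next
    case (compl A)
    then have A: "A \<in> sets borel" using G by simp
    have "(LINT x:A \<union> (UNIV - A)|lborel. f x) = (LINT x:A|lborel. f x) + (LINT x:UNIV - A|lborel. f x)"
      using A by (intro set_integral_Un fm) auto
    then show ?case using compl U by simp
  next
    case (union B)
    then have "range B \<subseteq> sets borel" using G by simp
    then have "(LINT x:(\<Union>i. B i)|lborel. f x) = (\<Sum>i. LINT x:B i|lborel. f x)"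
      using union by (intro lebesgue_integral_countable_add fm) (auto simp: disjoint_family_on_def)
    then show ?case using union by simp
  qed
qed

text \<open>With \<open>m = max 0 z\<close>, the quotient \<open>m\<^sup>2 / (m\<^sup>2 + e\<^sup>2)\<close> is a continuously differentiable step: it vanishes
  for \<open>z \<le> 0\<close> and tends to 1 for \<open>z > 0\<close> as \<open>e\<close> tends to 0. Its derivative is \<open>step_ratio' e\<close>.\<close>

definition step_ratio :: "real \<Rightarrow> real \<Rightarrow> real" where
  "step_ratio e z = (max 0 z)\<^sup>2 / ((max 0 z)\<^sup>2 + e\<^sup>2)"

definition step_ratio' :: "real \<Rightarrow> real \<Rightarrow> real" where
  "step_ratio' e z = 2 * max 0 z * e\<^sup>2 / ((max 0 z)\<^sup>2 + e\<^sup>2)\<^sup>2"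

lemma positive_part_square_deriv: "((\<lambda>z::real. (max 0 z)\<^sup>2) has_real_derivative 2 * max 0 z) (at z)"
proof -
  consider "z > 0" | "z < 0" | "z = 0" by linarith
  then show ?thesis
  proof cases
    case 1
    have "((\<lambda>z::real. z\<^sup>2) has_real_derivative 2 * z) (at z)"
      by (auto intro!: derivative_eq_intros)
    then have "((\<lambda>z::real. (max 0 z)\<^sup>2) has_real_derivative 2 * z) (at z)"
      by (rule has_field_derivative_transform_within_open[of _ _ _ "{0<..}"]) (use 1 in auto)
    with 1 show ?thesis by simp
  next
    case 2
    have "((\<lambda>z::real. 0::real) has_real_derivative 0) (at z)" by simp
    then have "((\<lambda>z::real. (max 0 z)\<^sup>2) has_real_derivative 0) (at z)"
      by (rule has_field_derivative_transform_within_open[of _ _ _ "{..<0}"]) (use 2 in auto)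
    with 2 show ?thesis by simp
  next
    case 3
    have "(\<lambda>h::real. (max 0 h)\<^sup>2 / h) \<midarrow>0\<rightarrow> 0"
    proof (rule Lim_null_comparison)
      show "\<forall>\<^sub>F h::real in at 0. norm ((max 0 h)\<^sup>2 / h) \<le> \<bar>h\<bar>"
        by (intro always_eventually allI) (auto simp: max_def power2_eq_square)
      show "(\<lambda>h::real. \<bar>h\<bar>) \<midarrow>0\<rightarrow> 0" by (intro tendsto_rabs_zero tendsto_ident_at)
    qed
    then show ?thesis using 3 by (simp add: DERIV_def)
  qed
qed

lemma step_ratio_deriv:
  assumes "0 < e"
  shows "(step_ratio e has_real_derivative step_ratio' e z) (at z)"
proof -
  have pos: "(max 0 z)\<^sup>2 + e\<^sup>2 \<noteq> 0" using assms by (simp add: sum_power2_eq_zero_iff)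
  have "((\<lambda>z. (max 0 z)\<^sup>2 / ((max 0 z)\<^sup>2 + e\<^sup>2)) has_real_derivative
     ((2 * max 0 z) * ((max 0 z)\<^sup>2 + e\<^sup>2) - (max 0 z)\<^sup>2 * (2 * max 0 z + 0))
       / (((max 0 z)\<^sup>2 + e\<^sup>2) * ((max 0 z)\<^sup>2 + e\<^sup>2))) (at z)"
    by (intro DERIV_divide DERIV_add positive_part_square_deriv DERIV_const pos)
  moreover have "((2 * max 0 z) * ((max 0 z)\<^sup>2 + e\<^sup>2) - (max 0 z)\<^sup>2 * (2 * max 0 z + 0))
       / (((max 0 z)\<^sup>2 + e\<^sup>2) * ((max 0 z)\<^sup>2 + e\<^sup>2)) = step_ratio' e z"
    by (simp add: step_ratio'_def power2_eq_square algebra_simps)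
  ultimately show ?thesis unfolding step_ratio_def[abs_def] by simp
qed

lemma continuous_step_ratio': "0 < e \<Longrightarrow> continuous_on UNIV (step_ratio' e)"
proof -
  assume e: "0 < e"
  have "(max 0 z)\<^sup>2 + e\<^sup>2 \<noteq> 0" for z
    using e by (simp add: sum_power2_eq_zero_iff)
  then show ?thesis unfolding step_ratio'_def[abs_def]
    by (intro continuous_intros ballI power_not_zero)
qed

lemma step_ratio_bounds: "0 \<le> step_ratio e z" "step_ratio e z \<le> 1"
proof -
  show "0 \<le> step_ratio e z" by (simp add: step_ratio_def)
  have "0 \<le> (max 0 z)\<^sup>2 + e\<^sup>2" "(max 0 z)\<^sup>2 \<le> (max 0 z)\<^sup>2 + e\<^sup>2" by simp_all
  then show "step_ratio e z \<le> 1"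
    unfolding step_ratio_def divide_le_eq_1 by linarith
qed

lemma step_ratio'_nonneg: "0 \<le> step_ratio' e z"
  by (auto simp: step_ratio'_def)

lemma step_ratio_nonpos: "z \<le> 0 \<Longrightarrow> step_ratio e z = 0" "z \<le> 0 \<Longrightarrow> step_ratio' e z = 0"
  by (auto simp: step_ratio_def step_ratio'_def)

text \<open>The product of the slope of the cutoff with the distance to the endpoint stays bounded as the
  cutoff becomes steeper; this is what makes a factor that vanishes linearly at the endpoint sufficient.\<close>

lemma step_ratio'_bound:
  assumes "0 < e"
  shows "step_ratio' e (z - e) * \<bar>z\<bar> \<le> 2"
proof (cases "z \<le> e")
  case True then show ?thesis by (simp add: step_ratio_nonpos)
next
  case False
  define m where "m = z - e"
  have m: "m > 0" "z = m + e" using False by (auto simp: m_def)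
  have "m * e^3 \<le> (m\<^sup>2 + e\<^sup>2) * e\<^sup>2"
  proof -
    have "0 \<le> (m - e)\<^sup>2" by simp
    hence "m * e \<le> m\<^sup>2 + e\<^sup>2" using mult_pos_pos[OF m(1) assms] by (simp add: power2_diff)
    hence "(m * e) * e\<^sup>2 \<le> (m\<^sup>2 + e\<^sup>2) * e\<^sup>2" by (rule mult_right_mono) simp
    thus ?thesis by (simp add: power3_eq_cube power2_eq_square algebra_simps)
  qed
  then have "2 * m * e\<^sup>2 * (m + e) \<le> 2 * (m\<^sup>2 + e\<^sup>2)\<^sup>2"
  proof -
    have "2 * m * e\<^sup>2 * (m + e) = 2 * (m\<^sup>2 * e\<^sup>2 + m * e^3)"
      by (simp add: power2_eq_square power3_eq_cube algebra_simps)
    also have "\<dots> \<le> 2 * (m\<^sup>2 * (m\<^sup>2 + e\<^sup>2) + (m\<^sup>2 + e\<^sup>2) * e\<^sup>2)"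
      using \<open>m * e^3 \<le> (m\<^sup>2 + e\<^sup>2) * e\<^sup>2\<close> by (intro mult_left_mono add_mono) simp_all
    also have "\<dots> = 2 * (m\<^sup>2 + e\<^sup>2)\<^sup>2"
      by (simp add: power2_eq_square algebra_simps)
    finally show ?thesis .
  qed
  moreover have "0 < (m\<^sup>2 + e\<^sup>2)\<^sup>2" using m assms by (simp add: add_pos_pos)
  ultimately have "2 * m * e\<^sup>2 * (m + e) / (m\<^sup>2 + e\<^sup>2)\<^sup>2 \<le> 2" by (simp add: divide_le_eq)
  moreover have "step_ratio' e (z - e) * \<bar>z\<bar> = 2 * m * e\<^sup>2 * (m + e) / (m\<^sup>2 + e\<^sup>2)\<^sup>2"
    using m assms by (simp add: step_ratio'_def)
  ultimately show ?thesis by simp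
qed

lemma step_ratio_tendsto:
  assumes "0 < z"
  shows "(\<lambda>n. step_ratio (inverse (real (Suc n))) (z - inverse (real (Suc n)))) \<longlonglongrightarrow> 1"
    "(\<lambda>n. step_ratio' (inverse (real (Suc n))) (z - inverse (real (Suc n)))) \<longlonglongrightarrow> 0"
proof -
  have e: "(\<lambda>n. inverse (real (Suc n))) \<longlonglongrightarrow> 0" by (rule LIMSEQ_inverse_real_of_nat)
  have "(\<lambda>n. step_ratio (inverse (real (Suc n))) (z - inverse (real (Suc n)))) \<longlonglongrightarrow>
      (max 0 (z - 0))\<^sup>2 / ((max 0 (z - 0))\<^sup>2 + 0\<^sup>2)"
    unfolding step_ratio_def using assms by (intro tendsto_intros e) auto
  then show "(\<lambda>n. step_ratio (inverse (real (Suc n))) (z - inverse (real (Suc n)))) \<longlonglongrightarrow> 1"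
    using assms by simp
  have "(\<lambda>n. step_ratio' (inverse (real (Suc n))) (z - inverse (real (Suc n)))) \<longlonglongrightarrow>
      2 * max 0 (z - 0) * 0\<^sup>2 / ((max 0 (z - 0))\<^sup>2 + 0\<^sup>2)\<^sup>2"
    unfolding step_ratio'_def using assms by (intro tendsto_intros e) auto
  then show "(\<lambda>n. step_ratio' (inverse (real (Suc n))) (z - inverse (real (Suc n)))) \<longlonglongrightarrow> 0"
    by simp
qed

text \<open>The steps start at distance \<open>1 / (n + 1)\<close> inside \<open>(s, t)\<close>, so that the cutoff has compact support in this
  interval; as \<open>n\<close> grows it tends to the indicator of the interval.\<close>

definition cutoff :: "real \<Rightarrow> real \<Rightarrow> nat \<Rightarrow> real \<Rightarrow> real" where
  "cutoff s t n y = step_ratio (inverse (real (Suc n))) (y - s - inverse (real (Suc n)))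
     * step_ratio (inverse (real (Suc n))) (t - y - inverse (real (Suc n)))"

definition cutoff' :: "real \<Rightarrow> real \<Rightarrow> nat \<Rightarrow> real \<Rightarrow> real" where
  "cutoff' s t n y = step_ratio' (inverse (real (Suc n))) (y - s - inverse (real (Suc n)))
       * step_ratio (inverse (real (Suc n))) (t - y - inverse (real (Suc n)))
     - step_ratio (inverse (real (Suc n))) (y - s - inverse (real (Suc n)))
       * step_ratio' (inverse (real (Suc n))) (t - y - inverse (real (Suc n)))"

lemma cutoff_deriv: "(cutoff s t n has_real_derivative cutoff' s t n y) (at y)"
proof -
  let ?e = "inverse (real (Suc n))"
  have e: "?e > 0" by simp
  have "((\<lambda>y. step_ratio ?e (y - s - ?e)) has_real_derivative step_ratio' ?e (y - s - ?e) * 1) (at y)"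
    by (rule DERIV_chain2[of "step_ratio ?e"], rule step_ratio_deriv[OF e]) (auto intro!: derivative_eq_intros)
  moreover have "((\<lambda>y. step_ratio ?e (t - y - ?e)) has_real_derivative step_ratio' ?e (t - y - ?e) * (-1)) (at y)"
    by (rule DERIV_chain2[of "step_ratio ?e"], rule step_ratio_deriv[OF e]) (auto intro!: derivative_eq_intros)
  ultimately have "((\<lambda>y. step_ratio ?e (y - s - ?e) * step_ratio ?e (t - y - ?e)) has_real_derivative
     step_ratio' ?e (y - s - ?e) * 1 * step_ratio ?e (t - y - ?e)
     + step_ratio' ?e (t - y - ?e) * (-1) * step_ratio ?e (y - s - ?e)) (at y)"
    by (rule DERIV_mult)
  then show ?thesis unfolding cutoff_def[abs_def] cutoff'_def by (simp add: algebra_simps)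
qed

lemma cutoff_bounds: "0 \<le> cutoff s t n y" "cutoff s t n y \<le> 1"
  by (auto simp: cutoff_def step_ratio_bounds mult_le_one)

lemma continuous_cutoff: "continuous_on UNIV (cutoff s t n)"
  by (metis DERIV_continuous_on cutoff_deriv has_field_derivative_at_within)

lemma continuous_cutoff': "continuous_on UNIV (cutoff' s t n)"
proof -
  let ?e = "inverse (real (Suc n))"
  have e: "?e > 0" by simp
  have a: "continuous_on UNIV (step_ratio ?e)"
    by (metis DERIV_continuous_on step_ratio_deriv[OF e] has_field_derivative_at_within)
  show ?thesis unfolding cutoff'_def[abs_def]
    by (intro continuous_intros continuous_on_compose2[OF a] continuous_on_compose2[OF continuous_step_ratio'[OF e]]) auto
qed

lemma cutoff_mult_test_function:
  assumes "\<alpha> \<le> s" "t \<le> \<beta>" "\<alpha> < \<beta>"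
    and \<phi>: "\<And>y. (\<phi> has_real_derivative \<psi> y) (at y)" "continuous_on UNIV \<psi>"
  shows "(\<lambda>y. cutoff s t n y * \<phi> y) \<in> test_functions \<alpha> \<beta>"
    and "deriv (\<lambda>y. cutoff s t n y * \<phi> y) = (\<lambda>y. cutoff' s t n y * \<phi> y + cutoff s t n y * \<psi> y)"
proof -
  have d: "((\<lambda>y. cutoff s t n y * \<phi> y) has_real_derivative (cutoff' s t n y * \<phi> y + cutoff s t n y * \<psi> y)) (at y)" for y
    using DERIV_mult[OF cutoff_deriv \<phi>(1)] by (simp add: algebra_simps)
  show "deriv (\<lambda>y. cutoff s t n y * \<phi> y) = (\<lambda>y. cutoff' s t n y * \<phi> y + cutoff s t n y * \<psi> y)"
    using d by (intro ext DERIV_imp_deriv)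
  have c\<phi>: "continuous_on UNIV \<phi>"
    by (rule DERIV_continuous_on[OF has_field_derivative_at_within[OF \<phi>(1)]])
  let ?e = "inverse (real (Suc n))"
  have e: "?e > 0" by simp
  let ?c = "min (s + ?e) ((\<alpha> + \<beta>) / 2)" and ?d = "max (t - ?e) ((\<alpha> + \<beta>) / 2)"
  have z: "cutoff s t n y = 0" if "y \<notin> {?c..?d}" for y
  proof (cases "y < ?c")
    case True
    then have "y - s - ?e \<le> 0" by (auto simp: min_def split: if_splits)
    then show ?thesis by (simp add: cutoff_def step_ratio_nonpos)
  next
    case False
    then have "?d < y" using that unfolding atLeastAtMost_iff by linarith
    then have "t - y - ?e \<le> 0" by linarith
    then show ?thesis by (simp add: cutoff_def step_ratio_nonpos)
  qed
  have i: "\<alpha> < ?c" "?c \<le> ?d" "?d < \<beta>"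
    using assms e by (auto simp del: inverse_positive_iff_positive simp: min_less_iff_conj less_max_iff_disj)
  have "(\<lambda>y. cutoff s t n y * \<phi> y) C1_differentiable_on UNIV"
    unfolding C1_differentiable_on_def
    using d continuous_cutoff continuous_cutoff' c\<phi> \<phi>(2)
    by (intro exI[of _ "\<lambda>y. cutoff' s t n y * \<phi> y + cutoff s t n y * \<psi> y"])
       (auto simp: has_real_derivative_iff_has_vector_derivative intro!: continuous_intros)
  moreover have "\<exists>c d. \<alpha> < c \<and> c \<le> d \<and> d < \<beta> \<and> (\<forall>x. x \<notin> {c..d} \<longrightarrow> cutoff s t n x * \<phi> x = 0)"
    by (rule exI[of _ ?c], rule exI[of _ ?d]) (intro conjI i allI impI, subst z, simp_all only: mult_zero_left not_False_eq_True)
  ultimately show "(\<lambda>y. cutoff s t n y * \<phi> y) \<in> test_functions \<alpha> \<beta>"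
    unfolding test_functions_def by blast
qed

lemma cutoff_tendsto:
  assumes "s < y" "y < t"
  shows "(\<lambda>n. cutoff s t n y) \<longlonglongrightarrow> 1" "(\<lambda>n. cutoff' s t n y) \<longlonglongrightarrow> 0"
proof -
  have *: "0 < y - s" "0 < t - y" using assms by auto
  note l = step_ratio_tendsto[OF *(1)] step_ratio_tendsto[OF *(2)]
  show "(\<lambda>n. cutoff s t n y) \<longlonglongrightarrow> 1" unfolding cutoff_def
    using tendsto_mult[OF l(1) l(3)] by simp
  show "(\<lambda>n. cutoff' s t n y) \<longlonglongrightarrow> 0" unfolding cutoff'_def
    using tendsto_diff[OF tendsto_mult[OF l(2) l(3)] tendsto_mult[OF l(1) l(4)]] by simp
qed

lemma cutoff_outside: "y \<notin> {s<..<t} \<Longrightarrow> cutoff s t n y = 0"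
  unfolding cutoff_def
proof -
  assume "y \<notin> {s<..<t}"
  moreover have "0 < inverse (real (Suc n))" by simp
  ultimately have "y - s - inverse (real (Suc n)) \<le> 0 \<or> t - y - inverse (real (Suc n)) \<le> 0"
    by (auto simp del: inverse_positive_iff_positive)
  then show "step_ratio (inverse (real (Suc n))) (y - s - inverse (real (Suc n)))
     * step_ratio (inverse (real (Suc n))) (t - y - inverse (real (Suc n))) = 0"
    by (auto simp: step_ratio_nonpos)
qed

text \<open>The cutoffs are test functions tending boundedly to indicators of intervals. Hence two weak derivatives
  have the same integral over every interval.\<close>

lemma weak_deriv_unique:
  assumes "\<alpha> < \<beta>" "weak_deriv \<alpha> \<beta> v w" "weak_deriv \<alpha> \<beta> v w'"
    and int: "set_integrable lborel {\<alpha><..<\<beta>} w" "set_integrable lborel {\<alpha><..<\<beta>} w'"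
  shows "AE x in lborel. x \<in> {\<alpha><..<\<beta>} \<longrightarrow> w x = w' x"
proof -
  define f where "f x = indicator {\<alpha><..<\<beta>} x *\<^sub>R (w x - w' x)" for x
  have f: "integrable lborel f"
    using set_integral_diff(1)[OF int] by (simp add: f_def[abs_def] set_integrable_def)
  have [measurable]: "f \<in> borel_measurable borel" using f by auto
  have cm [measurable]: "cutoff s t n \<in> borel_measurable borel" for s t n
    by (rule borel_measurable_continuous_onI[OF continuous_cutoff])
  have z: "(LINT x|lborel. cutoff s t n x * f x) = 0" if "\<alpha> \<le> s" "t \<le> \<beta>" for s t n
  proof -
    have "(\<lambda>y. cutoff s t n y * 1) \<in> test_functions \<alpha> \<beta>"
      using that assms(1) by (intro cutoff_mult_test_function(1)[where \<psi>="\<lambda>_. 0"]) auto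
    then have "(LINT x:{\<alpha><..<\<beta>}|lborel. w x * cutoff s t n x) = (LINT x:{\<alpha><..<\<beta>}|lborel. w' x * cutoff s t n x)"
      using assms(2,3) unfolding weak_deriv_def by force
    moreover have i: "integrable lborel (\<lambda>x. indicator {\<alpha><..<\<beta>} x *\<^sub>R (u x * cutoff s t n x))"
      if "set_integrable lborel {\<alpha><..<\<beta>} u" for u
    proof -
      have "integrable lborel (\<lambda>x. (indicator {\<alpha><..<\<beta>} x *\<^sub>R u x) * cutoff s t n x)"
        using that[unfolded set_integrable_def]
      proof (rule Bochner_Integration.integrable_bound)
        show "(\<lambda>x. (indicator {\<alpha><..<\<beta>} x *\<^sub>R u x) * cutoff s t n x) \<in> borel_measurable lborel"
          using that[unfolded set_integrable_def] by measurable
        show "AE x in lborel. norm (indicator {\<alpha><..<\<beta>} x *\<^sub>R u x * cutoff s t n x)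
               \<le> norm (indicator {\<alpha><..<\<beta>} x *\<^sub>R u x)"
          using cutoff_bounds by (auto simp: abs_mult intro!: AE_I2 mult_left_le)
      qed
      then show ?thesis by (simp add: mult.assoc)
    qed
    ultimately have "0 = (LINT x|lborel. indicator {\<alpha><..<\<beta>} x *\<^sub>R (w x * cutoff s t n x)
        - indicator {\<alpha><..<\<beta>} x *\<^sub>R (w' x * cutoff s t n x))"
      using i[OF int(1)] i[OF int(2)] by (simp add: set_lebesgue_integral_def)
    also have "\<dots> = (LINT x|lborel. cutoff s t n x * f x)"
      by (intro Bochner_Integration.integral_cong) (auto simp: f_def indicator_def algebra_simps)
    finally show ?thesis by simp
  qed
  have "(LINT x:{s<..<t}|lborel. f x) = 0" if st: "\<alpha> \<le> s" "t \<le> \<beta>" for s t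
  proof -
    have "(\<lambda>n. LINT x|lborel. cutoff s t n x * f x) \<longlonglongrightarrow> (LINT x|lborel. indicator {s<..<t} x *\<^sub>R f x)"
    proof (rule integral_dominated_convergence[where w="\<lambda>x. norm (f x)"])
      show "AE x in lborel. (\<lambda>n. cutoff s t n x * f x) \<longlonglongrightarrow> indicator {s<..<t} x *\<^sub>R f x"
      proof (rule AE_I2)
        fix x
        show "(\<lambda>n. cutoff s t n x * f x) \<longlonglongrightarrow> indicator {s<..<t} x *\<^sub>R f x"
        proof (cases "x \<in> {s<..<t}")
          case True
          then show ?thesis using tendsto_mult[OF cutoff_tendsto(1)[of s x t] tendsto_const[of "f x"]] by simp
        next
          case False
          then show ?thesis by (simp add: cutoff_outside)
        qed
      qed
      show "AE x in lborel. norm (cutoff s t n x * f x) \<le> norm (f x)" for n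
        using cutoff_bounds by (auto simp: abs_mult intro!: AE_I2 mult_left_le_one_le)
    qed (use f in \<open>auto\<close>)
    then show ?thesis using z[OF st] by (simp add: set_lebesgue_integral_def LIMSEQ_const_iff)
  qed
  moreover have "(LINT x:{s<..<t}|lborel. f x) = (LINT x:{max s \<alpha><..<min t \<beta>}|lborel. f x)" for s t
    unfolding set_lebesgue_integral_def
    by (intro Bochner_Integration.integral_cong) (auto simp: f_def indicator_def)
  ultimately have "AE x in lborel. f x = 0"
    by (intro AE_zero_if_interval_integrals_zero f) auto
  then show ?thesis by eventually_elim (auto simp: f_def)
qed

text \<open>Compact support of the test function is more than integration by parts needs; here it is replaced by
  zero boundary values. The function is multiplied by a cutoff. Since it vanishes linearly at the
  endpoints, the product with the derivative of the cutoff stays bounded, and it tends to zero at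
  every interior point.\<close>

lemma weak_deriv_zero_boundary:
  assumes ab: "\<alpha> < \<beta>" and wd: "weak_deriv \<alpha> \<beta> v w"
    and v: "set_integrable lborel {\<alpha><..<\<beta>} v" and w: "set_integrable lborel {\<alpha><..<\<beta>} w"
    and \<phi>: "\<And>y. (\<phi> has_real_derivative \<psi> y) (at y)" "continuous_on UNIV \<psi>" "\<phi> \<alpha> = 0" "\<phi> \<beta> = 0"
  shows "(LINT x:{\<alpha><..<\<beta>}|lborel. v x * \<psi> x) = - (LINT x:{\<alpha><..<\<beta>}|lborel. w x * \<phi> x)"
proof -
  let ?I = "{\<alpha><..<\<beta>}"
  let ?\<chi> = "cutoff \<alpha> \<beta>" and ?\<chi>' = "cutoff' \<alpha> \<beta>"
  have c\<phi>: "continuous_on UNIV \<phi>"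
    by (rule DERIV_continuous_on[OF has_field_derivative_at_within[OF \<phi>(1)]])
  have "bounded (\<psi> ` {\<alpha>..\<beta>})"
    using compact_imp_bounded[OF compact_continuous_image[OF continuous_on_subset[OF \<phi>(2)], of "{\<alpha>..\<beta>}"]]
    by simp
  then obtain B where B: "\<And>y. y \<in> {\<alpha>..\<beta>} \<Longrightarrow> \<bar>\<psi> y\<bar> \<le> B"
    unfolding bounded_iff real_norm_def by blast
  have B0: "0 \<le> B" using B[of \<alpha>] ab by auto
  have bd: "\<bar>\<phi> y - \<phi> z\<bar> \<le> B * \<bar>y - z\<bar>" if "y \<in> {\<alpha>..\<beta>}" "z \<in> {\<alpha>..\<beta>}" for y z
    using field_differentiable_bound[of "{\<alpha>..\<beta>}" \<phi> \<psi> B y z] that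
      has_field_derivative_at_within[OF \<phi>(1)] B by simp
  have bdl: "\<bar>\<phi> y\<bar> \<le> B * \<bar>y - \<alpha>\<bar>" "\<bar>\<phi> y\<bar> \<le> B * \<bar>\<beta> - y\<bar>" if "y \<in> ?I" for y
    using bd[of y \<alpha>] bd[of y \<beta>] that \<phi>(3,4) ab by (auto simp: abs_minus_commute)
  have \<chi>'\<phi>: "\<bar>?\<chi>' n y * \<phi> y\<bar> \<le> 4 * B" if "y \<in> ?I" for n y
  proof -
    let ?e = "inverse (real (Suc n))"
    have e: "?e > 0" by simp
    have "\<bar>?\<chi>' n y\<bar> \<le> step_ratio' ?e (y - \<alpha> - ?e) + step_ratio' ?e (\<beta> - y - ?e)"
    proof -
      have "\<bar>p * q - r * s\<bar> \<le> p + s" if "0 \<le> p" "0 \<le> q" "q \<le> 1" "0 \<le> r" "r \<le> 1" "0 \<le> s" for p q r s :: real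
      proof -
        have "0 \<le> p * q" "p * q \<le> p" "0 \<le> r * s" "r * s \<le> s"
          using that by (auto simp: mult_left_le mult_left_le_one_le)
        then show ?thesis using that by linarith
      qed
      then show ?thesis unfolding cutoff'_def using step_ratio_bounds step_ratio'_nonneg by blast
    qed
    then have "\<bar>?\<chi>' n y * \<phi> y\<bar> \<le> step_ratio' ?e (y - \<alpha> - ?e) * \<bar>\<phi> y\<bar> + step_ratio' ?e (\<beta> - y - ?e) * \<bar>\<phi> y\<bar>"
      by (simp add: abs_mult mult_right_mono flip: distrib_right)
    also have "\<dots> \<le> step_ratio' ?e (y - \<alpha> - ?e) * (B * \<bar>y - \<alpha>\<bar>) + step_ratio' ?e (\<beta> - y - ?e) * (B * \<bar>\<beta> - y\<bar>)"
      using bdl[OF that] step_ratio'_nonneg by (intro add_mono mult_left_mono) auto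
    also have "\<dots> = B * (step_ratio' ?e (y - \<alpha> - ?e) * \<bar>y - \<alpha>\<bar>) + B * (step_ratio' ?e (\<beta> - y - ?e) * \<bar>\<beta> - y\<bar>)"
      by (simp add: algebra_simps)
    also have "\<dots> \<le> B * 2 + B * 2"
      using B0 by (intro add_mono mult_left_mono step_ratio'_bound[OF e]) auto
    finally show ?thesis by simp
  qed
  have [measurable]: "\<phi> \<in> borel_measurable borel" "\<psi> \<in> borel_measurable borel"
      "cutoff s t n \<in> borel_measurable borel" "cutoff' s t n \<in> borel_measurable borel" for s t n
    by (rule borel_measurable_continuous_onI; fact c\<phi> \<phi>(2) continuous_cutoff continuous_cutoff')+
  have [measurable]: "(\<lambda>x. indicator ?I x * v x) \<in> borel_measurable borel"
    "(\<lambda>x. indicator ?I x * w x) \<in> borel_measurable borel"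
    using v w by (auto simp: set_integrable_def)
  have L: "(\<lambda>n. LINT x|lborel. (indicator ?I x * v x) * (?\<chi>' n x * \<phi> x + ?\<chi> n x * \<psi> x)) \<longlonglongrightarrow>
    (LINT x|lborel. (indicator ?I x * v x) * \<psi> x)"
  proof (rule integral_dominated_convergence[where w="\<lambda>x. norm (indicator ?I x * v x) * (5 * B)"])
    show "integrable lborel (\<lambda>x. norm (indicator ?I x * v x) * (5 * B))"
      using v by (intro integrable_mult_left integrable_norm) (simp add: set_integrable_def)
    show "AE x in lborel. (\<lambda>n. indicator ?I x * v x * (?\<chi>' n x * \<phi> x + ?\<chi> n x * \<psi> x)) \<longlonglongrightarrow> indicator ?I x * v x * \<psi> x"
    proof (rule AE_I2)
      fix x
      have "(\<lambda>n. v x * (?\<chi>' n x * \<phi> x + ?\<chi> n x * \<psi> x)) \<longlonglongrightarrow> v x * (0 * \<phi> x + 1 * \<psi> x)" if "x \<in> ?I"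
        using that by (intro tendsto_intros cutoff_tendsto) auto
      then show "(\<lambda>n. indicator ?I x * v x * (?\<chi>' n x * \<phi> x + ?\<chi> n x * \<psi> x)) \<longlonglongrightarrow> indicator ?I x * v x * \<psi> x"
        by (cases "x \<in> ?I") auto
    qed
    show "AE x in lborel. norm (indicator ?I x * v x * (?\<chi>' n x * \<phi> x + ?\<chi> n x * \<psi> x))
        \<le> norm (indicator ?I x * v x) * (5 * B)" for n
    proof (rule AE_I2)
      fix x
      have "\<bar>?\<chi>' n x * \<phi> x + ?\<chi> n x * \<psi> x\<bar> \<le> 5 * B" if "x \<in> ?I"
      proof -
        have "\<bar>?\<chi> n x * \<psi> x\<bar> \<le> 1 * B"
          unfolding abs_mult using cutoff_bounds B[of x] that by (intro mult_mono) auto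
        with \<chi>'\<phi>[OF that, of n] show ?thesis by linarith
      qed
      then show "norm (indicator ?I x * v x * (?\<chi>' n x * \<phi> x + ?\<chi> n x * \<psi> x))
        \<le> norm (indicator ?I x * v x) * (5 * B)"
        by (cases "x \<in> ?I") (auto simp: abs_mult intro!: mult_left_mono)
    qed
  qed (measurable)
  have R: "(\<lambda>n. LINT x|lborel. (indicator ?I x * w x) * (?\<chi> n x * \<phi> x)) \<longlonglongrightarrow>
    (LINT x|lborel. (indicator ?I x * w x) * \<phi> x)"
  proof (rule integral_dominated_convergence[where w="\<lambda>x. norm (indicator ?I x * w x) * (B * (\<beta> - \<alpha>))"])
    show "integrable lborel (\<lambda>x. norm (indicator ?I x * w x) * (B * (\<beta> - \<alpha>)))"
      using w by (intro integrable_mult_left integrable_norm) (simp add: set_integrable_def)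
    show "AE x in lborel. (\<lambda>n. indicator ?I x * w x * (?\<chi> n x * \<phi> x)) \<longlonglongrightarrow> indicator ?I x * w x * \<phi> x"
    proof (rule AE_I2)
      fix x
      have "(\<lambda>n. w x * (?\<chi> n x * \<phi> x)) \<longlonglongrightarrow> w x * (1 * \<phi> x)" if "x \<in> ?I"
        using that by (intro tendsto_intros cutoff_tendsto) auto
      then show "(\<lambda>n. indicator ?I x * w x * (?\<chi> n x * \<phi> x)) \<longlonglongrightarrow> indicator ?I x * w x * \<phi> x"
        by (cases "x \<in> ?I") auto
    qed
    show "AE x in lborel. norm (indicator ?I x * w x * (?\<chi> n x * \<phi> x))
        \<le> norm (indicator ?I x * w x) * (B * (\<beta> - \<alpha>))" for n
    proof (rule AE_I2)
      fix x
      have "\<bar>?\<chi> n x * \<phi> x\<bar> \<le> B * (\<beta> - \<alpha>)" if "x \<in> ?I"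
      proof -
        have "\<bar>\<phi> x\<bar> \<le> B * \<bar>x - \<alpha>\<bar>" using bdl that by auto
        also have "\<dots> \<le> B * (\<beta> - \<alpha>)" using that B0 by (intro mult_left_mono) auto
        finally have "\<bar>?\<chi> n x\<bar> * \<bar>\<phi> x\<bar> \<le> 1 * (B * (\<beta> - \<alpha>))"
          using cutoff_bounds by (intro mult_mono) auto
        then show ?thesis by (simp add: abs_mult)
      qed
      then show "norm (indicator ?I x * w x * (?\<chi> n x * \<phi> x)) \<le> norm (indicator ?I x * w x) * (B * (\<beta> - \<alpha>))"
        by (cases "x \<in> ?I") (auto simp: abs_mult intro!: mult_left_mono)
    qed
  qed (measurable)
  have E: "(LINT x|lborel. (indicator ?I x * v x) * (?\<chi>' n x * \<phi> x + ?\<chi> n x * \<psi> x))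
      = - (LINT x|lborel. (indicator ?I x * w x) * (?\<chi> n x * \<phi> x))" for n
    using wd[unfolded weak_deriv_def, rule_format, OF cutoff_mult_test_function(1)[OF order_refl order_refl ab \<phi>(1,2), of n]]
    by (simp add: cutoff_mult_test_function(2)[OF order_refl order_refl ab \<phi>(1,2)] set_lebesgue_integral_def mult.assoc)
  have "(LINT x|lborel. (indicator ?I x * v x) * \<psi> x) = - (LINT x|lborel. (indicator ?I x * w x) * \<phi> x)"
    using LIMSEQ_unique[OF L[unfolded E] tendsto_minus[OF R]] .
  then show ?thesis by (simp add: set_lebesgue_integral_def mult.assoc)
qed

lemma weak_deriv_cong_AE:
  assumes "weak_deriv \<alpha> \<beta> v w" "set_borel_measurable lborel {\<alpha><..<\<beta>} w"
    "set_borel_measurable lborel {\<alpha><..<\<beta>} w'" "AE x in lborel. x \<in> {\<alpha><..<\<beta>} \<longrightarrow> w x = w' x"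
  shows "weak_deriv \<alpha> \<beta> v w'"
  unfolding weak_deriv_def
proof
  fix \<phi> assume \<phi>: "\<phi> \<in> test_functions \<alpha> \<beta>"
  have "\<phi> \<in> borel_measurable borel"
    using \<phi> C1_differentiable_imp_continuous_on[of \<phi> UNIV] unfolding test_functions_def
    by (intro borel_measurable_continuous_onI) auto
  then have "set_borel_measurable lborel {\<alpha><..<\<beta>} \<phi>"
    by (auto simp: set_borel_measurable_def)
  then have "L2_inner \<alpha> \<beta> w \<phi> = L2_inner \<alpha> \<beta> w' \<phi>"
    using assms by (intro L2_inner_cong_AE) auto
  then show "(LINT x:{\<alpha><..<\<beta>}|lborel. v x * deriv \<phi> x) = - (LINT x:{\<alpha><..<\<beta>}|lborel. w' x * \<phi> x)"
    using assms(1) \<phi> by (simp add: weak_deriv_def L2_inner_def)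
qed

text \<open>The fundamental theorem of calculus tolerates the finite exceptional set. This covers continuous
  piecewise polynomials as well as smooth functions.\<close>

lemma weak_derivI_classical:
  assumes "\<alpha> \<le> \<beta>" "continuous_on {\<alpha>..\<beta>} v" "finite S"
    and d: "\<And>y. y \<in> {\<alpha><..<\<beta>} - S \<Longrightarrow> (v has_real_derivative w y) (at y)"
    and w: "w \<in> L2_space {\<alpha><..<\<beta>}"
  shows "weak_deriv \<alpha> \<beta> v w"
  unfolding weak_deriv_def
proof
  fix \<phi> assume \<phi>: "\<phi> \<in> test_functions \<alpha> \<beta>"
  then obtain \<psi> where \<psi>: "\<And>y. (\<phi> has_vector_derivative \<psi> y) (at y)" "continuous_on UNIV \<psi>"
    unfolding test_functions_def C1_differentiable_on_def by auto
  have d\<phi>: "deriv \<phi> y = \<psi> y" for y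
    using \<psi>(1) by (intro DERIV_imp_deriv) (simp add: has_real_derivative_iff_has_vector_derivative)
  have c\<phi>: "continuous_on A \<phi>" for A
    using \<psi>(1) by (meson continuous_on_subset has_vector_derivative_continuous continuous_at_imp_continuous_on subset_UNIV)
  have z: "\<phi> \<alpha> = 0" "\<phi> \<beta> = 0" using \<phi> unfolding test_functions_def by force+
  have "((\<lambda>y. v y * \<psi> y + w y * \<phi> y) has_integral (v \<beta> * \<phi> \<beta> - v \<alpha> * \<phi> \<alpha>)) {\<alpha>..\<beta>}"
  proof (rule fundamental_theorem_of_calculus_interior_strong[OF assms(3,1)])
    fix x assume "x \<in> {\<alpha><..<\<beta>} - S"
    from DERIV_mult[OF d[OF this] \<psi>(1)[unfolded has_real_derivative_iff_has_vector_derivative[symmetric]]]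
    show "((\<lambda>y. v y * \<phi> y) has_vector_derivative v x * \<psi> x + w x * \<phi> x) (at x)"
      by (simp add: has_real_derivative_iff_has_vector_derivative algebra_simps)
  qed (intro continuous_intros assms c\<phi>)
  then have "integral {\<alpha><..<\<beta>} (\<lambda>y. v y * \<psi> y + w y * \<phi> y) = 0"
    by (simp add: integral_open_interval_real[symmetric] integral_unique z)
  moreover have i: "set_integrable lborel {\<alpha><..<\<beta>} (\<lambda>y. v y * \<psi> y)" "set_integrable lborel {\<alpha><..<\<beta>} (\<lambda>y. w y * \<phi> y)"
    using assms(2) continuous_on_subset[OF \<psi>(2) subset_UNIV]
    by (intro set_integrable_continuous_open continuous_intros; simp)
       (intro L2_space_mult_integrable w L2_spaceI_continuous c\<phi>)
  ultimately show "(LINT x:{\<alpha><..<\<beta>}|lborel. v x * deriv \<phi> x) = - (LINT x:{\<alpha><..<\<beta>}|lborel. w x * \<phi> x)"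
    using set_borel_integral_eq_integral(2)[OF set_integral_add(1)[OF i]] by (simp add: d\<phi>)
qed

lemma weak_dx_AE_eq:
  assumes "\<alpha> < \<beta>" "w \<in> L2_space {\<alpha><..<\<beta>}" "weak_deriv \<alpha> \<beta> v w"
  shows "weak_dx \<alpha> \<beta> v \<in> L2_space {\<alpha><..<\<beta>}" "weak_deriv \<alpha> \<beta> v (weak_dx \<alpha> \<beta> v)"
    and "AE x in lborel. x \<in> {\<alpha><..<\<beta>} \<longrightarrow> weak_dx \<alpha> \<beta> v x = w x"
proof -
  have *: "weak_dx \<alpha> \<beta> v \<in> L2_space {\<alpha><..<\<beta>} \<and> weak_deriv \<alpha> \<beta> v (weak_dx \<alpha> \<beta> v)"
    unfolding weak_dx_def by (rule someI[of _ w]) (use assms in auto)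
  then show "weak_dx \<alpha> \<beta> v \<in> L2_space {\<alpha><..<\<beta>}" "weak_deriv \<alpha> \<beta> v (weak_dx \<alpha> \<beta> v)" by auto
  show "AE x in lborel. x \<in> {\<alpha><..<\<beta>} \<longrightarrow> weak_dx \<alpha> \<beta> v x = w x"
    using * assms by (intro weak_deriv_unique[of \<alpha> \<beta> v] L2_space_integrable) auto
qed

text \<open>Test functions live on the whole line. Continuing \<open>\<psi>\<close> beyond the interval by its boundary values
  provides an antiderivative there.\<close>

lemma antiderivative_extended:
  fixes \<psi> :: "real \<Rightarrow> real"
  assumes "\<alpha> \<le> \<beta>" "continuous_on {\<alpha>..\<beta>} \<psi>"
  obtains \<phi> \<psi>' where "\<And>y. (\<phi> has_real_derivative \<psi>' y) (at y)" "continuous_on UNIV \<psi>'"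
    "\<And>y. y \<in> {\<alpha>..\<beta>} \<Longrightarrow> \<psi>' y = \<psi> y" "\<And>y. y \<in> {\<alpha>..\<beta>} \<Longrightarrow> \<phi> y = integral {\<alpha>..y} \<psi>"
proof -
  define \<psi>' where "\<psi>' y = \<psi> (max \<alpha> (min \<beta> y))" for y
  have c: "continuous_on UNIV \<psi>'"
    unfolding \<psi>'_def[abs_def]
    by (rule continuous_on_compose2[OF assms(2)]) (use assms(1) in \<open>auto intro!: continuous_intros\<close>)
  have eq: "\<psi>' y = \<psi> y" if "y \<in> {\<alpha>..\<beta>}" for y
    using that assms(1) by (simp add: \<psi>'_def)
  have "\<exists>F. \<forall>x. - \<infinity> < ereal x \<longrightarrow> ereal x < \<infinity> \<longrightarrow> (F has_vector_derivative \<psi>' x) (at x)"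
    using einterval_antiderivative[of "-\<infinity>" \<infinity> \<psi>'] c by (simp add: continuous_on_eq_continuous_at)
  then obtain F where F: "\<And>x. (F has_vector_derivative \<psi>' x) (at x)" by auto
  have "F y - F \<alpha> = integral {\<alpha>..y} \<psi>" if "y \<in> {\<alpha>..\<beta>}" for y
  proof -
    have "(\<psi>' has_integral (F y - F \<alpha>)) {\<alpha>..y}"
      using that by (intro fundamental_theorem_of_calculus has_vector_derivative_at_within[OF F]) simp
    then have "integral {\<alpha>..y} \<psi>' = F y - F \<alpha>" by (rule integral_unique)
    moreover have "integral {\<alpha>..y} \<psi>' = integral {\<alpha>..y} \<psi>"
      using that by (intro integral_cong eq) auto
    ultimately show ?thesis by simp
  qed
  moreover have "((\<lambda>y. F y - F \<alpha>) has_real_derivative \<psi>' y) (at y)" for y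
    using DERIV_diff[OF F[of y, folded has_real_derivative_iff_has_vector_derivative] DERIV_const] by simp
  ultimately show ?thesis using c eq by (intro that[of "\<lambda>y. F y - F \<alpha>" \<psi>']) auto
qed

text \<open>The derivative to test with is the function minus its own mean: its antiderivative vanishes at both
  ends, and the resulting identity says that the variance is zero.\<close>

lemma weak_deriv_zero_imp_constant:
  assumes ab: "\<alpha> < \<beta>" and u: "continuous_on {\<alpha>..\<beta>} u" and wd: "weak_deriv \<alpha> \<beta> u (\<lambda>_. 0)"
    and t: "t \<in> {\<alpha>..\<beta>}"
  shows "u t = u \<alpha>"
proof -
  define c where "c = integral {\<alpha>..\<beta>} u / (\<beta> - \<alpha>)"
  have uc: "continuous_on {\<alpha>..\<beta>} (\<lambda>y. u y - c)" by (intro continuous_intros u)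
  obtain \<phi> \<psi> where \<phi>: "\<And>y. (\<phi> has_real_derivative \<psi> y) (at y)" "continuous_on UNIV \<psi>"
    "\<And>y. y \<in> {\<alpha>..\<beta>} \<Longrightarrow> \<psi> y = u y - c" "\<And>y. y \<in> {\<alpha>..\<beta>} \<Longrightarrow> \<phi> y = integral {\<alpha>..y} (\<lambda>y. u y - c)"
    using antiderivative_extended[OF less_imp_le[OF ab] uc] by blast
  have mean: "integral {\<alpha>..\<beta>} (\<lambda>y. u y - c) = 0"
    using ab by (subst Henstock_Kurzweil_Integration.integral_diff)
      (auto intro: integrable_continuous_real u simp: c_def)
  have "(LINT x:{\<alpha><..<\<beta>}|lborel. u x * \<psi> x) = - (LINT x:{\<alpha><..<\<beta>}|lborel. 0 * \<phi> x)"
    by (rule weak_deriv_zero_boundary[OF ab wd set_integrable_continuous_open[OF u] _ \<phi>(1,2)])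
       (use ab mean \<phi>(4) in \<open>auto simp: set_integrable_def\<close>)
  then have "0 = (LINT x:{\<alpha><..<\<beta>}|lborel. u x * \<psi> x)" by simp
  also have "\<dots> = (LINT x:{\<alpha><..<\<beta>}|lborel. u x * (u x - c))"
    by (intro set_lebesgue_integral_cong) (auto simp: \<phi>(3))
  also have "\<dots> = integral {\<alpha>..\<beta>} (\<lambda>x. u x * (u x - c))"
    by (intro set_lebesgue_integral_open_eq_integral continuous_intros u)
  finally have "0 = integral {\<alpha>..\<beta>} (\<lambda>x. u x * (u x - c))" .
  moreover have "integral {\<alpha>..\<beta>} (\<lambda>x. (u x - c) * (u x - c)) =
      integral {\<alpha>..\<beta>} (\<lambda>x. u x * (u x - c) - c * (u x - c))"
    by (intro integral_cong) (simp add: algebra_simps)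
  moreover have "\<dots> = integral {\<alpha>..\<beta>} (\<lambda>x. u x * (u x - c)) - c * integral {\<alpha>..\<beta>} (\<lambda>x. u x - c)"
    by (subst Henstock_Kurzweil_Integration.integral_diff)
       (auto intro!: integrable_continuous_real continuous_intros u)
  ultimately have "integral {\<alpha>..\<beta>} (\<lambda>x. (u x - c) * (u x - c)) = 0" using mean by simp
  then have h: "((\<lambda>x. (u x - c) * (u x - c)) has_integral 0) (cbox \<alpha> \<beta>)"
    using integrable_integral[OF integrable_continuous_real[OF continuous_on_mult[OF uc uc]]] by simp
  have "(u y - c) * (u y - c) = 0" if "y \<in> {\<alpha>..\<beta>}" for y
    by (rule has_integral_0_cbox_imp_0[OF _ _ h]) (use that ab continuous_on_mult[OF uc uc] in auto)
  from this[OF t] this[of \<alpha>] show ?thesis using ab by auto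
qed

text \<open>This turns variational equations that hold for almost every time into ordinary differential equations:
  subtracting an antiderivative of \<open>g\<close> leaves a continuous function whose weak derivative is zero.\<close>

lemma has_derivative_if_weak_deriv_continuous:
  assumes ab: "\<alpha> < \<beta>" and z: "continuous_on {\<alpha>..\<beta>} z" and wd: "weak_deriv \<alpha> \<beta> z w"
    and w: "set_borel_measurable lborel {\<alpha><..<\<beta>} w"
    and g: "continuous_on {\<alpha>..\<beta>} g" and eq: "AE x in lborel. x \<in> {\<alpha><..<\<beta>} \<longrightarrow> w x = g x"
    and t: "t \<in> {\<alpha>..\<beta>}"
  shows "(z has_real_derivative g t) (at t within {\<alpha>..\<beta>})"
proof -
  obtain \<phi> \<psi> where \<phi>: "\<And>y. (\<phi> has_real_derivative \<psi> y) (at y)" "continuous_on UNIV \<psi>"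
    "\<And>y. y \<in> {\<alpha>..\<beta>} \<Longrightarrow> \<psi> y = g y" "\<And>y. y \<in> {\<alpha>..\<beta>} \<Longrightarrow> \<phi> y = integral {\<alpha>..y} g"
    using antiderivative_extended[OF less_imp_le[OF ab] g] by blast
  have c\<phi>: "continuous_on {\<alpha>..\<beta>} \<phi>"
    by (rule DERIV_continuous_on[OF has_field_derivative_at_within[OF \<phi>(1)]])
  have wg: "weak_deriv \<alpha> \<beta> z g"
    by (rule weak_deriv_cong_AE[OF wd w _ eq])
       (use L2_spaceI_continuous[OF g] in \<open>simp add: L2_space_def\<close>)
  have w\<phi>: "weak_deriv \<alpha> \<beta> \<phi> g"
  proof (rule weak_derivI_classical[where S="{}"])
    show "(\<phi> has_real_derivative g y) (at y)" if "y \<in> {\<alpha><..<\<beta>} - {}" for y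
      using \<phi>(1)[of y] \<phi>(3)[of y] that by simp
  qed (use ab in \<open>simp_all add: c\<phi> L2_spaceI_continuous g\<close>)
  have "weak_deriv \<alpha> \<beta> (\<lambda>y. z y - \<phi> y) (\<lambda>_. 0)"
    unfolding weak_deriv_def
  proof
    fix \<eta> assume \<eta>: "\<eta> \<in> test_functions \<alpha> \<beta>"
    then obtain D where D: "\<And>y. (\<eta> has_vector_derivative D y) (at y)" "continuous_on UNIV D"
      unfolding test_functions_def C1_differentiable_on_def by auto
    have "deriv \<eta> = D"
      using D(1) by (intro ext DERIV_imp_deriv) (simp add: has_real_derivative_iff_has_vector_derivative)
    then have cD: "continuous_on {\<alpha>..\<beta>} (deriv \<eta>)" using D(2) continuous_on_subset by blast
    have "(LINT x:{\<alpha><..<\<beta>}|lborel. z x * deriv \<eta> x) = (LINT x:{\<alpha><..<\<beta>}|lborel. \<phi> x * deriv \<eta> x)"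
      using wg w\<phi> \<eta> by (simp add: weak_deriv_def)
    moreover have "(LINT x:{\<alpha><..<\<beta>}|lborel. z x * deriv \<eta> x - \<phi> x * deriv \<eta> x)
        = (LINT x:{\<alpha><..<\<beta>}|lborel. z x * deriv \<eta> x) - (LINT x:{\<alpha><..<\<beta>}|lborel. \<phi> x * deriv \<eta> x)"
      by (intro set_integral_diff(2) set_integrable_continuous_open continuous_intros z c\<phi> cD)
    ultimately show "(LINT x:{\<alpha><..<\<beta>}|lborel. (z x - \<phi> x) * deriv \<eta> x) = - (LINT x:{\<alpha><..<\<beta>}|lborel. 0 * \<eta> x)"
      unfolding left_diff_distrib by simp
  qed
  then have k: "z y - \<phi> y = z \<alpha> - \<phi> \<alpha>" if "y \<in> {\<alpha>..\<beta>}" for y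
    by (rule weak_deriv_zero_imp_constant[OF ab continuous_on_diff[OF z c\<phi>] _ that])
  have "((\<lambda>y. \<phi> y + (z \<alpha> - \<phi> \<alpha>)) has_real_derivative g t) (at t within {\<alpha>..\<beta>})"
  proof -
    have "((\<lambda>y. \<phi> y + (z \<alpha> - \<phi> \<alpha>)) has_real_derivative \<psi> t + 0) (at t within {\<alpha>..\<beta>})"
      by (intro DERIV_add has_field_derivative_at_within[OF \<phi>(1)] DERIV_const)
    then show ?thesis using \<phi>(3)[OF t] by simp
  qed
  then show ?thesis
    by (rule has_field_derivative_transform_within[OF _ zero_less_one t])
       (use k in \<open>simp add: algebra_simps\<close>)
qed

text \<open>Mean value zero makes the antiderivative of \<open>\<psi>\<close> vanish at both ends, so that integration by parts moves
  a derivative to \<open>d\<close>. The antiderivative is bounded by the \<open>L\<^sup>1\<close> norm of \<open>\<psi>\<close>, and integrating it contributes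
  the length of the interval.\<close>

lemma weak_deriv_pairing_bound:
  assumes ab: "\<alpha> < \<beta>" and d: "d \<in> Linf_space {\<alpha><..<\<beta>}" and wd: "weak_deriv \<alpha> \<beta> d w"
    and w: "w \<in> L2_space {\<alpha><..<\<beta>}" and M: "AE x in lborel. x \<in> {\<alpha><..<\<beta>} \<longrightarrow> \<bar>w x\<bar> \<le> M"
    and \<psi>: "continuous_on {\<alpha>..\<beta>} \<psi>" "integral {\<alpha>..\<beta>} \<psi> = 0"
  shows "\<bar>(LINT x:{\<alpha><..<\<beta>}|lborel. d x * \<psi> x)\<bar> \<le> M * (\<beta> - \<alpha>) * integral {\<alpha>..\<beta>} (\<lambda>x. \<bar>\<psi> x\<bar>)"
proof -
  obtain \<phi> \<psi>' where \<phi>: "\<And>y. (\<phi> has_real_derivative \<psi>' y) (at y)" "continuous_on UNIV \<psi>'"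
    "\<And>y. y \<in> {\<alpha>..\<beta>} \<Longrightarrow> \<psi>' y = \<psi> y" "\<And>y. y \<in> {\<alpha>..\<beta>} \<Longrightarrow> \<phi> y = integral {\<alpha>..y} \<psi>"
    using antiderivative_extended[OF less_imp_le[OF ab] \<psi>(1)] by blast
  let ?B = "integral {\<alpha>..\<beta>} (\<lambda>x. \<bar>\<psi> x\<bar>)"
  have B: "\<bar>\<phi> y\<bar> \<le> ?B" if "y \<in> {\<alpha>..\<beta>}" for y
  proof -
    have c: "continuous_on {\<alpha>..y} \<psi>" by (rule continuous_on_subset[OF \<psi>(1)]) (use that in auto)
    have "\<bar>\<phi> y\<bar> \<le> integral {\<alpha>..y} (\<lambda>x. \<bar>\<psi> x\<bar>)"
      unfolding \<phi>(4)[OF that]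
      by (rule integral_norm_bound_integral[of \<psi> "{\<alpha>..y}" "\<lambda>x. \<bar>\<psi> x\<bar>", unfolded real_norm_def])
        (intro integrable_continuous_real continuous_on_rabs c order_refl)+
    also have "\<dots> \<le> ?B"
      by (rule integral_subset_le)
        (use that in \<open>simp_all add: integrable_continuous_real continuous_on_rabs c \<psi>(1)\<close>)
    finally show ?thesis .
  qed
  have c\<phi>: "continuous_on {\<alpha>..\<beta>} \<phi>"
    by (rule DERIV_continuous_on[OF has_field_derivative_at_within[OF \<phi>(1)]])
  have "(LINT x:{\<alpha><..<\<beta>}|lborel. d x * \<psi> x) = (LINT x:{\<alpha><..<\<beta>}|lborel. d x * \<psi>' x)"
    by (intro set_lebesgue_integral_cong) (auto simp: \<phi>(3))
  also have "\<dots> = - (LINT x:{\<alpha><..<\<beta>}|lborel. w x * \<phi> x)"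
    by (rule weak_deriv_zero_boundary[OF ab wd L2_space_integrable[OF Linf_subset_L2[OF d]]
          L2_space_integrable[OF w] \<phi>(1,2)])
       (use \<phi>(4)[of \<alpha>] \<phi>(4)[of \<beta>] \<psi>(2) ab in simp_all)
  finally have "\<bar>(LINT x:{\<alpha><..<\<beta>}|lborel. d x * \<psi> x)\<bar> = \<bar>(LINT x:{\<alpha><..<\<beta>}|lborel. w x * \<phi> x)\<bar>" by simp
  also have "\<dots> \<le> (LINT x:{\<alpha><..<\<beta>}|lborel. \<bar>w x * \<phi> x\<bar>)"
    unfolding set_lebesgue_integral_def
    by (rule order_trans[OF integral_abs_bound]) (simp add: abs_mult)
  also have "\<dots> \<le> (LINT x:{\<alpha><..<\<beta>}|lborel. M * ?B)"
  proof (rule set_integral_mono_AE)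
    show "set_integrable lborel {\<alpha><..<\<beta>} (\<lambda>x. \<bar>w x * \<phi> x\<bar>)"
      by (rule set_integrable_abs[OF L2_space_mult_integrable[OF w L2_spaceI_continuous[OF c\<phi>]]])
    show "set_integrable lborel {\<alpha><..<\<beta>} (\<lambda>x. M * ?B)"
      by (rule set_integrable_continuous_open[OF continuous_on_const])
    show "AE x\<in>{\<alpha><..<\<beta>} in lborel. \<bar>w x * \<phi> x\<bar> \<le> M * ?B"
      using M
    proof (rule eventually_mono)
      fix x assume x: "x \<in> {\<alpha><..<\<beta>} \<longrightarrow> \<bar>w x\<bar> \<le> M"
      have "\<bar>w x\<bar> * \<bar>\<phi> x\<bar> \<le> M * ?B" if "x \<in> {\<alpha><..<\<beta>}"
        using x B[of x] that by (intro mult_mono) auto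
      then show "x \<in> {\<alpha><..<\<beta>} \<longrightarrow> \<bar>w x * \<phi> x\<bar> \<le> M * ?B" by (auto simp: abs_mult)
    qed
  qed
  also have "\<dots> = M * (\<beta> - \<alpha>) * ?B"
    using ab by (subst set_lebesgue_integral_open_eq_integral) (auto simp: algebra_simps)
  finally show ?thesis .
qed

section \<open>Orthonormal polynomials on an element\<close>

lemma continuous_on_poly_fun [continuous_intros]: "continuous_on S (poly (p :: real poly))"
  by (intro continuous_intros)

lemma poly_L2_space: "poly p \<in> L2_space {c<..<d}"
  by (intro L2_spaceI_continuous continuous_intros)

lemma L2_inner_eq_integral:
  assumes "continuous_on {c..d} u" "continuous_on {c..d} v"
  shows "L2_inner c d u v = integral {c..d} (\<lambda>x. u x * v x)"
  unfolding L2_inner_def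
  by (intro set_lebesgue_integral_open_eq_integral continuous_on_mult assms)

lemma L2_inner_self_poly_pos:
  assumes "c < d" "p \<noteq> (0 :: real poly)"
  shows "0 < L2_inner c d (poly p) (poly p)"
proof -
  have "L2_inner c d (poly p) (poly p) \<noteq> 0"
  proof
    assume "L2_inner c d (poly p) (poly p) = 0"
    then have i: "integral {c..d} (\<lambda>x. poly p x * poly p x) = 0"
      by (simp add: L2_inner_eq_integral continuous_on_poly_fun)
    have h: "((\<lambda>x. poly p x * poly p x) has_integral 0) (cbox c d)"
      using integrable_integral[OF integrable_continuous_real[OF continuous_on_mult[OF continuous_on_poly_fun[of _ p] continuous_on_poly_fun[of _ p]]], of c d] i
      by simp
    have "poly p x = 0" if "x \<in> {c..d}" for x
      using has_integral_0_cbox_imp_0[OF _ _ h, of x] that assms(1)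
      by (simp add: continuous_on_mult[OF continuous_on_poly_fun continuous_on_poly_fun])
    then have "{c..d} \<subseteq> {x. poly p x = 0}" by auto
    then have "finite {c..d}" using poly_roots_finite[OF assms(2)] finite_subset by blast
    then show False using assms(1) infinite_Icc by blast
  qed
  then show ?thesis using L2_inner_self_nonneg[of c d "poly p"] by simp
qed

text \<open>The last clause says that the \<open>k\<close> polynomials span the polynomials of degree less than \<open>k\<close>. All estimates
  below are made in coordinates with respect to such a basis; they use orthonormality only, which keeps
  every constant independent of the element.\<close>

definition orthonormal_polys :: "real \<Rightarrow> real \<Rightarrow> nat \<Rightarrow> (nat \<Rightarrow> real poly) \<Rightarrow> bool" where
  "orthonormal_polys c d k \<l> \<longleftrightarrow> (\<forall>i<k. degree (\<l> i) < k) \<and>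
     (\<forall>i<k. \<forall>j<k. L2_inner c d (poly (\<l> i)) (poly (\<l> j)) = (if i = j then 1 else 0)) \<and>
     (\<forall>q. degree q < k \<longrightarrow> q = (\<Sum>i<k. smult (L2_inner c d (poly q) (poly (\<l> i))) (\<l> i)))"

lemma L2_inner_poly_diff:
  "L2_inner c d (poly (p - q)) (poly r) = L2_inner c d (poly p) (poly r) - L2_inner c d (poly q) (poly r)"
proof -
  have "poly (p - q) = (\<lambda>x. poly p x - poly q x)" by (rule ext) simp
  then show ?thesis by (simp only: L2_inner_diff_left[OF poly_L2_space poly_L2_space poly_L2_space])
qed

lemma L2_inner_poly_smult: "L2_inner c d (poly (smult a p)) v = a * L2_inner c d (poly p) v"
proof -
  have "poly (smult a p) = (\<lambda>x. a * poly p x)" by (rule ext) simp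
  then show ?thesis by (simp only: L2_inner_scale_left)
qed

lemma L2_inner_poly_sum:
  assumes "v \<in> L2_space {c<..<d}"
  shows "L2_inner c d (poly (\<Sum>i\<in>I. smult (a i) (p i))) v = (\<Sum>i\<in>I. a i * L2_inner c d (poly (p i)) v)"
proof -
  have "poly (\<Sum>i\<in>I. smult (a i) (p i)) = (\<lambda>x. \<Sum>i\<in>I. a i * poly (p i) x)"
    by (rule ext) (simp add: poly_sum)
  then show ?thesis by (simp only: L2_inner_sum_left[OF poly_L2_space assms])
qed

text \<open>Gram-Schmidt: the next monomial minus its projection has leading coefficient 1, hence is not zero and
  can be normalised.\<close>

lemma orthonormal_polys_exist:
  assumes "c < d"
  shows "\<exists>\<l>. orthonormal_polys c d k \<l>"
proof (induction k)
  case 0 then show ?case by (simp add: orthonormal_polys_def)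
next
  case (Suc k)
  then obtain \<l> where deg: "\<And>i. i < k \<Longrightarrow> degree (\<l> i) < k"
    and on: "\<And>i j. i < k \<Longrightarrow> j < k \<Longrightarrow> L2_inner c d (poly (\<l> i)) (poly (\<l> j)) = (if i = j then 1 else 0)"
    and span: "\<And>q. degree q < k \<Longrightarrow> q = (\<Sum>i<k. smult (L2_inner c d (poly q) (poly (\<l> i))) (\<l> i))"
    unfolding orthonormal_polys_def by blast
  let ?ip = "\<lambda>p q. L2_inner c d (poly p) (poly q)"
  define s where "s = (\<Sum>i<k. smult (?ip (monom 1 k) (\<l> i)) (\<l> i))"
  define u where "u = monom 1 k - s"
  have cs: "coeff s j = 0" if "j \<ge> k" for j
  proof -
    have "coeff (\<l> i) j = 0" if "i < k" for i
      using deg[OF that] \<open>j \<ge> k\<close> by (intro coeff_eq_0) simp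
    then show ?thesis by (simp add: s_def coeff_sum)
  qed
  have uk: "coeff u k = 1" by (simp add: u_def cs)
  then have u0: "u \<noteq> 0" by auto
  have du: "degree u \<le> k"
    by (rule degree_le) (simp add: u_def cs)
  have uo: "?ip u (\<l> j) = 0" if "j < k" for j
  proof -
    have "?ip s (\<l> j) = (\<Sum>i<k. ?ip (monom 1 k) (\<l> i) * ?ip (\<l> i) (\<l> j))"
      unfolding s_def by (rule L2_inner_poly_sum[OF poly_L2_space])
    also have "\<dots> = (\<Sum>i<k. if i = j then ?ip (monom 1 k) (\<l> i) else 0)"
      by (intro sum.cong) (auto simp: on that)
    also have "\<dots> = ?ip (monom 1 k) (\<l> j)" using that by simp
    finally show ?thesis by (simp add: u_def L2_inner_poly_diff)
  qed
  have ou: "?ip (\<l> j) u = 0" if "j < k" for j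
    using uo[OF that] by (simp add: L2_inner_commute)
  define \<nu> where "\<nu> = ?ip u u"
  have \<nu>: "\<nu> > 0" unfolding \<nu>_def by (rule L2_inner_self_poly_pos[OF assms u0])
  define e where "e = smult (1 / sqrt \<nu>) u"
  have eL: "?ip e q = ?ip u q / sqrt \<nu>" for q
    by (simp add: e_def L2_inner_poly_smult)
  have eR: "?ip q e = ?ip q u / sqrt \<nu>" for q
    using eL[of q] by (simp add: L2_inner_commute)
  have ee: "?ip e e = 1" unfolding eL eR \<nu>_def[symmetric] using \<nu> by simp
  define \<l>' where "\<l>' = \<l>(k := e)"
  have "orthonormal_polys c d (Suc k) \<l>'"
    unfolding orthonormal_polys_def
  proof (intro conjI allI impI)
    fix i assume "i < Suc k"
    then show "degree (\<l>' i) < Suc k"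
      using deg[of i] du by (cases "i = k") (auto simp: \<l>'_def e_def intro: le_imp_less_Suc)
  next
    fix i j assume "i < Suc k" "j < Suc k"
    then show "?ip (\<l>' i) (\<l>' j) = (if i = j then 1 else 0)"
      using ee eL[of "\<l> j"] eR[of "\<l> i"] by (auto simp: \<l>'_def on uo ou less_Suc_eq)
  next
    fix q :: "real poly" assume q: "degree q < Suc k"
    define r where "r = q - smult (coeff q k) u"
    have "degree r < k \<or> r = 0"
    proof -
      have "coeff r j = 0" if "j \<ge> k" for j
      proof (cases "j = k")
        case True then show ?thesis by (simp add: r_def uk)
      next
        case False
        then have "j > k" using that by simp
        then show ?thesis using q du by (simp add: r_def coeff_eq_0)
      qed
      then have "r = 0 \<or> degree r < k"
        by (metis leading_coeff_0_iff not_less)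
      then show ?thesis by auto
    qed
    then have rs: "r = (\<Sum>i<k. smult (?ip r (\<l> i)) (\<l> i))"
      using span[of r] by (auto simp: L2_inner_def)
    have ri: "?ip r (\<l> i) = ?ip q (\<l> i)" if "i < k" for i
      by (simp add: r_def L2_inner_poly_diff L2_inner_poly_smult uo that)
    have "?ip r u = (\<Sum>i<k. ?ip r (\<l> i) * ?ip (\<l> i) u)"
      by (subst rs, rule L2_inner_poly_sum[OF poly_L2_space])
    then have "?ip r u = 0" by (simp add: ou)
    then have qu: "?ip q u = coeff q k * \<nu>"
      by (simp add: r_def L2_inner_poly_diff L2_inner_poly_smult \<nu>_def)
    have "smult (?ip q e) e = smult (coeff q k) u"
    proof -
      have "smult (?ip q e) e = smult (coeff q k * \<nu> / sqrt \<nu> * (1 / sqrt \<nu>)) u"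
        unfolding eR qu by (simp add: e_def)
      also have "coeff q k * \<nu> / sqrt \<nu> * (1 / sqrt \<nu>) = coeff q k" using \<nu> by simp
      finally show ?thesis .
    qed
    then have "(\<Sum>i<Suc k. smult (?ip q (\<l>' i)) (\<l>' i)) = (\<Sum>i<k. smult (?ip q (\<l> i)) (\<l> i)) + smult (coeff q k) u"
      by (simp add: \<l>'_def)
    also have "(\<Sum>i<k. smult (?ip q (\<l> i)) (\<l> i)) = r"
      using ri by (subst rs) simp
    finally show "q = (\<Sum>i<Suc k. smult (?ip q (\<l>' i)) (\<l>' i))" by (simp add: r_def)
  qed
  then show ?case by blast
qed

definition poly_antideriv :: "real poly \<Rightarrow> real poly" where
  "poly_antideriv q = (\<Sum>i\<le>degree q. monom (coeff q i / real (Suc i)) (Suc i))"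

lemma coeff_poly_antideriv:
  "coeff (poly_antideriv q) 0 = 0" "coeff (poly_antideriv q) (Suc j) = coeff q j / real (Suc j)"
proof -
  show "coeff (poly_antideriv q) 0 = 0" by (simp add: poly_antideriv_def coeff_sum)
  have "coeff (poly_antideriv q) (Suc j) = (\<Sum>i\<le>degree q. if i = j then coeff q j / real (Suc j) else 0)"
    unfolding poly_antideriv_def coeff_sum by (intro sum.cong) auto
  also have "\<dots> = coeff q j / real (Suc j)" by (simp add: coeff_eq_0)
  finally show "coeff (poly_antideriv q) (Suc j) = coeff q j / real (Suc j)" .
qed

lemma pderiv_poly_antideriv [simp]: "pderiv (poly_antideriv q) = q"
  by (rule poly_eqI) (simp add: coeff_pderiv coeff_poly_antideriv del: of_nat_Suc)

lemma degree_poly_antideriv_le: "degree (poly_antideriv q) \<le> Suc (degree q)"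
proof (rule degree_le, intro allI impI)
  fix i assume "Suc (degree q) < i"
  then obtain j where "i = Suc j" "degree q < j" by (cases i) auto
  then show "coeff (poly_antideriv q) i = 0" by (simp add: coeff_poly_antideriv coeff_eq_0)
qed

text \<open>Taylor's theorem with one-sided derivatives at the ends, by induction on the order: approximate the
  derivative by a polynomial and take the antiderivative with the right value at \<open>c\<close>.\<close>

lemma poly_approximation:
  fixes D :: "nat \<Rightarrow> real \<Rightarrow> real"
  assumes "c \<le> d"
    and "\<And>j y. j < n \<Longrightarrow> y \<in> {c..d} \<Longrightarrow> (D j has_real_derivative D (Suc j) y) (at y within {c..d})"
    and "\<And>y. y \<in> {c..d} \<Longrightarrow> \<bar>D n y\<bar> \<le> K"
  shows "\<exists>q. (\<forall>i\<ge>n. coeff q i = 0) \<and> (\<forall>y\<in>{c..d}. \<bar>D 0 y - poly q y\<bar> \<le> K * (d - c) ^ n)"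
  using assms(2,3)
proof (induction n arbitrary: D)
  case 0
  then show ?case by (intro exI[of _ 0]) simp
next
  case (Suc n)
  have "\<exists>q. (\<forall>i\<ge>n. coeff q i = 0) \<and> (\<forall>y\<in>{c..d}. \<bar>D (Suc 0) y - poly q y\<bar> \<le> K * (d - c) ^ n)"
    by (rule Suc.IH[of "\<lambda>j. D (Suc j)"]) (use Suc.prems in auto)
  then obtain q where q: "\<And>i. i \<ge> n \<Longrightarrow> coeff q i = 0"
    "\<And>y. y \<in> {c..d} \<Longrightarrow> \<bar>D (Suc 0) y - poly q y\<bar> \<le> K * (d - c) ^ n" by blast
  define Q where "Q = poly_antideriv q + [:D 0 c - poly (poly_antideriv q) c:]"
  have Qc: "poly Q c = D 0 c" by (simp add: Q_def)
  have Qd: "(poly Q has_real_derivative poly q y) (at y within {c..d})" for y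
  proof -
    have "pderiv Q = q" by (simp add: Q_def pderiv_add pderiv_pCons)
    then show ?thesis using has_field_derivative_at_within[OF poly_DERIV[of Q y]] by simp
  qed
  have "coeff Q i = 0" if "i \<ge> Suc n" for i
    using that q(1) by (cases i) (auto simp: Q_def coeff_poly_antideriv)
  moreover have "\<bar>D 0 y - poly Q y\<bar> \<le> K * (d - c) ^ Suc n" if y: "y \<in> {c..d}" for y
  proof -
    have "norm ((D 0 y - poly Q y) - (D 0 c - poly Q c)) \<le> K * (d - c) ^ n * norm (y - c)"
    proof (rule field_differentiable_bound[of "{c..d}" _ "\<lambda>y. D (Suc 0) y - poly q y"])
      show "((\<lambda>y. D 0 y - poly Q y) has_real_derivative D (Suc 0) z - poly q z) (at z within {c..d})"
        if "z \<in> {c..d}" for z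
        using that by (intro DERIV_diff Qd Suc.prems(1)) auto
    qed (use q(2) y assms(1) in auto)
    also have "\<dots> \<le> K * (d - c) ^ n * (d - c)"
      using y order_trans[OF abs_ge_zero q(2)[OF y]] by (intro mult_left_mono) auto
    finally show ?thesis by (simp add: Qc mult_ac)
  qed
  ultimately show ?case by blast
qed

section \<open>Projection and interpolation on one element\<close>

locale element =
  fixes c d :: real and k :: nat and \<l> :: "nat \<Rightarrow> real poly"
  assumes cd: "c < d" and k1: "1 \<le> k" and orthonormal: "orthonormal_polys c d k \<l>"
begin

definition coef :: "(real \<Rightarrow> real) \<Rightarrow> nat \<Rightarrow> real" where
  "coef w i = L2_inner c d w (poly (\<l> i))"

definition proj :: "(real \<Rightarrow> real) \<Rightarrow> real poly" where
  "proj w = (\<Sum>i<k. smult (coef w i) (\<l> i))"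

definition shape :: "nat \<Rightarrow> real poly" where
  "shape i = poly_antideriv (\<l> i) - [:poly (poly_antideriv (\<l> i)) c:]"

text \<open>The polynomial with the value \<open>a\<close> at the left end whose derivative is the projection of \<open>w\<close>. With
  \<open>a = v c\<close> and \<open>w\<close> the derivative of \<open>v\<close>, this is the restriction to the element of the
  interpolant \<open>interp\<close> of \<open>v\<close>. The explicit formula makes it linear in the data and commuting with derivatives in time.\<close>

definition interpolant :: "real \<Rightarrow> (real \<Rightarrow> real) \<Rightarrow> real poly" where
  "interpolant a w = [:a:] + (\<Sum>i<k. smult (coef w i) (shape i))"

lemma degree_basis: "i < k \<Longrightarrow> degree (\<l> i) < k"
  using orthonormal by (simp add: orthonormal_polys_def)

lemma coef_basis: "i < k \<Longrightarrow> j < k \<Longrightarrow> coef (poly (\<l> i)) j = (if i = j then 1 else 0)"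
  using orthonormal by (simp add: orthonormal_polys_def coef_def)

lemma proj_poly: "degree q < k \<Longrightarrow> proj (poly q) = q"
  using orthonormal unfolding orthonormal_polys_def proj_def coef_def by metis

lemma degree_proj: "degree (proj w) < k"
proof -
  have "degree (proj w) \<le> k - 1"
    unfolding proj_def
  proof (intro degree_sum_le order_trans[OF degree_smult_le])
    show "degree (\<l> i) \<le> k - 1" if "i \<in> {..<k}" for i
      using degree_basis[of i] that by simp
  qed simp
  then show ?thesis using k1 by simp
qed

lemma coef_diff:
  assumes "u \<in> L2_space {c<..<d}" "v \<in> L2_space {c<..<d}"
  shows "coef (\<lambda>x. u x - v x) i = coef u i - coef v i"
  unfolding coef_def by (rule L2_inner_diff_left[OF assms poly_L2_space])

lemma coef_add:
  assumes "u \<in> L2_space {c<..<d}" "v \<in> L2_space {c<..<d}"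
  shows "coef (\<lambda>x. u x + v x) i = coef u i + coef v i"
  unfolding coef_def by (rule L2_inner_add_left[OF assms poly_L2_space])

lemma coef_scale: "coef (\<lambda>x. r * u x) i = r * coef u i"
  unfolding coef_def by (rule L2_inner_scale_left)

lemma coef_cong: "(\<And>x. x \<in> {c<..<d} \<Longrightarrow> u x = v x) \<Longrightarrow> coef u i = coef v i"
  unfolding coef_def by (rule L2_inner_cong) auto

lemma coef_sum_poly:
  "coef (poly (\<Sum>i\<in>I. smult (a i) (p i))) j = (\<Sum>i\<in>I. a i * coef (poly (p i)) j)"
  unfolding coef_def by (rule L2_inner_poly_sum[OF poly_L2_space])

lemma coef_proj: "i < k \<Longrightarrow> coef (poly (proj w)) i = coef w i"
proof -
  assume i: "i < k"
  have "coef (poly (proj w)) i = (\<Sum>j<k. coef w j * coef (poly (\<l> j)) i)"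
    unfolding proj_def by (rule coef_sum_poly)
  also have "\<dots> = (\<Sum>j<k. if j = i then coef w j else 0)"
    by (intro sum.cong) (auto simp: coef_basis i)
  finally show ?thesis using i by simp
qed

lemma inner_proj:
  assumes "v \<in> L2_space {c<..<d}"
  shows "L2_inner c d (poly (proj w)) v = (\<Sum>i<k. coef w i * coef v i)"
  unfolding proj_def coef_def using L2_inner_poly_sum[OF assms, of "\<lambda>i. L2_inner c d w (poly (\<l> i))" \<l> "{..<k}"]
  by (simp add: L2_inner_commute[of c d v])

lemma inner_low_degree:
  assumes "v \<in> L2_space {c<..<d}" "degree q < k"
  shows "L2_inner c d v (poly q) = (\<Sum>i<k. coef v i * coef (poly q) i)"
  using inner_proj[OF assms(1), of "poly q"] proj_poly[OF assms(2)]
  by (simp add: L2_inner_commute[of c d v] mult.commute)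

lemma Pythagoras:
  assumes v: "v \<in> L2_space {c<..<d}"
  shows "L2_inner c d v v = (\<Sum>i<k. (coef v i)\<^sup>2)
    + L2_inner c d (\<lambda>x. v x - poly (proj v) x) (\<lambda>x. v x - poly (proj v) x)"
proof -
  let ?P = "poly (proj v)"
  note P = poly_L2_space[of "proj v" c d] and vP = L2_space_diff[OF v poly_L2_space[of "proj v"]]
  have 1: "L2_inner c d ?P v = (\<Sum>i<k. (coef v i)\<^sup>2)"
    by (simp add: inner_proj[OF v] power2_eq_square)
  have 2: "L2_inner c d ?P ?P = (\<Sum>i<k. (coef v i)\<^sup>2)"
    by (simp add: inner_proj[OF P] coef_proj power2_eq_square)
  have "L2_inner c d (\<lambda>x. v x - ?P x) (\<lambda>x. v x - ?P x) =
     L2_inner c d v (\<lambda>x. v x - ?P x) - L2_inner c d ?P (\<lambda>x. v x - ?P x)"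
    by (rule L2_inner_diff_left[OF v P vP])
  also have "\<dots> = (L2_inner c d v v - L2_inner c d ?P v) - (L2_inner c d v ?P - L2_inner c d ?P ?P)"
    using L2_inner_diff_left[OF v P v] L2_inner_diff_left[OF v P P]
    by (simp add: L2_inner_commute[of c d _ "\<lambda>x. v x - ?P x"])
  finally show ?thesis using 1 2 by (simp add: L2_inner_commute[of c d v ?P])
qed

lemma Bessel:
  assumes "v \<in> L2_space {c<..<d}"
  shows "(\<Sum>i<k. (coef v i)\<^sup>2) \<le> L2_inner c d v v"
  using Pythagoras[OF assms] L2_inner_self_nonneg[of c d "\<lambda>x. v x - poly (proj v) x"] by linarith

lemma proj_diff_poly:
  assumes "v \<in> L2_space {c<..<d}" "degree q < k"
  shows "proj (\<lambda>x. v x - poly q x) = proj v - q"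
proof -
  have "proj (\<lambda>x. v x - poly q x) = proj v - proj (poly q)"
    unfolding proj_def by (simp add: coef_diff[OF assms(1) poly_L2_space] smult_diff_left sum_subtractf)
  then show ?thesis using proj_poly[OF assms(2)] by simp
qed

lemma best_approximation:
  assumes "v \<in> L2_space {c<..<d}" "degree q < k"
  shows "L2_inner c d (\<lambda>x. v x - poly (proj v) x) (\<lambda>x. v x - poly (proj v) x)
    \<le> L2_inner c d (\<lambda>x. v x - poly q x) (\<lambda>x. v x - poly q x)"
proof -
  note w = L2_space_diff[OF assms(1) poly_L2_space[of q]]
  have "0 \<le> (\<Sum>i<k. (coef (\<lambda>x. v x - poly q x) i)\<^sup>2)" by (intro sum_nonneg) simp
  then show ?thesis using Pythagoras[OF w] by (simp add: proj_diff_poly[OF assms])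
qed

lemma inner_self_bound:
  assumes "continuous_on {c..d} u" "\<And>x. x \<in> {c..d} \<Longrightarrow> \<bar>u x\<bar> \<le> B"
  shows "L2_inner c d u u \<le> B\<^sup>2 * (d - c)"
proof -
  have "L2_inner c d u u = integral {c..d} (\<lambda>x. u x * u x)"
    by (rule L2_inner_eq_integral[OF assms(1) assms(1)])
  also have "\<dots> \<le> integral {c..d} (\<lambda>x. B\<^sup>2)"
  proof (rule integral_le)
    show "u x * u x \<le> B\<^sup>2" if "x \<in> {c..d}" for x
      using power_mono[OF assms(2)[OF that] abs_ge_zero, of 2] by (simp add: power2_eq_square)
  qed (intro integrable_continuous_real continuous_on_mult continuous_on_const assms)+
  finally show ?thesis using cd by (simp add: mult.commute)
qed

text \<open>Cauchy-Schwarz against the constant 1; this is where integration gains half a power of the element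
  length.\<close>

lemma antiderivative_bound:
  assumes u: "continuous_on {c..d} u" and y: "y \<in> {c..d}"
    and U: "\<And>x. x \<in> {c..d} \<Longrightarrow> (U has_real_derivative u x) (at x within {c..d})"
  shows "(U y - U c)\<^sup>2 \<le> (d - c) * L2_inner c d u u"
proof -
  have cu: "continuous_on {c..y} u" by (rule continuous_on_subset[OF u]) (use y in auto)
  have "(u has_integral (U y - U c)) {c..y}"
  proof (rule fundamental_theorem_of_calculus)
    show "(U has_vector_derivative u x) (at x within {c..y})" if "x \<in> {c..y}" for x
      using has_field_derivative_subset[OF U[of x], of "{c..y}"] that y
      by (simp add: has_real_derivative_iff_has_vector_derivative)
  qed (use y in auto)
  then have "U y - U c = integral {c..y} (\<lambda>x. u x * 1)" by (simp add: integral_unique)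
  then have "U y - U c = L2_inner c y u (\<lambda>_. 1)" using L2_inner_eq_integral[OF cu continuous_on_const] by simp
  then have "(U y - U c)\<^sup>2 \<le> L2_inner c y u u * L2_inner c y (\<lambda>_. 1) (\<lambda>_. 1)"
    using L2_Cauchy_Schwarz[OF L2_spaceI_continuous[OF cu] L2_spaceI_continuous[OF continuous_on_const]] by simp
  also have "L2_inner c y (\<lambda>_. 1) (\<lambda>_. 1) = y - c"
    using y by (subst L2_inner_eq_integral) auto
  also have "L2_inner c y u u * (y - c) \<le> L2_inner c d u u * (d - c)"
  proof (rule mult_mono)
    show "L2_inner c y u u \<le> L2_inner c d u u"
      unfolding L2_inner_eq_integral[OF cu cu] L2_inner_eq_integral[OF u u]
      by (rule integral_subset_le)
         (use y in \<open>simp_all add: integrable_continuous_real continuous_on_mult u cu\<close>)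
  qed (use y L2_inner_self_nonneg in auto)
  finally show ?thesis by (simp add: mult.commute)
qed

text \<open>The part of a polynomial of degree \<open>k\<close> that the moments do not see is controlled by the
  derivative: the element mean is among the moments.\<close>

lemma inner_self_poly_le:
  assumes "degree e \<le> k"
  shows "L2_inner c d (poly e) (poly e) \<le> (\<Sum>i<k. (coef (poly e) i)\<^sup>2)
     + (d - c)\<^sup>2 * (\<Sum>i<k. (coef (poly (pderiv e)) i)\<^sup>2)"
proof -
  have dp: "degree (pderiv e) < k"
    using assms k1 by (simp add: degree_pderiv)
  let ?N = "L2_inner c d (poly (pderiv e)) (poly (pderiv e))"
  have N: "?N = (\<Sum>i<k. (coef (poly (pderiv e)) i)\<^sup>2)"
    using inner_low_degree[OF poly_L2_space dp] by (simp add: power2_eq_square)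
  have N0: "0 \<le> ?N" by (rule L2_inner_self_nonneg)
  have "\<bar>poly e y - poly [:poly e c:] y\<bar> \<le> sqrt ((d - c) * ?N)" if y: "y \<in> {c..d}" for y
  proof -
    have "(poly e y - poly e c)\<^sup>2 \<le> (d - c) * ?N"
      by (rule antiderivative_bound[OF continuous_on_poly_fun y has_field_derivative_at_within[OF poly_DERIV]])
    then show ?thesis using real_le_rsqrt[of "\<bar>poly e y - poly e c\<bar>"] by simp
  qed
  then have "L2_inner c d (\<lambda>y. poly e y - poly [:poly e c:] y) (\<lambda>y. poly e y - poly [:poly e c:] y)
     \<le> (sqrt ((d - c) * ?N))\<^sup>2 * (d - c)"
    by (intro inner_self_bound continuous_on_diff continuous_on_poly_fun)
  also have "\<dots> = (d - c)\<^sup>2 * ?N" using cd N0 by (simp add: power2_eq_square)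
  finally have "L2_inner c d (\<lambda>y. poly e y - poly [:poly e c:] y) (\<lambda>y. poly e y - poly [:poly e c:] y)
     \<le> (d - c)\<^sup>2 * ?N" .
  then have "L2_inner c d (\<lambda>x. poly e x - poly (proj (poly e)) x) (\<lambda>x. poly e x - poly (proj (poly e)) x) \<le> (d - c)\<^sup>2 * ?N"
    using best_approximation[OF poly_L2_space, of "[:poly e c:]" e] k1 by simp
  then show ?thesis using Pythagoras[OF poly_L2_space, of e] N by simp
qed

lemma proj_error:
  fixes D :: "nat \<Rightarrow> real \<Rightarrow> real"
  assumes "\<And>j y. j < k \<Longrightarrow> y \<in> {c..d} \<Longrightarrow> (D j has_real_derivative D (Suc j) y) (at y within {c..d})"
    and "\<And>y. y \<in> {c..d} \<Longrightarrow> \<bar>D k y\<bar> \<le> K"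
  shows "L2_inner c d (\<lambda>x. D 0 x - poly (proj (D 0)) x) (\<lambda>x. D 0 x - poly (proj (D 0)) x)
    \<le> (K * (d - c) ^ k)\<^sup>2 * (d - c)"
proof -
  obtain q where q: "\<forall>i\<ge>k. coeff q i = 0" "\<And>y. y \<in> {c..d} \<Longrightarrow> \<bar>D 0 y - poly q y\<bar> \<le> K * (d - c) ^ k"
    using poly_approximation[of c d k D K] cd assms by auto
  have "degree q \<le> k - 1"
    by (rule degree_le) (use q k1 in auto)
  then have dq: "degree q < k" using k1 by simp
  have c0: "continuous_on {c..d} (D 0)"
    using k1 by (intro DERIV_continuous_on[OF assms(1)[of 0]]) auto
  have "L2_inner c d (\<lambda>x. D 0 x - poly (proj (D 0)) x) (\<lambda>x. D 0 x - poly (proj (D 0)) x)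
    \<le> L2_inner c d (\<lambda>x. D 0 x - poly q x) (\<lambda>x. D 0 x - poly q x)"
    by (rule best_approximation[OF L2_spaceI_continuous[OF c0] dq])
  also have "\<dots> \<le> (K * (d - c) ^ k)\<^sup>2 * (d - c)"
    by (intro inner_self_bound continuous_on_diff continuous_on_poly_fun c0 q)
  finally show ?thesis .
qed

lemma pderiv_shape: "pderiv (shape i) = \<l> i"
  by (simp add: shape_def pderiv_diff pderiv_pCons)

lemma poly_shape_left [simp]: "poly (shape i) c = 0"
  by (simp add: shape_def)

lemma degree_shape: "i < k \<Longrightarrow> degree (shape i) \<le> k"
proof -
  assume i: "i < k"
  have "degree (shape i) \<le> max (degree (poly_antideriv (\<l> i))) 0"
    unfolding shape_def by (rule order_trans[OF degree_diff_le_max]) simp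
  also have "\<dots> \<le> k" using degree_poly_antideriv_le[of "\<l> i"] degree_basis[OF i] by simp
  finally show ?thesis .
qed

lemma degree_interpolant: "degree (interpolant a w) \<le> k"
  unfolding interpolant_def
  by (intro degree_add_le degree_sum_le order_trans[OF degree_smult_le] degree_shape) auto

lemma poly_interpolant_left: "poly (interpolant a w) c = a"
  by (simp add: interpolant_def poly_sum)

lemma pderiv_interpolant: "pderiv (interpolant a w) = proj w"
proof -
  have "pderiv (\<Sum>i\<in>I. smult (coef w i) (shape i)) = (\<Sum>i\<in>I. smult (coef w i) (\<l> i))" for I
    by (induction I rule: infinite_finite_induct) (simp_all add: pderiv_add pderiv_smult pderiv_shape)
  then show ?thesis by (simp add: interpolant_def proj_def pderiv_add pderiv_pCons)
qed

text \<open>The derivative has degree less than \<open>k\<close>, so its moments determine it; the left value fixes the constant.\<close>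

lemma interpolant_unique:
  assumes "poly e c = a" "degree e \<le> k" "\<And>i. i < k \<Longrightarrow> coef (poly (pderiv e)) i = coef w i"
  shows "e = interpolant a w"
proof -
  have "degree (pderiv e) < k" using assms(2) k1 by (simp add: degree_pderiv)
  then have "pderiv e = proj (poly (pderiv e))" by (simp add: proj_poly)
  also have "\<dots> = proj w" unfolding proj_def using assms(3) by (intro sum.cong) auto
  finally have "pderiv (e - interpolant a w) = 0" by (simp add: pderiv_diff pderiv_interpolant)
  then have "degree (e - interpolant a w) = 0" by (simp add: pderiv_eq_0_iff)
  then obtain r where r: "e - interpolant a w = [:r:]" by (rule degree_eq_zeroE)
  have "poly (e - interpolant a w) c = 0" using assms(1) by (simp add: poly_interpolant_left)
  then show ?thesis using r by simp
qed

text \<open>Since \<open>k \<ge> 1\<close>, the constant 1 is one of the polynomials to which the projection error of \<open>w\<close> is orthogonal.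
  Hence the interpolant and \<open>v\<close> have the same increment over the element.\<close>

lemma poly_interpolant_right:
  assumes v: "\<And>x. x \<in> {c..d} \<Longrightarrow> (v has_real_derivative w x) (at x within {c..d})"
    and w: "continuous_on {c..d} w"
  shows "poly (interpolant (v c) w) d = v d"
proof -
  let ?e = "interpolant (v c) w"
  have FTC: "L2_inner c d u' (poly [:1:]) = u d - u c"
    if "\<And>x. x \<in> {c..d} \<Longrightarrow> (u has_real_derivative u' x) (at x within {c..d})" "continuous_on {c..d} u'"
    for u u' :: "real \<Rightarrow> real"
  proof -
    have "(u' has_integral (u d - u c)) {c..d}"
      using that(1) cd
      by (intro fundamental_theorem_of_calculus) (auto simp: has_real_derivative_iff_has_vector_derivative)
    then show ?thesis
      using L2_inner_eq_integral[OF that(2) continuous_on_poly_fun, of "[:1:]"] by (simp add: integral_unique)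
  qed
  have "poly ?e d - poly ?e c = L2_inner c d (poly (pderiv ?e)) (poly [:1:])"
    by (rule FTC[symmetric]) (auto intro!: has_field_derivative_at_within poly_DERIV continuous_on_poly_fun)
  also have "\<dots> = (\<Sum>i<k. coef (poly (proj w)) i * coef (poly [:1:]) i)"
    unfolding pderiv_interpolant using k1 by (intro inner_low_degree poly_L2_space) simp
  also have "\<dots> = L2_inner c d w (poly [:1:])"
    using inner_low_degree[OF L2_spaceI_continuous[OF w], of "[:1:]"] k1 by (simp add: coef_proj)
  also have "\<dots> = v d - v c" by (rule FTC[OF v w])
  finally show ?thesis by (simp add: poly_interpolant_left)
qed

text \<open>The error vanishes at the left end and its derivative is the projection error of \<open>D 1\<close>, of order \<open>h\<^sup>k\<close>;
  integration gains one power of \<open>h\<close>.\<close>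

lemma interpolant_error:
  fixes D :: "nat \<Rightarrow> real \<Rightarrow> real"
  assumes D: "\<And>j y. j < Suc k \<Longrightarrow> y \<in> {c..d} \<Longrightarrow> (D j has_real_derivative D (Suc j) y) (at y within {c..d})"
    and K: "\<And>y. y \<in> {c..d} \<Longrightarrow> \<bar>D (Suc k) y\<bar> \<le> K"
    and y: "y \<in> {c..d}"
  shows "\<bar>D 0 y - poly (interpolant (D 0 c) (D 1)) y\<bar> \<le> K * (d - c) ^ (k + 1)"
proof -
  let ?e = "interpolant (D 0 c) (D 1)"
  let ?r = "\<lambda>x. D 1 x - poly (proj (D 1)) x"
  have c1: "continuous_on {c..d} (D 1)"
    using k1 by (intro DERIV_continuous_on[OF D[of 1]]) auto
  have "((\<lambda>y. D 0 y - poly ?e y) has_real_derivative ?r x) (at x within {c..d})" if "x \<in> {c..d}" for x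
    using D[of 0 x] that has_field_derivative_at_within[OF poly_DERIV[of ?e x]]
    by (intro DERIV_diff) (simp_all add: pderiv_interpolant)
  then have "((D 0 y - poly ?e y) - (D 0 c - poly ?e c))\<^sup>2 \<le> (d - c) * L2_inner c d ?r ?r"
    by (intro antiderivative_bound[of ?r y "\<lambda>y. D 0 y - poly ?e y"] continuous_on_diff c1 continuous_on_poly_fun y)
  also have "\<dots> \<le> (d - c) * ((K * (d - c) ^ k)\<^sup>2 * (d - c))"
    using proj_error[of "\<lambda>j. D (Suc j)" K] D K cd by (intro mult_left_mono) auto
  also have "\<dots> = (K * (d - c) ^ (k + 1))\<^sup>2" by (simp add: power2_eq_square)
  finally have "(D 0 y - poly ?e y)\<^sup>2 \<le> (K * (d - c) ^ (k + 1))\<^sup>2" by (simp add: poly_interpolant_left)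
  moreover have "0 \<le> K * (d - c) ^ (k + 1)"
    using order_trans[OF abs_ge_zero K[OF y]] cd by simp
  ultimately show ?thesis using abs_le_square_iff[of "D 0 y - poly ?e y" "K * (d - c) ^ (k + 1)"] by simp
qed

end

lemma continuous_on_section:
  assumes "continuous_on (U \<times> S) (\<lambda>(s, y). h s y)" "t \<in> U"
  shows "continuous_on S (h t)"
proof -
  have "continuous_on S (\<lambda>y. (t, y))" by (intro continuous_on_Pair continuous_on_const continuous_on_id)
  then have "continuous_on S (\<lambda>y. case (t, y) of (s, y) \<Rightarrow> h s y)"
    by (rule continuous_on_compose2[OF assms(1)]) (use assms(2) in auto)
  then show ?thesis by simp
qed

section \<open>Weighted and time-dependent moments\<close>

context element
begin

lemma weighted_inner_self_le:
  assumes \<delta>: "\<delta> \<in> Linf_space {c<..<d}" and B: "AE x in lborel. x \<in> {c<..<d} \<longrightarrow> \<bar>\<delta> x\<bar> \<le> B"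
    and u: "u \<in> L2_space {c<..<d}"
  shows "L2_inner c d (\<lambda>x. \<delta> x * u x) (\<lambda>x. \<delta> x * u x) \<le> B\<^sup>2 * L2_inner c d u u"
proof -
  note \<delta>u = Linf_mult_L2_space[OF \<delta> u]
  have "L2_inner c d (\<lambda>x. \<delta> x * u x) (\<lambda>x. \<delta> x * u x) \<le> (LINT x:{c<..<d}|lborel. B\<^sup>2 * (u x * u x))"
    unfolding L2_inner_def
  proof (rule set_integral_mono_AE)
    show "set_integrable lborel {c<..<d} (\<lambda>x. \<delta> x * u x * (\<delta> x * u x))"
      by (rule L2_space_mult_integrable[OF \<delta>u \<delta>u])
    show "set_integrable lborel {c<..<d} (\<lambda>x. B\<^sup>2 * (u x * u x))"
      using L2_space_mult_integrable[OF u u] by simp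
    show "AE x\<in>{c<..<d} in lborel. \<delta> x * u x * (\<delta> x * u x) \<le> B\<^sup>2 * (u x * u x)"
      using B
    proof (rule eventually_mono)
      fix x assume x: "x \<in> {c<..<d} \<longrightarrow> \<bar>\<delta> x\<bar> \<le> B"
      show "x \<in> {c<..<d} \<longrightarrow> \<delta> x * u x * (\<delta> x * u x) \<le> B\<^sup>2 * (u x * u x)"
      proof
        assume "x \<in> {c<..<d}"
        then have "\<bar>\<delta> x\<bar>\<^sup>2 \<le> B\<^sup>2" using x by (intro power_mono) auto
        then have "\<bar>\<delta> x\<bar>\<^sup>2 * (u x * u x) \<le> B\<^sup>2 * (u x * u x)" by (intro mult_right_mono) auto
        then show "\<delta> x * u x * (\<delta> x * u x) \<le> B\<^sup>2 * (u x * u x)" by (simp add: power2_eq_square mult_ac)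
      qed
    qed
  qed
  then show ?thesis by (simp add: L2_inner_def)
qed

lemma weighted_coef_le:
  assumes "\<delta> \<in> Linf_space {c<..<d}" "AE x in lborel. x \<in> {c<..<d} \<longrightarrow> \<bar>\<delta> x\<bar> \<le> B"
    and "u \<in> L2_space {c<..<d}"
  shows "(\<Sum>i<k. (coef (\<lambda>x. \<delta> x * u x) i)\<^sup>2) \<le> B\<^sup>2 * L2_inner c d u u"
  using Bessel[OF Linf_mult_L2_space[OF assms(1,3)]] weighted_inner_self_le[OF assms] by linarith

text \<open>The projection error is only of order \<open>h\<^sup>k\<close>, but its product with any test polynomial has mean
  zero over the element. Integrating the product by parts against the weight gains the missing factor \<open>h\<close>.\<close>

lemma weighted_proj_error_le:
  assumes \<delta>: "\<delta> \<in> Linf_space {c<..<d}" and wd: "weak_deriv c d \<delta> w" and w: "w \<in> L2_space {c<..<d}"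
    and M: "AE x in lborel. x \<in> {c<..<d} \<longrightarrow> \<bar>w x\<bar> \<le> M" "0 \<le> M"
    and v: "continuous_on {c..d} v"
  shows "(\<Sum>i<k. (coef (\<lambda>x. \<delta> x * (v x - poly (proj v) x)) i)\<^sup>2)
    \<le> (M * (d - c))\<^sup>2 * L2_inner c d (\<lambda>x. v x - poly (proj v) x) (\<lambda>x. v x - poly (proj v) x)"
proof -
  define e where "e x = v x - poly (proj v) x" for x
  have ce: "continuous_on {c..d} e"
    unfolding e_def[abs_def] by (intro continuous_on_diff v continuous_on_poly_fun)
  have eL: "e \<in> L2_space {c<..<d}" by (rule L2_spaceI_continuous[OF ce])
  note \<delta>e = Linf_mult_L2_space[OF \<delta> eL]
  define V where "V = proj (\<lambda>x. \<delta> x * e x)"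
  define S where "S = (\<Sum>i<k. (coef (\<lambda>x. \<delta> x * e x) i)\<^sup>2)"
  have S0: "0 \<le> S" unfolding S_def by (intro sum_nonneg) simp
  have dV: "degree V < k" unfolding V_def by (rule degree_proj)
  have cV: "coef (poly V) i = coef (\<lambda>x. \<delta> x * e x) i" if "i < k" for i
    unfolding V_def by (rule coef_proj[OF that])
  have NV: "L2_inner c d (poly V) (poly V) = S"
    using inner_low_degree[OF poly_L2_space dV] cV by (simp add: S_def power2_eq_square)
  \<comment> \<open>The product of the projection error with \<open>V\<close> has mean value zero.\<close>
  have "coef e i = 0" if "i < k" for i
    unfolding e_def[abs_def] coef_diff[OF L2_spaceI_continuous[OF v] poly_L2_space] coef_proj[OF that] by simp
  then have "L2_inner c d e (poly V) = 0" using inner_low_degree[OF eL dV] by simp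
  then have mean: "integral {c..d} (\<lambda>x. e x * poly V x) = 0"
    by (simp add: L2_inner_eq_integral[OF ce continuous_on_poly_fun])
  have "S = L2_inner c d (poly V) (\<lambda>x. \<delta> x * e x)"
    unfolding V_def inner_proj[OF \<delta>e] by (simp add: S_def power2_eq_square)
  also have "\<dots> = (LINT x:{c<..<d}|lborel. \<delta> x * (e x * poly V x))"
    unfolding L2_inner_def by (intro set_lebesgue_integral_cong) (auto simp: mult_ac)
  also have "\<dots> \<le> \<bar>(LINT x:{c<..<d}|lborel. \<delta> x * (e x * poly V x))\<bar>" by simp
  also have "\<dots> \<le> M * (d - c) * integral {c..d} (\<lambda>x. \<bar>e x * poly V x\<bar>)"
    by (rule weak_deriv_pairing_bound[OF cd \<delta> wd w M(1) continuous_on_mult[OF ce continuous_on_poly_fun] mean])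
  finally have 1: "S \<le> M * (d - c) * integral {c..d} (\<lambda>x. \<bar>e x * poly V x\<bar>)" .
  have ca: "continuous_on {c..d} (\<lambda>x. \<bar>e x\<bar>)" "continuous_on {c..d} (\<lambda>x. \<bar>poly V x\<bar>)"
    by (intro continuous_on_rabs ce continuous_on_poly_fun)+
  have 2: "integral {c..d} (\<lambda>x. \<bar>e x * poly V x\<bar>) = L2_inner c d (\<lambda>x. \<bar>e x\<bar>) (\<lambda>x. \<bar>poly V x\<bar>)"
    by (simp add: L2_inner_eq_integral[OF ca] abs_mult)
  have "(integral {c..d} (\<lambda>x. \<bar>e x * poly V x\<bar>))\<^sup>2 \<le> L2_inner c d e e * S"
    using L2_Cauchy_Schwarz[OF L2_spaceI_continuous[OF ca(1)] L2_spaceI_continuous[OF ca(2)]]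
    unfolding 2 NV[symmetric] by (simp add: L2_inner_def)
  then have "(M * (d - c) * integral {c..d} (\<lambda>x. \<bar>e x * poly V x\<bar>))\<^sup>2 \<le> (M * (d - c))\<^sup>2 * (L2_inner c d e e * S)"
    unfolding power_mult_distrib by (intro mult_left_mono) auto
  moreover have "S\<^sup>2 \<le> (M * (d - c) * integral {c..d} (\<lambda>x. \<bar>e x * poly V x\<bar>))\<^sup>2"
    using 1 S0 by (rule power_mono)
  ultimately have "S * S \<le> (M * (d - c))\<^sup>2 * L2_inner c d e e * S" by (simp add: power2_eq_square mult_ac)
  moreover have "0 \<le> (M * (d - c))\<^sup>2 * L2_inner c d e e"
    by (intro mult_nonneg_nonneg L2_inner_self_nonneg) simp
  ultimately have "S \<le> (M * (d - c))\<^sup>2 * L2_inner c d e e"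
    using S0 by (cases "S = 0") auto
  then show ?thesis by (simp add: S_def e_def[abs_def])
qed

text \<open>The matrix of the discrete lower-order term: multiplication by \<open>\<delta>\<close> followed by the projection.\<close>

definition weight_matrix :: "(real \<Rightarrow> real) \<Rightarrow> nat \<Rightarrow> nat \<Rightarrow> real" where
  "weight_matrix \<delta> i j = coef (\<lambda>x. \<delta> x * poly (\<l> j) x) i"

lemma weight_matrix_mult:
  assumes "\<delta> \<in> Linf_space {c<..<d}"
  shows "(\<Sum>j<k. weight_matrix \<delta> i j * v j) = coef (\<lambda>x. \<delta> x * poly (\<Sum>j<k. smult (v j) (\<l> j)) x) i"
proof -
  have "coef (\<lambda>x. \<Sum>j<k. v j * (\<delta> x * poly (\<l> j) x)) i = (\<Sum>j<k. v j * coef (\<lambda>x. \<delta> x * poly (\<l> j) x) i)"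
    unfolding coef_def by (intro L2_inner_sum_left Linf_mult_L2_space assms poly_L2_space)
  then show ?thesis
    by (simp add: weight_matrix_def poly_sum sum_distrib_left mult_ac)
qed

lemma weight_matrix_bound:
  assumes "\<delta> \<in> Linf_space {c<..<d}" "AE x in lborel. x \<in> {c<..<d} \<longrightarrow> \<bar>\<delta> x\<bar> \<le> B"
  shows "(\<Sum>i<k. (\<Sum>j<k. weight_matrix \<delta> i j * v j)\<^sup>2) \<le> B\<^sup>2 * (\<Sum>j<k. (v j)\<^sup>2)"
proof -
  let ?V = "\<Sum>j<k. smult (v j) (\<l> j)"
  have cV: "coef (poly ?V) i = v i" if "i < k" for i
  proof -
    have "coef (poly ?V) i = (\<Sum>j<k. if j = i then v j else 0)"
      unfolding coef_sum_poly by (intro sum.cong) (auto simp: coef_basis that)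
    then show ?thesis using that by simp
  qed
  have "?V = proj (poly ?V)" unfolding proj_def by (intro sum.cong) (auto simp: cV)
  then have dV: "degree ?V < k" using degree_proj by metis
  have "L2_inner c d (poly ?V) (poly ?V) = (\<Sum>j<k. (v j)\<^sup>2)"
    using inner_low_degree[OF poly_L2_space dV] cV by (simp add: power2_eq_square)
  then show ?thesis
    using weighted_coef_le[OF assms poly_L2_space, of ?V] unfolding weight_matrix_mult[OF assms(1)] by simp
qed

lemma weight_matrix_nonneg:
  assumes "\<delta> \<in> Linf_space {c<..<d}" "AE x in lborel. x \<in> {c<..<d} \<longrightarrow> 0 \<le> \<delta> x"
  shows "0 \<le> (\<Sum>i<k. (\<Sum>j<k. weight_matrix \<delta> i j * v j) * v i)"
proof -
  let ?V = "\<Sum>j<k. smult (v j) (\<l> j)"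
  have "(\<Sum>i<k. (\<Sum>j<k. weight_matrix \<delta> i j * v j) * v i) = L2_inner c d (poly ?V) (\<lambda>x. \<delta> x * poly ?V x)"
    unfolding weight_matrix_mult[OF assms(1)]
      L2_inner_poly_sum[OF Linf_mult_L2_space[OF assms(1) poly_L2_space], of v \<l> "{..<k}" ?V]
    by (simp add: coef_def L2_inner_commute mult.commute)
  also have "0 \<le> \<dots>"
    unfolding L2_inner_def set_lebesgue_integral_def
  proof (rule integral_nonneg_AE)
    show "AE x in lborel. 0 \<le> indicat_real {c<..<d} x *\<^sub>R (poly ?V x * (\<delta> x * poly ?V x))"
      using assms(2)
    proof (rule eventually_mono)
      fix x assume x: "x \<in> {c<..<d} \<longrightarrow> 0 \<le> \<delta> x"
      have "0 \<le> p * (\<delta> x * p)" if "x \<in> {c<..<d}" for p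
      proof -
        have "0 \<le> \<delta> x * p\<^sup>2" using x that by simp
        then show ?thesis by (simp only: power2_eq_square mult_ac)
      qed
      then have "0 \<le> indicat_real {c<..<d} x *\<^sub>R (p * (\<delta> x * p))" for p
        by (cases "x \<in> {c<..<d}") simp_all
      then show "0 \<le> indicat_real {c<..<d} x *\<^sub>R (poly ?V x * (\<delta> x * poly ?V x))" .
    qed
  qed
  finally show ?thesis .
qed

lemma coef_eq_integral: "continuous_on {c..d} u \<Longrightarrow> coef u i = integral {c..d} (\<lambda>x. u x * poly (\<l> i) x)"
  unfolding coef_def by (rule L2_inner_eq_integral[OF _ continuous_on_poly_fun])

lemma coef_has_derivative:
  assumes h: "\<And>s y. s \<in> {0..T} \<Longrightarrow> y \<in> {c..d} \<Longrightarrow> ((\<lambda>s. h s y) has_real_derivative h' s y) (at s within {0..T})"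
    and c: "\<And>s. s \<in> {0..T} \<Longrightarrow> continuous_on {c..d} (h s)"
    and c': "continuous_on ({0..T} \<times> {c..d}) (\<lambda>(s, y). h' s y)"
    and t: "t \<in> {0..T}"
  shows "((\<lambda>s. coef (h s) i) has_real_derivative coef (h' t) i) (at t within {0..T})"
proof -
  have ch': "continuous_on {c..d} (h' t)"
    by (rule continuous_on_section[OF c' t])
  have "((\<lambda>s. integral (cbox c d) (\<lambda>x. h s x * poly (\<l> i) x)) has_real_derivative
      integral (cbox c d) (\<lambda>x. h' t x * poly (\<l> i) x)) (at t within {0..T})"
  proof (rule leibniz_rule_field_derivative[where fx="\<lambda>s x. h' s x * poly (\<l> i) x"])
    show "((\<lambda>s. h s y * poly (\<l> i) y) has_real_derivative h' s y * poly (\<l> i) y) (at s within {0..T})"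
      if "s \<in> {0..T}" "y \<in> cbox c d" for s y
      using h[of s y] that DERIV_cmult_right by simp
    show "(\<lambda>y. h s y * poly (\<l> i) y) integrable_on cbox c d" if "s \<in> {0..T}" for s
      using integrable_continuous_real[OF continuous_on_mult[OF c[OF that] continuous_on_poly_fun]] by simp
    have "continuous_on ({0..T} \<times> {c..d}) (\<lambda>p. (case p of (s, y) \<Rightarrow> h' s y) * poly (\<l> i) (snd p))"
      by (intro continuous_on_mult c' continuous_on_compose2[OF continuous_on_poly_fun[of UNIV "\<l> i"] continuous_on_snd]) auto
    then show "continuous_on ({0..T} \<times> cbox c d) (\<lambda>(s, x). h' s x * poly (\<l> i) x)"
      by (simp add: case_prod_beta)
  qed (use t in auto)
  then have "((\<lambda>s. integral {c..d} (\<lambda>x. h s x * poly (\<l> i) x)) has_real_derivative coef (h' t) i) (at t within {0..T})"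
    by (simp add: coef_eq_integral[OF ch'])
  then show ?thesis
    by (rule has_field_derivative_transform_within[OF _ zero_less_one t]) (simp add: coef_eq_integral c)
qed

lemma coef_continuous:
  assumes "continuous_on (U \<times> {c..d}) (\<lambda>(s, y). h s y)"
  shows "continuous_on U (\<lambda>s. coef (h s) i)"
proof -
  have ch: "continuous_on {c..d} (h t)" if "t \<in> U" for t
    by (rule continuous_on_section[OF assms that])
  have "continuous_on (U \<times> {c..d}) (\<lambda>p. (case p of (s, y) \<Rightarrow> h s y) * poly (\<l> i) (snd p))"
    by (intro continuous_on_mult assms continuous_on_compose2[OF continuous_on_poly_fun[of UNIV "\<l> i"] continuous_on_snd]) auto
  then have "continuous_on U (\<lambda>s. integral (cbox c d) (\<lambda>x. h s x * poly (\<l> i) x))"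
    by (intro integral_continuous_on_param) (simp add: case_prod_beta)
  then show ?thesis
    by (rule continuous_on_eq) (simp add: coef_eq_integral ch)
qed

end

text \<open>Regularity in time is known for point values of the discrete solution. This lemma expresses every linear
  functional of a polynomial through finitely many of them.\<close>

lemma Lagrange_interpolation:
  fixes s :: "nat \<Rightarrow> real"
  assumes inj: "inj_on s {..k}"
  shows "\<exists>L. \<forall>e. degree e \<le> k \<longrightarrow> e = (\<Sum>i\<le>k. smult (poly e (s i)) (L i))"
proof -
  define L where "L i = (\<Prod>j\<in>{..k} - {i}. smult (1 / (s i - s j)) [:- s j, 1:])" for i
  have pL: "poly (L i) (s m) = (if i = m then 1 else 0)" if "i \<le> k" "m \<le> k" for i m
  proof (cases "i = m")
    case True
    have "poly (smult (1 / (s i - s j)) [:- s j, 1:]) (s m) = 1" if j: "j \<in> {..k} - {i}" for j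
    proof -
      have "s i - s j \<noteq> 0" using inj_onD[OF inj, of i j] j \<open>i \<le> k\<close> by auto
      moreover have "poly (smult (1 / (s i - s j)) [:- s j, 1:]) (s m) = (s m - s j) / (s i - s j)"
        by (simp add: diff_divide_distrib)
      ultimately show ?thesis using True by (simp only: divide_self simp_thms)
    qed
    then have "poly (L i) (s m) = (\<Prod>j\<in>{..k} - {i}. 1)"
      unfolding L_def poly_prod by (intro prod.cong refl)
    then show ?thesis using True by simp
  next
    case False
    then have "poly (L i) (s m) = 0"
      unfolding L_def poly_prod using that by (intro prod_zero) (auto intro!: bexI[of _ m])
    then show ?thesis using False by simp
  qed
  have dL: "degree (L i) \<le> k" if "i \<le> k" for i
  proof -
    have "degree (L i) \<le> sum (degree \<circ> (\<lambda>j. smult (1 / (s i - s j)) [:- s j, 1:])) ({..k} - {i})"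
      unfolding L_def by (rule degree_prod_sum_le) simp
    also have "\<dots> \<le> (\<Sum>j\<in>{..k} - {i}. 1)"
      by (intro sum_mono) (auto intro: order_trans[OF degree_smult_le])
    also have "\<dots> = k" using that by simp
    finally show ?thesis .
  qed
  have "e = (\<Sum>i\<le>k. smult (poly e (s i)) (L i))" if e: "degree e \<le> k" for e
  proof (rule poly_eqI_degree[of "s ` {..k}"])
    show "poly e x = poly (\<Sum>i\<le>k. smult (poly e (s i)) (L i)) x" if x: "x \<in> s ` {..k}" for x
    proof -
      obtain m where m: "m \<le> k" "x = s m" using x by auto
      have "poly (\<Sum>i\<le>k. smult (poly e (s i)) (L i)) x = (\<Sum>i\<le>k. if i = m then poly e (s i) else 0)"
        unfolding poly_sum by (intro sum.cong) (auto simp: m pL)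
      then show ?thesis using m by simp
    qed
    have card: "card (s ` {..k}) = Suc k" using card_image[OF inj] by simp
    show "degree e < card (s ` {..k})" using e card by simp
    have "degree (\<Sum>i\<le>k. smult (poly e (s i)) (L i)) \<le> k"
      by (intro degree_sum_le order_trans[OF degree_smult_le] dL) auto
    then show "degree (\<Sum>i\<le>k. smult (poly e (s i)) (L i)) < card (s ` {..k})" using card by simp
  qed
  then show ?thesis by blast
qed

section \<open>Stability of the semidiscrete system\<close>

lemma sum_mult_le_sqrt:
  fixes u v :: "'j \<Rightarrow> real"
  assumes "(\<Sum>j\<in>J. (u j)\<^sup>2) \<le> U\<^sup>2" "0 \<le> U"
  shows "(\<Sum>j\<in>J. u j * v j) \<le> U * sqrt (\<Sum>j\<in>J. (v j)\<^sup>2)"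
proof -
  have "(\<Sum>j\<in>J. u j * v j)\<^sup>2 \<le> (\<Sum>j\<in>J. (u j)\<^sup>2) * (\<Sum>j\<in>J. (v j)\<^sup>2)"
    by (rule Cauchy_Schwarz_ineq_sum)
  also have "\<dots> \<le> U\<^sup>2 * (\<Sum>j\<in>J. (v j)\<^sup>2)"
    by (intro mult_right_mono assms sum_nonneg) simp
  also have "\<dots> = (U * sqrt (\<Sum>j\<in>J. (v j)\<^sup>2))\<^sup>2"
    by (simp add: power_mult_distrib sum_nonneg)
  finally show ?thesis
    by (rule power2_le_imp_le) (simp add: assms(2) sum_nonneg)
qed

text \<open>Dividing by twice the square root of the energy leaves a bounded derivative. The shift by \<open>\<eta>\<^sup>2\<close> keeps
  the square root differentiable where the energy vanishes.\<close>

lemma sqrt_growth: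
  fixes e :: "real \<Rightarrow> real"
  assumes "0 \<le> t" "0 \<le> L"
    and d: "\<And>s. s \<in> {0..t} \<Longrightarrow> (e has_real_derivative e' s) (at s within {0..t})"
    and nn: "\<And>s. s \<in> {0..t} \<Longrightarrow> 0 \<le> e s"
    and le: "\<And>s. s \<in> {0..t} \<Longrightarrow> e' s \<le> 2 * L * sqrt (e s)"
  shows "sqrt (e t) \<le> sqrt (e 0) + L * t"
proof (cases "t = 0")
  case True then show ?thesis by simp
next
  case False
  then have t: "0 < t" using assms by simp
  show ?thesis
  proof (rule field_le_epsilon)
    fix \<eta> :: real assume \<eta>: "0 < \<eta>"
    have pos: "0 < e s + \<eta>\<^sup>2" if "s \<in> {0..t}" for s using nn[OF that] \<eta> by (simp add: add_nonneg_pos)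
    have "\<exists>s\<in>{0<..<t}. sqrt (e t + \<eta>\<^sup>2) - sqrt (e 0 + \<eta>\<^sup>2) = (e' s * (inverse (sqrt (e s + \<eta>\<^sup>2)) / 2)) * (t - 0)"
    proof (rule mvt_simple[OF t, where f="\<lambda>s. sqrt (e s + \<eta>\<^sup>2)" and f'="\<lambda>s h. (e' s * (inverse (sqrt (e s + \<eta>\<^sup>2)) / 2)) * h"])
      fix s assume s: "0 \<le> s" "s \<le> t"
      have "((\<lambda>s. e s + \<eta>\<^sup>2) has_real_derivative e' s + 0) (at s within {0..t})"
        using s by (intro DERIV_add d DERIV_const) auto
      moreover have "(sqrt has_real_derivative inverse (sqrt (e s + \<eta>\<^sup>2)) / 2) (at (e s + \<eta>\<^sup>2))"
        using s by (intro DERIV_real_sqrt pos) simp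
      ultimately have "((\<lambda>s. sqrt (e s + \<eta>\<^sup>2)) has_real_derivative (inverse (sqrt (e s + \<eta>\<^sup>2)) / 2) * (e' s + 0)) (at s within {0..t})"
        by (rule DERIV_chain2[rotated])
      moreover have "(inverse (sqrt (e s + \<eta>\<^sup>2)) / 2) * (e' s + 0) = e' s * (inverse (sqrt (e s + \<eta>\<^sup>2)) / 2)" by simp
      ultimately show "((\<lambda>s. sqrt (e s + \<eta>\<^sup>2)) has_derivative (\<lambda>h. (e' s * (inverse (sqrt (e s + \<eta>\<^sup>2)) / 2)) * h)) (at s within {0..t})"
        by (simp only: has_field_derivative_def)
    qed
    then obtain s where s: "s \<in> {0<..<t}"
      and eq: "sqrt (e t + \<eta>\<^sup>2) - sqrt (e 0 + \<eta>\<^sup>2) = (e' s * (inverse (sqrt (e s + \<eta>\<^sup>2)) / 2)) * t" by auto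
    have ps: "0 < e s + \<eta>\<^sup>2" using pos s by simp
    have "e' s * (inverse (sqrt (e s + \<eta>\<^sup>2)) / 2) \<le> (2 * L * sqrt (e s + \<eta>\<^sup>2)) * (inverse (sqrt (e s + \<eta>\<^sup>2)) / 2)"
    proof (rule mult_right_mono)
      have "e' s \<le> 2 * L * sqrt (e s)" using le s by simp
      also have "\<dots> \<le> 2 * L * sqrt (e s + \<eta>\<^sup>2)" using assms(2) by (intro mult_left_mono) auto
      finally show "e' s \<le> 2 * L * sqrt (e s + \<eta>\<^sup>2)" .
    qed (use ps in simp)
    also have "\<dots> = L" using ps by simp
    finally have "(e' s * (inverse (sqrt (e s + \<eta>\<^sup>2)) / 2)) * t \<le> L * t" using t by (intro mult_right_mono) auto
    moreover have "sqrt (e 0 + \<eta>\<^sup>2) \<le> sqrt (e 0) + sqrt (\<eta>\<^sup>2)"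
      using nn[of 0] assms(1) by (intro sqrt_add_le_add_sqrt) auto
    moreover have "sqrt (e t) \<le> sqrt (e t + \<eta>\<^sup>2)" by simp
    moreover have "sqrt (\<eta>\<^sup>2) = \<eta>" using \<eta> by simp
    ultimately show "sqrt (e t) \<le> sqrt (e 0) + L * t + \<eta>" using eq by linarith
  qed
qed

definition energy :: "real \<Rightarrow> real \<Rightarrow> 'j set \<Rightarrow> ('j \<Rightarrow> real) \<Rightarrow> ('j \<Rightarrow> real) \<Rightarrow> real" where
  "energy a b J z y = a * (\<Sum>j\<in>J. (z j)\<^sup>2) + b * (\<Sum>j\<in>J. (y j)\<^sup>2)"

text \<open>The constant by which the root of the energy bounds the sum of the two Euclidean norms.\<close>

definition energy_factor :: "real \<Rightarrow> real \<Rightarrow> real" where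
  "energy_factor a b = 1 / sqrt a + 1 / sqrt b"

lemma energy_bounds:
  assumes "0 < a" "0 < b"
  shows "0 \<le> energy a b J z y"
    and "sqrt (\<Sum>j\<in>J. (z j)\<^sup>2) + sqrt (\<Sum>j\<in>J. (y j)\<^sup>2) \<le> energy_factor a b * sqrt (energy a b J z y)"
    and "a * (\<Sum>j\<in>J. (z j)\<^sup>2) \<le> energy a b J z y" "b * (\<Sum>j\<in>J. (y j)\<^sup>2) \<le> energy a b J z y"
proof -
  have nn: "0 \<le> a * (\<Sum>j\<in>J. (z j)\<^sup>2)" "0 \<le> b * (\<Sum>j\<in>J. (y j)\<^sup>2)"
    using assms by (auto intro!: mult_nonneg_nonneg sum_nonneg)
  show "0 \<le> energy a b J z y" using nn by (simp add: energy_def)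
  show za: "a * (\<Sum>j\<in>J. (z j)\<^sup>2) \<le> energy a b J z y" and yb: "b * (\<Sum>j\<in>J. (y j)\<^sup>2) \<le> energy a b J z y"
    using nn by (auto simp: energy_def)
  have "sqrt (\<Sum>j\<in>J. (z j)\<^sup>2) = 1 / sqrt a * sqrt (a * (\<Sum>j\<in>J. (z j)\<^sup>2))"
    "sqrt (\<Sum>j\<in>J. (y j)\<^sup>2) = 1 / sqrt b * sqrt (b * (\<Sum>j\<in>J. (y j)\<^sup>2))"
    using assms by (simp_all add: real_sqrt_mult)
  moreover have "1 / sqrt a * sqrt (a * (\<Sum>j\<in>J. (z j)\<^sup>2)) \<le> 1 / sqrt a * sqrt (energy a b J z y)"
    "1 / sqrt b * sqrt (b * (\<Sum>j\<in>J. (y j)\<^sup>2)) \<le> 1 / sqrt b * sqrt (energy a b J z y)"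
    using assms za yb by (intro mult_left_mono; simp)+
  ultimately show "sqrt (\<Sum>j\<in>J. (z j)\<^sup>2) + sqrt (\<Sum>j\<in>J. (y j)\<^sup>2) \<le> energy_factor a b * sqrt (energy a b J z y)"
    by (simp add: energy_factor_def distrib_right)
qed

text \<open>In the derivative of the energy the terms with \<open>\<alpha>\<close> and \<open>\<beta>\<close> cancel by skew symmetry, and the term with \<open>W\<close>
  has a favourable sign. Only the right-hand sides remain.\<close>

lemma energy_estimate:
  fixes z y \<alpha> \<beta> \<rho> \<sigma> :: "real \<Rightarrow> 'j \<Rightarrow> real" and W :: "('j \<Rightarrow> real) \<Rightarrow> 'j \<Rightarrow> real"
  assumes ab: "0 < a" "0 < b" and t: "0 \<le> t" and g: "0 \<le> g"
    and W: "\<And>u. 0 \<le> (\<Sum>j\<in>J. W u j * u j)"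
    and dz: "\<And>s j. s \<in> {0..t} \<Longrightarrow> j \<in> J \<Longrightarrow>
      ((\<lambda>s. z s j) has_real_derivative (\<rho> s j - \<beta> s j) / a) (at s within {0..t})"
    and dy: "\<And>s j. s \<in> {0..t} \<Longrightarrow> j \<in> J \<Longrightarrow>
      ((\<lambda>s. y s j) has_real_derivative (\<sigma> s j - \<alpha> s j - W (y s) j) / b) (at s within {0..t})"
    and skew: "\<And>s. s \<in> {0..t} \<Longrightarrow> (\<Sum>j\<in>J. z s j * \<beta> s j + y s j * \<alpha> s j) = 0"
    and \<rho>: "\<And>s. s \<in> {0..t} \<Longrightarrow> (\<Sum>j\<in>J. (\<rho> s j)\<^sup>2) \<le> g\<^sup>2"
    and \<sigma>: "\<And>s. s \<in> {0..t} \<Longrightarrow> (\<Sum>j\<in>J. (\<sigma> s j)\<^sup>2) \<le> g\<^sup>2"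
  shows "sqrt (energy a b J (z t) (y t)) \<le> sqrt (energy a b J (z 0) (y 0)) + g * energy_factor a b * t"
proof (rule sqrt_growth[OF t, where e="\<lambda>s. energy a b J (z s) (y s)"
      and e'="\<lambda>s. a * (\<Sum>j\<in>J. 2 * z s j * ((\<rho> s j - \<beta> s j) / a))
        + b * (\<Sum>j\<in>J. 2 * y s j * ((\<sigma> s j - \<alpha> s j - W (y s) j) / b))"])
  show "0 \<le> g * energy_factor a b" using g ab by (simp add: energy_factor_def)
  fix s assume s: "s \<in> {0..t}"
  show "0 \<le> energy a b J (z s) (y s)" by (rule energy_bounds(1)[OF ab])
  have sq: "((\<lambda>s. (u s)\<^sup>2) has_real_derivative 2 * u s * D) (at s within {0..t})"
    if "(u has_real_derivative D) (at s within {0..t})" for u :: "real \<Rightarrow> real" and D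
    using DERIV_power[OF that, of 2] by (simp add: mult_ac)
  show "((\<lambda>s. energy a b J (z s) (y s)) has_real_derivative
     a * (\<Sum>j\<in>J. 2 * z s j * ((\<rho> s j - \<beta> s j) / a))
        + b * (\<Sum>j\<in>J. 2 * y s j * ((\<sigma> s j - \<alpha> s j - W (y s) j) / b))) (at s within {0..t})"
    unfolding energy_def by (intro DERIV_add DERIV_cmult DERIV_sum sq dz dy s)
  have "a * (\<Sum>j\<in>J. 2 * z s j * ((\<rho> s j - \<beta> s j) / a))
        + b * (\<Sum>j\<in>J. 2 * y s j * ((\<sigma> s j - \<alpha> s j - W (y s) j) / b))
     = (\<Sum>j\<in>J. 2 * (\<rho> s j * z s j) + 2 * (\<sigma> s j * y s j) - 2 * (z s j * \<beta> s j + y s j * \<alpha> s j) - 2 * (W (y s) j * y s j))"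
  proof -
    have "r * (\<Sum>j\<in>J. 2 * u j * (v j / r)) = (\<Sum>j\<in>J. 2 * u j * v j)" if "r \<noteq> 0" for r and u v :: "'j \<Rightarrow> real"
      using that by (simp add: sum_distrib_left)
    then have "a * (\<Sum>j\<in>J. 2 * z s j * ((\<rho> s j - \<beta> s j) / a)) = (\<Sum>j\<in>J. 2 * z s j * (\<rho> s j - \<beta> s j))"
      "b * (\<Sum>j\<in>J. 2 * y s j * ((\<sigma> s j - \<alpha> s j - W (y s) j) / b)) = (\<Sum>j\<in>J. 2 * y s j * (\<sigma> s j - \<alpha> s j - W (y s) j))"
      using ab by simp_all
    then show ?thesis
      unfolding sum.distrib[symmetric] by (simp add: sum.distrib[symmetric]) (simp add: algebra_simps)
  qed
  also have "\<dots> = 2 * (\<Sum>j\<in>J. \<rho> s j * z s j) + 2 * (\<Sum>j\<in>J. \<sigma> s j * y s j)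
      - 2 * (\<Sum>j\<in>J. z s j * \<beta> s j + y s j * \<alpha> s j) - 2 * (\<Sum>j\<in>J. W (y s) j * y s j)"
    by (simp only: sum.distrib sum_subtractf sum_distrib_left[symmetric])
  also have "\<dots> \<le> 2 * (\<Sum>j\<in>J. \<rho> s j * z s j) + 2 * (\<Sum>j\<in>J. \<sigma> s j * y s j)"
    using skew[OF s] W[of "y s"] by simp
  also have "\<dots> \<le> 2 * (g * sqrt (\<Sum>j\<in>J. (z s j)\<^sup>2)) + 2 * (g * sqrt (\<Sum>j\<in>J. (y s j)\<^sup>2))"
    by (intro add_mono mult_left_mono sum_mult_le_sqrt \<rho> \<sigma> s g) auto
  also have "\<dots> = 2 * g * (sqrt (\<Sum>j\<in>J. (z s j)\<^sup>2) + sqrt (\<Sum>j\<in>J. (y s j)\<^sup>2))" by (simp add: algebra_simps)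
  also have "\<dots> \<le> 2 * g * (energy_factor a b * sqrt (energy a b J (z s) (y s)))"
    using g by (intro mult_left_mono energy_bounds(2) ab) auto
  finally show "a * (\<Sum>j\<in>J. 2 * z s j * ((\<rho> s j - \<beta> s j) / a))
        + b * (\<Sum>j\<in>J. 2 * y s j * ((\<sigma> s j - \<alpha> s j - W (y s) j) / b))
     \<le> 2 * (g * energy_factor a b) * sqrt (energy a b J (z s) (y s))"
    by (simp add: mult_ac)
qed

text \<open>The sum of the bounds for \<open>z\<close>, \<open>y\<close>, \<open>\<beta>\<close> and \<open>\<alpha>\<close>, in this order.\<close>

definition stability_const :: "real \<Rightarrow> real \<Rightarrow> real \<Rightarrow> real \<Rightarrow> real" where
  "stability_const a b B T = (let q = (energy_factor a b)\<^sup>2 in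
     q * T\<^sup>2 / a + q * T\<^sup>2 / b + (2 + 2 * a * (q * (1 + T)\<^sup>2))
     + (3 + 3 * B\<^sup>2 * (q * T\<^sup>2 / b) + 3 * b * (q * (1 + T)\<^sup>2)))"

text \<open>The unknowns \<open>z\<close> and \<open>y\<close> are the moments of the two errors, \<open>\<alpha>\<close> and \<open>\<beta>\<close> the moments of their derivatives
  in space. The energy controls \<open>z\<close> and \<open>y\<close>. By the equations, \<open>\<alpha>\<close> and \<open>\<beta>\<close> are controlled as soon as
  the time derivatives of \<open>z\<close> and \<open>y\<close> are. The equations cannot be differentiated in time, because \<open>\<alpha>\<close>
  and \<open>\<beta>\<close> need not be differentiable; but time differences \<open>z (r + \<tau>) - z r\<close> satisfy the same equations with
  right-hand sides of size \<open>G \<tau>\<close>, and their initial value \<open>z \<tau>\<close> is of size \<open>\<tau>\<close> by the energy estimate itself,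
  because \<open>z\<close> and \<open>y\<close> start from zero. Dividing by \<open>\<tau>\<close> bounds the derivatives.\<close>

lemma stability:
  fixes z y \<alpha> \<beta> \<rho> \<sigma> :: "real \<Rightarrow> 'j \<Rightarrow> real" and W :: "('j \<Rightarrow> real) \<Rightarrow> 'j \<Rightarrow> real"
  assumes ab: "0 < a" "0 < b" and T: "0 < T" and G: "0 \<le> G"
    and W: "\<And>u. 0 \<le> (\<Sum>j\<in>J. W u j * u j)"
    and W_diff: "\<And>u v j. j \<in> J \<Longrightarrow> W (\<lambda>i. u i - v i) j = W u j - W v j"
    and W_bound: "\<And>u. (\<Sum>j\<in>J. (W u j)\<^sup>2) \<le> B\<^sup>2 * (\<Sum>j\<in>J. (u j)\<^sup>2)"
    and dz: "\<And>s j. s \<in> {0..T} \<Longrightarrow> j \<in> J \<Longrightarrow>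
      ((\<lambda>s. z s j) has_real_derivative (\<rho> s j - \<beta> s j) / a) (at s within {0..T})"
    and dy: "\<And>s j. s \<in> {0..T} \<Longrightarrow> j \<in> J \<Longrightarrow>
      ((\<lambda>s. y s j) has_real_derivative (\<sigma> s j - \<alpha> s j - W (y s) j) / b) (at s within {0..T})"
    and init: "\<And>j. j \<in> J \<Longrightarrow> z 0 j = 0" "\<And>j. j \<in> J \<Longrightarrow> y 0 j = 0"
    and skew: "\<And>s. s \<in> {0..T} \<Longrightarrow> (\<Sum>j\<in>J. z s j * \<beta> s j + y s j * \<alpha> s j) = 0"
    and skew_diff: "\<And>s t. s \<in> {0..T} \<Longrightarrow> t \<in> {0..T} \<Longrightarrow>
      (\<Sum>j\<in>J. (z t j - z s j) * (\<beta> t j - \<beta> s j) + (y t j - y s j) * (\<alpha> t j - \<alpha> s j)) = 0"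
    and \<rho>: "\<And>s. s \<in> {0..T} \<Longrightarrow> (\<Sum>j\<in>J. (\<rho> s j)\<^sup>2) \<le> G\<^sup>2"
    and \<sigma>: "\<And>s. s \<in> {0..T} \<Longrightarrow> (\<Sum>j\<in>J. (\<sigma> s j)\<^sup>2) \<le> G\<^sup>2"
    and \<rho>_diff: "\<And>s t. s \<in> {0..T} \<Longrightarrow> t \<in> {0..T} \<Longrightarrow> (\<Sum>j\<in>J. (\<rho> t j - \<rho> s j)\<^sup>2) \<le> (G * \<bar>t - s\<bar>)\<^sup>2"
    and \<sigma>_diff: "\<And>s t. s \<in> {0..T} \<Longrightarrow> t \<in> {0..T} \<Longrightarrow> (\<Sum>j\<in>J. (\<sigma> t j - \<sigma> s j)\<^sup>2) \<le> (G * \<bar>t - s\<bar>)\<^sup>2"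
    and t: "t \<in> {0..T}"
  shows "(\<Sum>j\<in>J. (z t j)\<^sup>2) + (\<Sum>j\<in>J. (y t j)\<^sup>2) + (\<Sum>j\<in>J. (\<beta> t j)\<^sup>2) + (\<Sum>j\<in>J. (\<alpha> t j)\<^sup>2)
    \<le> stability_const a b B T * G\<^sup>2"
proof -
  let ?\<kappa> = "energy_factor a b"
  have \<kappa>: "0 \<le> ?\<kappa>" using ab by (simp add: energy_factor_def)
  let ?E = "energy a b J"
  have E0: "?E (z 0) (y 0) = 0" using init by (simp add: energy_def)
  have E: "sqrt (?E (z s) (y s)) \<le> G * ?\<kappa> * s" if s: "s \<in> {0..T}" for s
  proof -
    have sub: "{0..s} \<subseteq> {0..T}" using s by auto
    have "sqrt (?E (z s) (y s)) \<le> sqrt (?E (z 0) (y 0)) + G * ?\<kappa> * s"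
    proof (rule energy_estimate[OF ab _ G W, where \<rho>=\<rho> and \<sigma>=\<sigma> and \<alpha>=\<alpha> and \<beta>=\<beta>])
      show "((\<lambda>s. z s j) has_real_derivative (\<rho> r j - \<beta> r j) / a) (at r within {0..s})"
        if "r \<in> {0..s}" "j \<in> J" for r j
        by (rule has_field_derivative_subset[OF dz sub]) (use that sub in auto)
      show "((\<lambda>s. y s j) has_real_derivative (\<sigma> r j - \<alpha> r j - W (y r) j) / b) (at r within {0..s})"
        if "r \<in> {0..s}" "j \<in> J" for r j
        by (rule has_field_derivative_subset[OF dy sub]) (use that sub in auto)
    qed (use s sub skew \<rho> \<sigma> in auto)
    then show ?thesis using E0 by simp
  qed
  define L where "L = G * ?\<kappa> * (1 + T)"
  have L0: "0 \<le> L" using G \<kappa> T by (simp add: L_def)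
  have Ed: "sqrt (?E (\<lambda>j. z (s + \<tau>) j - z s j) (\<lambda>j. y (s + \<tau>) j - y s j)) \<le> L * \<tau>"
    if s: "0 \<le> s" "0 \<le> \<tau>" "s + \<tau> \<le> T" for s \<tau>
  proof -
    have shift: "((\<lambda>r. u (r + \<tau>) - u r) has_real_derivative D (r + \<tau>) - D r) (at r within {0..s})"
      if D: "\<And>r. r \<in> {0..T} \<Longrightarrow> (u has_real_derivative D r) (at r within {0..T})" and r: "r \<in> {0..s}"
      for u D :: "real \<Rightarrow> real" and r
    proof -
      have "(u \<circ> (\<lambda>r. r + \<tau>) has_real_derivative D (r + \<tau>) * (1 + 0)) (at r within {0..s})"
      proof (rule DERIV_image_chain)
        show "(u has_real_derivative D (r + \<tau>)) (at (r + \<tau>) within (\<lambda>r. r + \<tau>) ` {0..s})"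
          by (rule has_field_derivative_subset[OF D]) (use r s in auto)
        show "((\<lambda>r. r + \<tau>) has_real_derivative 1 + 0) (at r within {0..s})"
          by (intro DERIV_add DERIV_ident DERIV_const)
      qed
      moreover have "(u has_real_derivative D r) (at r within {0..s})"
        by (rule has_field_derivative_subset[OF D]) (use r s in auto)
      ultimately show ?thesis using DERIV_diff by (fastforce simp: o_def)
    qed
    have "sqrt (?E (\<lambda>j. z (s + \<tau>) j - z s j) (\<lambda>j. y (s + \<tau>) j - y s j))
       \<le> sqrt (?E (\<lambda>j. z (0 + \<tau>) j - z 0 j) (\<lambda>j. y (0 + \<tau>) j - y 0 j)) + (G * \<tau>) * ?\<kappa> * s"
    proof (rule energy_estimate[OF ab s(1) _ W, where z="\<lambda>r j. z (r + \<tau>) j - z r j" and y="\<lambda>r j. y (r + \<tau>) j - y r j"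
          and \<rho>="\<lambda>r j. \<rho> (r + \<tau>) j - \<rho> r j" and \<sigma>="\<lambda>r j. \<sigma> (r + \<tau>) j - \<sigma> r j"
          and \<alpha>="\<lambda>r j. \<alpha> (r + \<tau>) j - \<alpha> r j" and \<beta>="\<lambda>r j. \<beta> (r + \<tau>) j - \<beta> r j"])
      show "0 \<le> G * \<tau>" using G s by simp
      fix r assume r: "r \<in> {0..s}"
      then have rr: "r \<in> {0..T}" "r + \<tau> \<in> {0..T}" using s by auto
      show "(\<Sum>j\<in>J. (z (r + \<tau>) j - z r j) * (\<beta> (r + \<tau>) j - \<beta> r j) + (y (r + \<tau>) j - y r j) * (\<alpha> (r + \<tau>) j - \<alpha> r j)) = 0"
        by (rule skew_diff[OF rr])
      show "(\<Sum>j\<in>J. (\<rho> (r + \<tau>) j - \<rho> r j)\<^sup>2) \<le> (G * \<tau>)\<^sup>2" using \<rho>_diff[OF rr] s by simp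
      show "(\<Sum>j\<in>J. (\<sigma> (r + \<tau>) j - \<sigma> r j)\<^sup>2) \<le> (G * \<tau>)\<^sup>2" using \<sigma>_diff[OF rr] s by simp
      fix j assume j: "j \<in> J"
      have "((\<lambda>r. z (r + \<tau>) j - z r j) has_real_derivative
         (\<rho> (r + \<tau>) j - \<beta> (r + \<tau>) j) / a - (\<rho> r j - \<beta> r j) / a) (at r within {0..s})"
        using dz j by (intro shift[where D="\<lambda>r. (\<rho> r j - \<beta> r j) / a"] r) auto
      then show "((\<lambda>r. z (r + \<tau>) j - z r j) has_real_derivative
         ((\<rho> (r + \<tau>) j - \<rho> r j) - (\<beta> (r + \<tau>) j - \<beta> r j)) / a) (at r within {0..s})"
        by (simp only: diff_divide_distrib) (simp only: algebra_simps)
      have "((\<lambda>r. y (r + \<tau>) j - y r j) has_real_derivative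
         (\<sigma> (r + \<tau>) j - \<alpha> (r + \<tau>) j - W (y (r + \<tau>)) j) / b - (\<sigma> r j - \<alpha> r j - W (y r) j) / b) (at r within {0..s})"
        using dy j by (intro shift[where D="\<lambda>r. (\<sigma> r j - \<alpha> r j - W (y r) j) / b"] r) auto
      then show "((\<lambda>r. y (r + \<tau>) j - y r j) has_real_derivative
         ((\<sigma> (r + \<tau>) j - \<sigma> r j) - (\<alpha> (r + \<tau>) j - \<alpha> r j) - W (\<lambda>j. y (r + \<tau>) j - y r j) j) / b) (at r within {0..s})"
        by (simp only: W_diff[OF j] diff_divide_distrib) (simp only: algebra_simps)
    qed
    also have "?E (\<lambda>j. z (0 + \<tau>) j - z 0 j) (\<lambda>j. y (0 + \<tau>) j - y 0 j) = ?E (z \<tau>) (y \<tau>)"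
      using init by (simp add: energy_def)
    also have "sqrt (?E (z \<tau>) (y \<tau>)) + (G * \<tau>) * ?\<kappa> * s \<le> G * ?\<kappa> * \<tau> + (G * \<tau>) * ?\<kappa> * T"
      using s G \<kappa> by (intro add_mono E mult_left_mono) auto
    also have "\<dots> = L * \<tau>" by (simp add: L_def algebra_simps)
    finally show ?thesis .
  qed
  have Ld: "a * (\<Sum>j\<in>J. (z s j - z t j)\<^sup>2) \<le> (L * (s - t))\<^sup>2" "b * (\<Sum>j\<in>J. (y s j - y t j)\<^sup>2) \<le> (L * (s - t))\<^sup>2"
    if s: "s \<in> {0..T}" for s
  proof -
    have "?E (\<lambda>j. z s j - z t j) (\<lambda>j. y s j - y t j) \<le> (L * (s - t))\<^sup>2"
    proof (cases "t \<le> s")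
      case True
      have "sqrt (?E (\<lambda>j. z s j - z t j) (\<lambda>j. y s j - y t j)) \<le> L * (s - t)"
        using Ed[of t "s - t"] s t True by simp
      then show ?thesis by (simp add: sqrt_le_D)
    next
      case False
      have "sqrt (?E (\<lambda>j. z t j - z s j) (\<lambda>j. y t j - y s j)) \<le> L * (t - s)"
        using Ed[of s "t - s"] s t False by simp
      then have "?E (\<lambda>j. z t j - z s j) (\<lambda>j. y t j - y s j) \<le> (L * (t - s))\<^sup>2" by (rule sqrt_le_D)
      then show ?thesis
        by (simp add: energy_def power2_commute[of "z t _"] power2_commute[of "y t _"] power_mult_distrib power2_commute[of t])
    qed
    then show "a * (\<Sum>j\<in>J. (z s j - z t j)\<^sup>2) \<le> (L * (s - t))\<^sup>2" "b * (\<Sum>j\<in>J. (y s j - y t j)\<^sup>2) \<le> (L * (s - t))\<^sup>2"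
      using energy_bounds(3,4)[OF ab, where J=J and z="\<lambda>j. z s j - z t j" and y="\<lambda>j. y s j - y t j"] by linarith+
  qed
  \<comment> \<open>Lipschitz bounds pass to the limit of difference quotients.\<close>
  have deriv_bound: "r * (\<Sum>j\<in>J. (D j)\<^sup>2) \<le> L\<^sup>2"
    if d: "\<And>j. j \<in> J \<Longrightarrow> ((\<lambda>s. u s j) has_real_derivative D j) (at t within {0..T})"
      and le: "\<And>s. s \<in> {0..T} \<Longrightarrow> r * (\<Sum>j\<in>J. (u s j - u t j)\<^sup>2) \<le> (L * (s - t))\<^sup>2"
    for u :: "real \<Rightarrow> 'j \<Rightarrow> real" and D r
  proof (rule tendsto_upperbound)
    show "((\<lambda>s. r * (\<Sum>j\<in>J. ((u s j - u t j) / (s - t))\<^sup>2)) \<longlongrightarrow> r * (\<Sum>j\<in>J. (D j)\<^sup>2)) (at t within {0..T})"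
      using d by (intro tendsto_intros) (auto simp: has_field_derivative_iff)
    show "\<forall>\<^sub>F s in at t within {0..T}. r * (\<Sum>j\<in>J. ((u s j - u t j) / (s - t))\<^sup>2) \<le> L\<^sup>2"
      unfolding eventually_at_filter
    proof (intro always_eventually allI impI)
      fix s assume s: "s \<noteq> t" "s \<in> {0..T}"
      have "r * (\<Sum>j\<in>J. ((u s j - u t j) / (s - t))\<^sup>2) = r * (\<Sum>j\<in>J. (u s j - u t j)\<^sup>2) / (s - t)\<^sup>2"
        by (simp add: power_divide sum_divide_distrib[symmetric])
      also have "\<dots> \<le> (L * (s - t))\<^sup>2 / (s - t)\<^sup>2" using s by (intro divide_right_mono le) auto
      also have "\<dots> = L\<^sup>2" using s by (simp add: power_mult_distrib)
      finally show "r * (\<Sum>j\<in>J. ((u s j - u t j) / (s - t))\<^sup>2) \<le> L\<^sup>2" .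
    qed
    show "at t within {0..T} \<noteq> bot"
      using t T connected_imp_perfect[of "{0..T}" t] by (auto simp: trivial_limit_within set_eq_iff)
  qed
  have z': "a * (\<Sum>j\<in>J. ((\<rho> t j - \<beta> t j) / a)\<^sup>2) \<le> L\<^sup>2"
    by (rule deriv_bound[OF dz[OF t] Ld(1)])
  have y': "b * (\<Sum>j\<in>J. ((\<sigma> t j - \<alpha> t j - W (y t) j) / b)\<^sup>2) \<le> L\<^sup>2"
    by (rule deriv_bound[OF dy[OF t] Ld(2)])
  let ?q = "?\<kappa>\<^sup>2"
  have L2: "L\<^sup>2 = ?q * (1 + T)\<^sup>2 * G\<^sup>2" by (simp add: L_def power_mult_distrib mult_ac)
  have Et: "?E (z t) (y t) \<le> ?q * T\<^sup>2 * G\<^sup>2"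
  proof -
    have "G * ?\<kappa> * t \<le> G * ?\<kappa> * T" using t G \<kappa> by (intro mult_left_mono) auto
    then have "sqrt (?E (z t) (y t)) \<le> G * ?\<kappa> * T" using E[OF t] by linarith
    then have "?E (z t) (y t) \<le> (G * ?\<kappa> * T)\<^sup>2" by (rule sqrt_le_D)
    then show ?thesis by (simp add: power_mult_distrib mult_ac)
  qed
  have zb: "(\<Sum>j\<in>J. (z t j)\<^sup>2) \<le> ?q * T\<^sup>2 / a * G\<^sup>2"
    using order_trans[OF energy_bounds(3)[OF ab] Et] ab by (simp add: field_simps)
  have yb: "(\<Sum>j\<in>J. (y t j)\<^sup>2) \<le> ?q * T\<^sup>2 / b * G\<^sup>2"
    using order_trans[OF energy_bounds(4)[OF ab] Et] ab by (simp add: field_simps)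
  have s2: "(p - r)\<^sup>2 \<le> 2 * p\<^sup>2 + 2 * r\<^sup>2" for p r :: real
    using zero_le_power2[of "p + r"] by (simp add: power2_sum power2_diff)
  have s3: "(p - r - w)\<^sup>2 \<le> 3 * p\<^sup>2 + 3 * r\<^sup>2 + 3 * w\<^sup>2" for p r w :: real
    using zero_le_power2[of "p + r"] zero_le_power2[of "p + w"] zero_le_power2[of "r - w"]
    by (simp add: power2_sum power2_diff algebra_simps)
  have "(\<Sum>j\<in>J. (\<beta> t j)\<^sup>2) \<le> (\<Sum>j\<in>J. 2 * (\<rho> t j)\<^sup>2 + 2 * (a * ((\<rho> t j - \<beta> t j) / a))\<^sup>2)"
    using s2[of "\<rho> t j" "\<rho> t j - \<beta> t j" for j] ab by (intro sum_mono) simp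
  also have "\<dots> = 2 * (\<Sum>j\<in>J. (\<rho> t j)\<^sup>2) + 2 * a * (a * (\<Sum>j\<in>J. ((\<rho> t j - \<beta> t j) / a)\<^sup>2))"
    by (simp only: sum.distrib sum_distrib_left[symmetric] power_mult_distrib) (simp only: power2_eq_square[of a] mult_ac)
  also have "\<dots> \<le> 2 * G\<^sup>2 + 2 * a * L\<^sup>2"
    using ab by (intro add_mono mult_left_mono \<rho>[OF t] z') auto
  finally have \<beta>b: "(\<Sum>j\<in>J. (\<beta> t j)\<^sup>2) \<le> 2 * G\<^sup>2 + 2 * a * L\<^sup>2" .
  have "(\<Sum>j\<in>J. (\<alpha> t j)\<^sup>2) \<le> (\<Sum>j\<in>J. 3 * (\<sigma> t j)\<^sup>2 + 3 * (W (y t) j)\<^sup>2 + 3 * (b * ((\<sigma> t j - \<alpha> t j - W (y t) j) / b))\<^sup>2)"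
    using s3[of "\<sigma> t j" "W (y t) j" "\<sigma> t j - \<alpha> t j - W (y t) j" for j] ab by (intro sum_mono) simp
  also have "\<dots> = 3 * (\<Sum>j\<in>J. (\<sigma> t j)\<^sup>2) + 3 * (\<Sum>j\<in>J. (W (y t) j)\<^sup>2)
      + 3 * b * (b * (\<Sum>j\<in>J. ((\<sigma> t j - \<alpha> t j - W (y t) j) / b)\<^sup>2))"
    by (simp only: sum.distrib sum_distrib_left[symmetric] power_mult_distrib) (simp only: power2_eq_square[of b] mult_ac)
  also have "\<dots> \<le> 3 * G\<^sup>2 + 3 * (B\<^sup>2 * (?q * T\<^sup>2 / b * G\<^sup>2)) + 3 * b * L\<^sup>2"
    using ab order_trans[OF W_bound mult_left_mono[OF yb, of "B\<^sup>2"]]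
    by (intro add_mono mult_left_mono \<sigma>[OF t] y') auto
  finally have \<alpha>b: "(\<Sum>j\<in>J. (\<alpha> t j)\<^sup>2) \<le> 3 * G\<^sup>2 + 3 * (B\<^sup>2 * (?q * T\<^sup>2 / b * G\<^sup>2)) + 3 * b * L\<^sup>2" .
  have "stability_const a b B T * G\<^sup>2 = ?q * T\<^sup>2 / a * G\<^sup>2 + ?q * T\<^sup>2 / b * G\<^sup>2 + (2 * G\<^sup>2 + 2 * a * L\<^sup>2)
    + (3 * G\<^sup>2 + 3 * (B\<^sup>2 * (?q * T\<^sup>2 / b * G\<^sup>2)) + 3 * b * L\<^sup>2)"
    unfolding L2 stability_const_def Let_def by (simp add: algebra_simps)
  then show ?thesis using zb yb \<beta>b \<alpha>b by linarith
qed

section \<open>Piecewise polynomials on a mesh\<close>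

locale mesh =
  fixes xL xR :: real and N :: nat and x :: "nat \<Rightarrow> real" and k :: nat
  assumes is_mesh: "is_mesh xL xR N x" and k1: "1 \<le> k"
begin

lemma x_0: "x 0 = xL" and x_N: "x N = xR" and N1: "1 \<le> N"
  using is_mesh by (auto simp: is_mesh_def)

lemma x_step: "n < N \<Longrightarrow> x n < x (Suc n)"
  using is_mesh by (auto simp: is_mesh_def dest!: bspec[of _ _ "Suc n"])

lemma x_strict_mono: "i < j \<Longrightarrow> j \<le> N \<Longrightarrow> x i < x j"
proof (induction j)
  case (Suc j)
  then have "x j < x (Suc j)" by (intro x_step) simp
  with Suc show ?case by (cases "i = j") auto
qed simp

lemma x_mono: "i \<le> j \<Longrightarrow> j \<le> N \<Longrightarrow> x i \<le> x j"
  using x_strict_mono[of i j] by (cases "i = j") auto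

lemma element_subset: "n < N \<Longrightarrow> {x n..x (Suc n)} \<subseteq> {xL..xR}"
  using x_mono[of 0 n] x_mono[of "Suc n" N] x_0 x_N by auto

lemma open_element_subset: "n < N \<Longrightarrow> {x n<..<x (Suc n)} \<subseteq> {xL<..<xR}"
  using x_mono[of 0 n] x_mono[of "Suc n" N] x_0 x_N by auto

lemma node_in: "n \<le> N \<Longrightarrow> x n \<in> {xL..xR}"
  using x_mono[of 0 n] x_mono[of n N] x_0 x_N by auto

lemma xL_less_xR: "xL < xR"
  using x_strict_mono[of 0 N] x_0 x_N N1 by auto

lemma element_disjoint:
  assumes "n < N" "m < N" "n \<noteq> m" "y \<in> {x n<..<x (Suc n)}"
  shows "y \<notin> {x m<..<x (Suc m)}"
proof (cases "n < m")
  case True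
  then show ?thesis using x_mono[of "Suc n" m] assms by auto
next
  case False
  then show ?thesis using x_mono[of "Suc m" n] assms by auto
qed

lemma element_cover:
  assumes "y \<in> {xL<..<xR}" "y \<notin> x ` {..N}"
  obtains n where "n < N" "y \<in> {x n<..<x (Suc n)}"
proof -
  define m where "m = (LEAST m. y < x m)"
  have y: "y < x N" using assms x_N by simp
  have m: "y < x m" unfolding m_def by (rule LeastI[of _ N]) (rule y)
  have mN: "m \<le> N" unfolding m_def by (rule Least_le) (rule y)
  have "m \<noteq> 0" using m x_0 assms(1) by (cases m) auto
  then obtain n where n: "m = Suc n" by (cases m) auto
  then have "n < N" using mN by simp
  have "\<not> y < x n" using not_less_Least[of n "\<lambda>m. y < x m"] n m_def by auto
  moreover have "y \<noteq> x n" using assms(2) \<open>n < N\<close> by auto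
  ultimately show ?thesis using \<open>n < N\<close> m n by (intro that[of n]) auto
qed

lemma sum_element_lengths: "(\<Sum>n<N. x (Suc n) - x n) = xR - xL"
  using sum_lessThan_telescope[of x N] x_0 x_N by simp

lemma mesh_size_ge: "n < N \<Longrightarrow> x (Suc n) - x n \<le> mesh_size N x"
proof -
  assume n: "n < N"
  have "\<bar>x (Suc n) - x (Suc n - 1)\<bar> \<le> mesh_size N x"
    unfolding mesh_size_def using n by (intro Max_ge imageI) auto
  then show ?thesis by simp
qed

lemma mesh_size_nonneg: "0 \<le> mesh_size N x"
  using mesh_size_ge[of 0] x_step[of 0] N1 by auto

text \<open>The elements are numbered from 0 here, which avoids subtraction of natural numbers.\<close>

lemma pw_poly_iff: "v \<in> pw_poly j N x \<longleftrightarrow>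
  (\<forall>n<N. \<exists>q. degree q \<le> j \<and> (\<forall>y\<in>{x n<..<x (Suc n)}. v y = poly q y))"
proof -
  have "(\<forall>n\<in>{1..N}. P (n - 1) n) \<longleftrightarrow> (\<forall>n<N. P n (Suc n))" for P :: "nat \<Rightarrow> nat \<Rightarrow> bool"
  proof safe
    fix n assume P: "\<forall>n\<in>{1..N}. P (n - 1) n" and "n < N"
    then show "P n (Suc n)" using P[rule_format, of "Suc n"] by simp
  next
    fix n assume P: "\<forall>n<N. P n (Suc n)" and "n \<in> {1..N}"
    then obtain m where "n = Suc m" "m < N" by (cases n) auto
    then show "P (n - 1) n" using P by simp
  qed
  then show ?thesis unfolding pw_poly_def by simp
qed

text \<open>Testing with functions that live on one element turns the variational equations into equations for moments.\<close>

definition test_fun :: "nat \<Rightarrow> real poly \<Rightarrow> real \<Rightarrow> real" where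
  "test_fun n q y = (if y \<in> {x n<..<x (Suc n)} then poly q y else 0)"

lemma test_fun_in:
  assumes "n < N" "degree q \<le> j"
  shows "test_fun n q \<in> pw_poly j N x"
  unfolding pw_poly_iff
proof (intro allI impI)
  fix m assume m: "m < N"
  show "\<exists>r. degree r \<le> j \<and> (\<forall>y\<in>{x m<..<x (Suc m)}. test_fun n q y = poly r y)"
  proof (cases "m = n")
    case True then show ?thesis using assms by (intro exI[of _ q]) (auto simp: test_fun_def)
  next
    case False
    then have "test_fun n q y = poly 0 y" if "y \<in> {x m<..<x (Suc m)}" for y
      using element_disjoint[OF m assms(1) False that] by (simp only: test_fun_def if_False poly_0)
    then show ?thesis by (intro exI[of _ 0]) auto
  qed
qed

lemma L2_inner_test_fun:
  assumes "n < N"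
  shows "L2_inner xL xR u (test_fun n q) = L2_inner (x n) (x (Suc n)) u (poly q)"
  unfolding L2_inner_def set_lebesgue_integral_def
proof (intro Bochner_Integration.integral_cong refl)
  fix y
  show "indicat_real {xL<..<xR} y *\<^sub>R (u y * test_fun n q y) = indicat_real {x n<..<x (Suc n)} y *\<^sub>R (u y * poly q y)"
    using open_element_subset[OF assms] by (auto simp: test_fun_def indicator_def)
qed

lemma element_indicators_AE:
  "AE y in lborel. indicat_real {xL<..<xR} y = (\<Sum>n<N. indicat_real {x n<..<x (Suc n)} y)"
proof -
  have "AE y in lborel. y \<notin> x ` {..N}"
    by (rule AE_not_in[OF finite_imp_null_set_lborel]) simp
  then show ?thesis
  proof (rule eventually_mono)
    fix y assume y: "y \<notin> x ` {..N}"
    show "indicat_real {xL<..<xR} y = (\<Sum>n<N. indicat_real {x n<..<x (Suc n)} y)"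
    proof (cases "y \<in> {xL<..<xR}")
      case True
      then obtain m where m: "m < N" "y \<in> {x m<..<x (Suc m)}" using element_cover y by blast
      have "indicat_real {x n<..<x (Suc n)} y = (if n = m then 1 else 0)" if "n < N" for n
        using element_disjoint[OF m(1) that _ m(2)] m(2) by (cases "n = m") auto
      then have "(\<Sum>n<N. indicat_real {x n<..<x (Suc n)} y) = (\<Sum>n<N. if n = m then 1 else 0)"
        by (intro sum.cong) auto
      then show ?thesis using True m(1) by simp
    next
      case False
      then have "indicat_real {x n<..<x (Suc n)} y = 0" if "n < N" for n
        using open_element_subset[OF that] by (auto simp: indicator_def)
      then show ?thesis using False by simp
    qed
  qed
qed

lemma set_integrable_element:
  fixes f :: "real \<Rightarrow> real"
  assumes "set_integrable lborel {xL<..<xR} f" "n < N"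
  shows "set_integrable lborel {x n<..<x (Suc n)} f"
  by (rule set_integrable_subset[OF assms(1) _ open_element_subset[OF assms(2)]]) simp

lemma L2_space_element:
  assumes "u \<in> L2_space {xL<..<xR}" "n < N"
  shows "u \<in> L2_space {x n<..<x (Suc n)}"
proof -
  have m: "(\<lambda>y. indicat_real {xL<..<xR} y *\<^sub>R u y) \<in> borel_measurable lborel"
    using assms(1) by (simp only: L2_space_def set_borel_measurable_def mem_Collect_eq)
  have "(\<lambda>y. indicat_real {x n<..<x (Suc n)} y *\<^sub>R (indicat_real {xL<..<xR} y *\<^sub>R u y)) \<in> borel_measurable lborel"
    by (rule borel_measurable_scaleR[OF borel_measurable_indicator m]) simp
  moreover have "(\<lambda>y. indicator {x n<..<x (Suc n)} y *\<^sub>R (indicator {xL<..<xR} y *\<^sub>R u y))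
      = (\<lambda>y. indicat_real {x n<..<x (Suc n)} y *\<^sub>R u y)"
    using open_element_subset[OF assms(2)] by (intro ext) (auto simp: indicator_def)
  ultimately show ?thesis
    using set_integrable_element[OF _ assms(2), of "\<lambda>y. (u y)\<^sup>2"] assms(1)
    by (auto simp: L2_space_def set_borel_measurable_def)
qed

lemma set_integral_split:
  fixes f :: "real \<Rightarrow> real"
  assumes f: "set_integrable lborel {xL<..<xR} f"
  shows "(LINT y:{xL<..<xR}|lborel. f y) = (\<Sum>n<N. LINT y:{x n<..<x (Suc n)}|lborel. f y)"
proof -
  have i: "integrable lborel (\<lambda>y. indicator {x n<..<x (Suc n)} y *\<^sub>R f y)" if "n < N" for n
    using set_integrable_element[OF f that] by (simp add: set_integrable_def)
  have "(LINT y:{xL<..<xR}|lborel. f y) = (LINT y|lborel. (\<Sum>n<N. indicator {x n<..<x (Suc n)} y *\<^sub>R f y))"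
    unfolding set_lebesgue_integral_def
  proof (rule integral_cong_AE)
    show "(\<lambda>y. indicator {xL<..<xR} y *\<^sub>R f y) \<in> borel_measurable lborel"
      using f unfolding set_integrable_def by (rule borel_measurable_integrable)
    show "(\<lambda>y. \<Sum>n<N. indicator {x n<..<x (Suc n)} y *\<^sub>R f y) \<in> borel_measurable lborel"
      by (rule borel_measurable_sum) (use i borel_measurable_integrable in auto)
    show "AE y in lborel. indicator {xL<..<xR} y *\<^sub>R f y = (\<Sum>n<N. indicator {x n<..<x (Suc n)} y *\<^sub>R f y)"
      using element_indicators_AE by (rule eventually_mono) (simp add: sum_distrib_right)
  qed
  also have "\<dots> = (\<Sum>n<N. LINT y|lborel. indicator {x n<..<x (Suc n)} y *\<^sub>R f y)"
    using i by (intro Bochner_Integration.integral_sum) auto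
  finally show ?thesis by (simp add: set_lebesgue_integral_def)
qed

lemma L2_inner_split:
  assumes "u \<in> L2_space {xL<..<xR}" "v \<in> L2_space {xL<..<xR}"
  shows "L2_inner xL xR u v = (\<Sum>n<N. L2_inner (x n) (x (Suc n)) u v)"
  unfolding L2_inner_def by (rule set_integral_split[OF L2_space_mult_integrable[OF assms]])

lemma test_fun_L2: "test_fun n q \<in> L2_space {xL<..<xR}"
proof -
  have "(\<lambda>y. indicat_real {x n<..<x (Suc n)} y) \<in> Linf_space {xL<..<xR}"
    unfolding Linf_space_def set_borel_measurable_def
    by (auto intro!: exI[of _ 1] AE_I2 borel_measurable_times simp: indicator_def)
  from Linf_mult_L2_space[OF this poly_L2_space[of q]]
  show ?thesis by (rule back_subst[of "\<lambda>u. u \<in> L2_space {xL<..<xR}"]) (auto simp: test_fun_def indicator_def fun_eq_iff)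
qed

text \<open>The values of piecewise polynomials at the nodes are arbitrary; this makes them harmless.\<close>

lemma L2_space_modify:
  assumes "v' \<in> L2_space S" "finite X" "\<And>y. y \<in> S \<Longrightarrow> y \<notin> X \<Longrightarrow> v y = v' (y :: real)"
  shows "v \<in> L2_space S"
proof -
  have m: "(\<lambda>y. indicat_real S y *\<^sub>R v' y) \<in> borel_measurable lborel"
    and i: "integrable lborel (\<lambda>y. indicat_real S y *\<^sub>R (v' y)\<^sup>2)"
    using assms(1) by (auto simp only: L2_space_def set_borel_measurable_def set_integrable_def)
  have cX: "countable X" using assms(2) by (rule countable_finite)
  have "(\<lambda>y. indicat_real S y *\<^sub>R v y) \<in> borel_measurable lborel"
    by (rule measurable_discrete_difference[OF m cX]) (use assms(3) in \<open>auto simp: indicator_def\<close>)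
  moreover have m2: "(\<lambda>y. indicat_real S y *\<^sub>R (v y)\<^sup>2) \<in> borel_measurable lborel"
    by (rule measurable_discrete_difference[OF borel_measurable_integrable[OF i] cX])
       (use assms(3) in \<open>auto simp: indicator_def\<close>)
  moreover have "AE y in lborel. y \<notin> X"
    by (rule AE_not_in[OF finite_imp_null_set_lborel[OF assms(2)]])
  then have "AE y in lborel. indicat_real S y *\<^sub>R (v' y)\<^sup>2 = indicat_real S y *\<^sub>R (v y)\<^sup>2"
    by (rule eventually_mono) (use assms(3) in \<open>auto simp: indicator_def\<close>)
  then have "integrable lborel (\<lambda>y. indicat_real S y *\<^sub>R (v y)\<^sup>2)"
    by (rule integrable_cong_AE_imp[OF i m2, rotated]) 
  ultimately show ?thesis by (simp add: L2_space_def set_borel_measurable_def set_integrable_def)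
qed

lemma sum_test_fun:
  assumes "n < N" "y \<in> {x n<..<x (Suc n)}"
  shows "(\<Sum>m<N. test_fun m (q m) y) = poly (q n) y"
proof -
  have "test_fun m (q m) y = (if m = n then poly (q n) y else 0)" if "m < N" for m
  proof (cases "m = n")
    case True then show ?thesis using assms(2) by (simp add: test_fun_def)
  next
    case False
    then show ?thesis using element_disjoint[OF assms(1) that _ assms(2)] by (simp only: test_fun_def if_False)
  qed
  then have "(\<Sum>m<N. test_fun m (q m) y) = (\<Sum>m<N. if m = n then poly (q n) y else 0)"
    by (intro sum.cong) auto
  then show ?thesis using assms(1) by simp
qed

lemma pw_poly_L2:
  assumes v: "\<And>n y. n < N \<Longrightarrow> y \<in> {x n<..<x (Suc n)} \<Longrightarrow> v y = poly (q n) y"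
  shows "v \<in> L2_space {xL<..<xR}"
proof (rule L2_space_modify)
  show "(\<lambda>y. \<Sum>n<N. test_fun n (q n) y) \<in> L2_space {xL<..<xR}" by (intro L2_space_sum test_fun_L2)
  fix y assume "y \<in> {xL<..<xR}" "y \<notin> x ` {..N}"
  then obtain n where n: "n < N" "y \<in> {x n<..<x (Suc n)}" by (rule element_cover)
  show "v y = (\<Sum>m<N. test_fun m (q m) y)" unfolding sum_test_fun[OF n] by (rule v[OF n])
qed simp

lemma L2_inner_pw_poly:
  assumes "u \<in> L2_space {xL<..<xR}"
    and v: "\<And>n y. n < N \<Longrightarrow> y \<in> {x n<..<x (Suc n)} \<Longrightarrow> v y = poly (q n) y"
  shows "L2_inner xL xR u v = (\<Sum>n<N. L2_inner (x n) (x (Suc n)) u (poly (q n)))"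
proof -
  have "v \<in> L2_space {xL<..<xR}" by (rule pw_poly_L2[OF v])
  then have "L2_inner xL xR u v = (\<Sum>n<N. L2_inner (x n) (x (Suc n)) u v)"
    by (rule L2_inner_split[OF assms(1)])
  also have "\<dots> = (\<Sum>n<N. L2_inner (x n) (x (Suc n)) u (poly (q n)))"
    by (intro sum.cong refl L2_inner_cong) (auto simp: v)
  finally show ?thesis .
qed

definition piece :: "(real \<Rightarrow> real) \<Rightarrow> nat \<Rightarrow> real poly" where
  "piece v n = (SOME q. degree q \<le> k \<and> (\<forall>y\<in>{x n<..<x (Suc n)}. v y = poly q y))"

lemma piece_open:
  assumes "v \<in> pw_poly k N x" "n < N"
  shows "degree (piece v n) \<le> k" "\<And>y. y \<in> {x n<..<x (Suc n)} \<Longrightarrow> v y = poly (piece v n) y"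
proof -
  have "\<exists>q. degree q \<le> k \<and> (\<forall>y\<in>{x n<..<x (Suc n)}. v y = poly q y)"
    using assms unfolding pw_poly_iff by blast
  from someI_ex[OF this]
  show "degree (piece v n) \<le> k" "\<And>y. y \<in> {x n<..<x (Suc n)} \<Longrightarrow> v y = poly (piece v n) y"
    unfolding piece_def by blast+
qed

lemma piece_eq:
  assumes v: "v \<in> pw_poly k N x" "continuous_on {xL..xR} v" and n: "n < N" and y: "y \<in> {x n..x (Suc n)}"
  shows "v y = poly (piece v n) y"
proof -
  have c: "continuous_on (closure {x n<..<x (Suc n)}) (\<lambda>y. v y - poly (piece v n) y)"
    using x_step[OF n] continuous_on_subset[OF v(2) element_subset[OF n]]
    by (simp add: closure_greaterThanLessThan continuous_on_diff continuous_on_poly_fun)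
  have "v y - poly (piece v n) y = 0"
    by (rule continuous_constant_on_closure[OF c])
       (use y x_step[OF n] piece_open(2)[OF v(1) n] in \<open>auto simp: closure_greaterThanLessThan\<close>)
  then show ?thesis by simp
qed

lemma weak_dx_AE:
  assumes v: "continuous_on {xL..xR} v" and D: "\<And>y. y \<in> {xL<..<xR} \<Longrightarrow> y \<notin> x ` {..N} \<Longrightarrow> (v has_real_derivative D y) (at y)"
    and DL: "D \<in> L2_space {xL<..<xR}"
  shows "weak_dx xL xR v \<in> L2_space {xL<..<xR}" "weak_deriv xL xR v D"
    and "u \<in> L2_space {xL<..<xR} \<Longrightarrow> L2_inner xL xR (weak_dx xL xR v) u = L2_inner xL xR D u"
proof -
  show wd: "weak_deriv xL xR v D"
    by (rule weak_derivI_classical[where S="x ` {..N}"]) (use v D DL xL_less_xR in auto)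
  note ae = weak_dx_AE_eq[OF xL_less_xR DL wd]
  show "weak_dx xL xR v \<in> L2_space {xL<..<xR}" by (rule ae(1))
  then show "L2_inner xL xR (weak_dx xL xR v) u = L2_inner xL xR D u" if "u \<in> L2_space {xL<..<xR}"
    using that ae(3) DL by (intro L2_inner_cong_AE) (auto simp: L2_space_def)
qed

lemma weak_dx_pw_poly:
  assumes v: "v \<in> pw_poly k N x" "continuous_on {xL..xR} v" and n: "n < N"
  shows "L2_inner xL xR (weak_dx xL xR v) (test_fun n q) = L2_inner (x n) (x (Suc n)) (poly (pderiv (piece v n))) (poly q)"
    and "v \<in> H1 xL xR"
    and "weak_dx xL xR v \<in> L2_space {xL<..<xR}"
proof -
  define D where "D y = (\<Sum>n<N. test_fun n (pderiv (piece v n)) y)" for y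
  have Dn: "D y = poly (pderiv (piece v n)) y" if "n < N" "y \<in> {x n<..<x (Suc n)}" for n y
    unfolding D_def by (rule sum_test_fun[OF that])
  have DL: "D \<in> L2_space {xL<..<xR}" by (rule pw_poly_L2[OF Dn])
  have d: "(v has_real_derivative D y) (at y)" if y: "y \<in> {xL<..<xR}" "y \<notin> x ` {..N}" for y
  proof -
    obtain n where n: "n < N" "y \<in> {x n<..<x (Suc n)}" using element_cover[OF y] by blast
    have "(poly (piece v n) has_real_derivative D y) (at y)"
      using poly_DERIV[of "piece v n" y] Dn[OF n] by simp
    then show ?thesis
      by (rule has_field_derivative_transform_within_open[OF _ open_greaterThanLessThan n(2)])
         (use piece_open(2)[OF v(1) n(1)] in simp)
  qed
  have w: "weak_dx xL xR v \<in> L2_space {xL<..<xR}" "weak_deriv xL xR v D"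
    "\<And>u. u \<in> L2_space {xL<..<xR} \<Longrightarrow> L2_inner xL xR (weak_dx xL xR v) u = L2_inner xL xR D u"
    by (rule weak_dx_AE[OF v(2) d DL]; assumption)+
  show "v \<in> H1 xL xR" using v(2) w(2) DL by (auto simp: H1_def)
  show "weak_dx xL xR v \<in> L2_space {xL<..<xR}" by (rule w(1))
  have "L2_inner xL xR (weak_dx xL xR v) (test_fun n q) = L2_inner (x n) (x (Suc n)) D (poly q)"
    unfolding w(3)[OF test_fun_L2] by (rule L2_inner_test_fun[OF n])
  also have "\<dots> = L2_inner (x n) (x (Suc n)) (poly (pderiv (piece v n))) (poly q)"
    by (rule L2_inner_cong) (simp_all add: Dn[OF n])
  finally show "L2_inner xL xR (weak_dx xL xR v) (test_fun n q) = L2_inner (x n) (x (Suc n)) (poly (pderiv (piece v n))) (poly q)" .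
qed

definition basis :: "nat \<Rightarrow> nat \<Rightarrow> real poly" where
  "basis n = (SOME \<l>. orthonormal_polys (x n) (x (Suc n)) k \<l>)"

lemma element: "n < N \<Longrightarrow> element (x n) (x (Suc n)) k (basis n)"
  unfolding element_def basis_def
  using someI_ex[OF orthonormal_polys_exist[OF x_step]] k1 x_step by blast

abbreviation "cf n \<equiv> element.coef (x n) (x (Suc n)) (basis n)"
abbreviation "pr n \<equiv> element.proj (x n) (x (Suc n)) k (basis n)"
abbreviation "ipol n \<equiv> element.interpolant (x n) (x (Suc n)) k (basis n)"
abbreviation "wmat n \<equiv> element.weight_matrix (x n) (x (Suc n)) (basis n)"

lemma L2_inner_test_basis: "n < N \<Longrightarrow> L2_inner xL xR u (test_fun n (basis n i)) = cf n u i"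
  by (simp add: L2_inner_test_fun element.coef_def[OF element])

lemma test_basis_in:
  assumes "n < N" "i < k"
  shows "test_fun n (basis n i) \<in> pw_poly (k - 1) N x"
  using element.degree_basis[OF element[OF assms(1)] assms(2)] by (intro test_fun_in assms(1)) simp

text \<open>The projection is defined by choice. The elementwise projections together show that a choice exists,
  and testing on one element shows that every choice has the same moments there.\<close>

lemma L2_proj_eq:
  assumes v: "v \<in> L2_space {xL<..<xR}" and n: "n < N" and y: "y \<in> {x n<..<x (Suc n)}"
  shows "L2_proj (k - 1) N x v y = poly (pr n v) y"
proof -
  define w where "w y = (\<Sum>n<N. test_fun n (pr n v) y)" for y
  have wn: "w y = poly (pr n v) y" if "n < N" "y \<in> {x n<..<x (Suc n)}" for n y
    unfolding w_def by (rule sum_test_fun[OF that])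
  have "w \<in> pw_poly (k - 1) N x"
    unfolding pw_poly_iff
  proof (intro allI impI)
    fix n assume n: "n < N"
    show "\<exists>q. degree q \<le> k - 1 \<and> (\<forall>y\<in>{x n<..<x (Suc n)}. w y = poly q y)"
      using element.degree_proj[OF element[OF n], of v] wn[OF n] by (intro exI[of _ "pr n v"]) auto
  qed
  moreover have "L2_inner xL xR w q = L2_inner xL xR v q" if "q \<in> pw_poly (k - 1) N x" for q
  proof -
    have "\<forall>n. \<exists>r. n < N \<longrightarrow> degree r \<le> k - 1 \<and> (\<forall>y\<in>{x n<..<x (Suc n)}. q y = poly r y)"
      using that unfolding pw_poly_iff by blast
    then obtain r where r: "\<And>n. n < N \<Longrightarrow> degree (r n) \<le> k - 1"
      "\<And>n y. n < N \<Longrightarrow> y \<in> {x n<..<x (Suc n)} \<Longrightarrow> q y = poly (r n) y" by metis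
    have "L2_inner (x n) (x (Suc n)) w (poly (r n)) = L2_inner (x n) (x (Suc n)) v (poly (r n))" if n: "n < N" for n
    proof -
      interpret e: element "x n" "x (Suc n)" k "basis n" by (rule element[OF n])
      have dr: "degree (r n) < k" using r(1)[OF n] k1 by simp
      have "L2_inner (x n) (x (Suc n)) w (poly (r n)) = L2_inner (x n) (x (Suc n)) (poly (pr n v)) (poly (r n))"
        by (rule L2_inner_cong) (simp_all add: wn[OF n])
      also have "\<dots> = L2_inner (x n) (x (Suc n)) v (poly (r n))"
        unfolding e.inner_low_degree[OF poly_L2_space dr] e.inner_low_degree[OF L2_space_element[OF v n] dr]
        by (intro sum.cong) (simp_all add: e.coef_proj)
      finally show ?thesis .
    qed
    then show ?thesis
      using L2_inner_pw_poly[OF pw_poly_L2[OF wn] r(2)] L2_inner_pw_poly[OF v r(2)] by simp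
  qed
  ultimately have ex: "\<exists>w. w \<in> pw_poly (k - 1) N x \<and>
     (\<forall>q\<in>pw_poly (k - 1) N x. L2_inner (x 0) (x N) w q = L2_inner (x 0) (x N) v q)"
    unfolding x_0 x_N by blast
  define W where "W = L2_proj (k - 1) N x v"
  have W: "W \<in> pw_poly (k - 1) N x" "\<And>q. q \<in> pw_poly (k - 1) N x \<Longrightarrow> L2_inner xL xR W q = L2_inner xL xR v q"
    using someI_ex[OF ex] unfolding W_def L2_proj_def x_0 x_N by blast+
  obtain e where e: "degree e \<le> k - 1" "\<And>y. y \<in> {x n<..<x (Suc n)} \<Longrightarrow> W y = poly e y"
    using W(1) n unfolding pw_poly_iff by blast
  interpret E: element "x n" "x (Suc n)" k "basis n" by (rule element[OF n])
  have "cf n (poly e) i = cf n v i" if i: "i < k" for i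
  proof -
    have "cf n (poly e) i = cf n W i" by (rule E.coef_cong) (simp add: e(2))
    also have "\<dots> = cf n v i"
      using W(2)[OF test_basis_in[OF n i]] by (simp add: L2_inner_test_basis[OF n])
    finally show ?thesis .
  qed
  then have "pr n (poly e) = pr n v" unfolding E.proj_def by (intro sum.cong) auto
  moreover have "pr n (poly e) = e" using e(1) k1 by (intro E.proj_poly) simp
  ultimately show ?thesis using e(2)[OF y] by (simp add: W_def)
qed

text \<open>As for the projection, existence has to come first. The elementwise interpolants agree with \<open>v\<close> at the nodes,
  so that they fit together continuously; conversely the defining conditions fix the left value and the
  moments of the derivative on each element.\<close>

lemma interp_eq:
  assumes v: "\<And>y. y \<in> {xL..xR} \<Longrightarrow> (v has_real_derivative w y) (at y within {xL..xR})"
    and w: "continuous_on {xL..xR} w"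
    and n: "n < N" and y: "y \<in> {x n..x (Suc n)}"
  shows "interp k N x v y = poly (ipol n (v (x n)) w) y"
proof -
  have cv: "continuous_on {xL..xR} v" by (rule DERIV_continuous_on[OF v])
  have wL: "w \<in> L2_space {xL<..<xR}" by (rule L2_spaceI_continuous[OF w])
  let ?I = "\<lambda>n. poly (ipol n (v (x n)) w)"
  have left: "?I n (x n) = v (x n)" if "n < N" for n
    by (rule element.poly_interpolant_left[OF element[OF that]])
  have right: "?I n (x (Suc n)) = v (x (Suc n))" if "n < N" for n
  proof (rule element.poly_interpolant_right[OF element[OF that]])
    show "(v has_real_derivative w y) (at y within {x n..x (Suc n)})" if "y \<in> {x n..x (Suc n)}" for y
      using has_field_derivative_subset[OF v element_subset[OF \<open>n < N\<close>]] that element_subset[OF \<open>n < N\<close>] by blast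
  qed (rule continuous_on_subset[OF w element_subset[OF that]])
  \<comment> \<open>Clamping the argument to each element makes the glued function continuous by construction.\<close>
  define J where "J y = v xL + (\<Sum>n<N. ?I n (max (x n) (min (x (Suc n)) y)) - v (x n))" for y
  have cJ: "continuous_on S J" for S
  proof -
    have c: "continuous_on S (\<lambda>y. ?I n (max (x n) (min (x (Suc n)) y)))" for n
      by (rule continuous_on_compose2[OF continuous_on_poly_fun[of UNIV]])
         (auto intro!: continuous_on_max continuous_on_min continuous_on_const continuous_on_id)
    show ?thesis
      unfolding J_def[abs_def] by (intro continuous_on_add continuous_on_sum continuous_on_diff continuous_on_const c)
  qed
  have Jn: "J y = ?I m y" if m: "m < N" and y: "y \<in> {x m..x (Suc m)}" for m y
  proof -
    have t: "?I n (max (x n) (min (x (Suc n)) y)) - v (x n) =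
      (if n < m then v (x (Suc n)) - v (x n) else 0) + (if n = m then ?I m y - v (x m) else 0)" if n: "n < N" for n
    proof -
      consider "n < m" | "n = m" | "m < n" by linarith
      then show ?thesis
      proof cases
        case 1
        then have "x (Suc n) \<le> x m" "x n \<le> x (Suc n)" using x_mono[of "Suc n" m] x_mono[of n "Suc n"] m by auto
        then have "max (x n) (min (x (Suc n)) y) = x (Suc n)" using y by auto
        then show ?thesis using 1 right[OF n] by simp
      next
        case 2
        then have "max (x n) (min (x (Suc n)) y) = y" using y by auto
        then show ?thesis using 2 by simp
      next
        case 3
        then have "x (Suc m) \<le> x n" "x n \<le> x (Suc n)" using x_mono[of "Suc m" n] x_mono[of n "Suc n"] n by auto
        then have "max (x n) (min (x (Suc n)) y) = x n" using y by auto
        then show ?thesis using 3 left[OF n] by simp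
      qed
    qed
    have "J y = v xL + (\<Sum>n<N. (if n < m then v (x (Suc n)) - v (x n) else 0) + (if n = m then ?I m y - v (x m) else 0))"
      unfolding J_def using t by (intro arg_cong2[where f="(+)"] refl sum.cong) auto
    also have "\<dots> = v xL + ((\<Sum>n<N. if n < m then v (x (Suc n)) - v (x n) else 0) + (?I m y - v (x m)))"
      using m by (simp add: sum.distrib)
    also have "(\<Sum>n<N. if n < m then v (x (Suc n)) - v (x n) else 0) = (\<Sum>n<m. v (x (Suc n)) - v (x n))"
      using m by (intro sum.mono_neutral_cong_right) auto
    also have "\<dots> = v (x m) - v xL" using sum_lessThan_telescope[of "\<lambda>n. v (x n)" m] x_0 by simp
    finally show ?thesis by simp
  qed
  have Jnode: "J (x n) = v (x n)" if "n \<le> N" for n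
  proof (cases "n < N")
    case True
    then show ?thesis using Jn[OF True, of "x n"] left[OF True] x_mono[of n "Suc n"] by simp
  next
    case False
    then obtain m where m: "n = Suc m" "m < N" using \<open>n \<le> N\<close> N1 by (cases n) auto
    then show ?thesis using Jn[OF m(2), of "x n"] right[OF m(2)] x_mono[of m "Suc m"] by simp
  qed
  have Jpw: "J \<in> pw_poly k N x"
    unfolding pw_poly_iff
  proof (intro allI impI)
    fix n assume n: "n < N"
    show "\<exists>q. degree q \<le> k \<and> (\<forall>y\<in>{x n<..<x (Suc n)}. J y = poly q y)"
      using element.degree_interpolant[OF element[OF n]] Jn[OF n] by (intro exI[of _ "ipol n (v (x n)) w"]) auto
  qed
  have vd: "L2_inner xL xR (weak_dx xL xR v) u = L2_inner xL xR w u" if "u \<in> L2_space {xL<..<xR}" for u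
  proof (rule weak_dx_AE(3)[OF cv _ wL that])
    show "(v has_real_derivative w y) (at y)" if "y \<in> {xL<..<xR}" for y
      using v[of y] that at_within_interior[of y "{xL..xR}"] by (simp add: interior_atLeastAtMost_real)
  qed
  have piece_unique: "p = q" if n: "n < N" and pq: "\<And>y. y \<in> {x n<..<x (Suc n)} \<Longrightarrow> poly p y = poly q y" for n and p q :: "real poly"
  proof (rule ccontr)
    assume "p \<noteq> q"
    then have "finite {y. poly (p - q) y = 0}" by (intro poly_roots_finite) simp
    moreover have "{x n<..<x (Suc n)} \<subseteq> {y. poly (p - q) y = 0}" using pq by auto
    ultimately have "finite {x n<..<x (Suc n)}" using finite_subset by blast
    then show False using infinite_Ioo[OF x_step[OF n]] by blast
  qed
  have Jd: "L2_inner xL xR (weak_dx xL xR J) q = L2_inner xL xR (weak_dx xL xR v) q" if q: "q \<in> pw_poly (k - 1) N x" for q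
  proof -
    have "\<forall>n. \<exists>r. n < N \<longrightarrow> degree r \<le> k - 1 \<and> (\<forall>y\<in>{x n<..<x (Suc n)}. q y = poly r y)"
      using q unfolding pw_poly_iff by blast
    then obtain r where r: "\<And>n. n < N \<Longrightarrow> degree (r n) \<le> k - 1"
      "\<And>n y. n < N \<Longrightarrow> y \<in> {x n<..<x (Suc n)} \<Longrightarrow> q y = poly (r n) y" by metis
    have dJ: "weak_dx xL xR J \<in> L2_space {xL<..<xR}"
      using weak_dx_pw_poly(3)[OF Jpw cJ, of 0] N1 by simp
    have "L2_inner (x n) (x (Suc n)) (weak_dx xL xR J) (poly (r n)) = L2_inner (x n) (x (Suc n)) w (poly (r n))" if n: "n < N" for n
    proof -
      interpret e: element "x n" "x (Suc n)" k "basis n" by (rule element[OF n])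
      have dr: "degree (r n) < k" using r(1)[OF n] k1 by simp
      have "piece J n = ipol n (v (x n)) w"
        by (rule piece_unique[OF n]) (use piece_open(2)[OF Jpw n] Jn[OF n] in auto)
      then have "pderiv (piece J n) = pr n w" by (simp add: e.pderiv_interpolant)
      then have "L2_inner (x n) (x (Suc n)) (weak_dx xL xR J) (poly (r n)) = L2_inner (x n) (x (Suc n)) (poly (pr n w)) (poly (r n))"
        using weak_dx_pw_poly(1)[OF Jpw cJ n, of "r n"] L2_inner_test_fun[OF n] by simp
      also have "\<dots> = L2_inner (x n) (x (Suc n)) w (poly (r n))"
        unfolding e.inner_low_degree[OF poly_L2_space dr] e.inner_low_degree[OF L2_space_element[OF wL n] dr]
        by (intro sum.cong) (simp_all add: e.coef_proj)
      finally show ?thesis .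
    qed
    then have "L2_inner xL xR (weak_dx xL xR J) q = L2_inner xL xR w q"
      using L2_inner_pw_poly[OF dJ r(2)] L2_inner_pw_poly[OF wL r(2)] by simp
    then show ?thesis using vd[OF pw_poly_L2[OF r(2)]] by simp
  qed
  have JH: "J \<in> H1 xL xR" using weak_dx_pw_poly(2)[OF Jpw cJ, of 0] N1 by simp
  have ex: "\<exists>J. J \<in> pw_poly k N x \<inter> H1 (x 0) (x N) \<and> (\<forall>n\<in>{0..N}. J (x n) = v (x n)) \<and>
     (\<forall>q\<in>pw_poly (k - 1) N x. L2_inner (x 0) (x N) (weak_dx (x 0) (x N) J) q = L2_inner (x 0) (x N) (weak_dx (x 0) (x N) v) q)"
    unfolding x_0 x_N using Jpw JH Jnode Jd by (intro exI[of _ J]) auto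
  define W where "W = interp k N x v"
  have W: "W \<in> pw_poly k N x" "W \<in> H1 xL xR" "\<And>n. n \<le> N \<Longrightarrow> W (x n) = v (x n)"
    "\<And>q. q \<in> pw_poly (k - 1) N x \<Longrightarrow> L2_inner xL xR (weak_dx xL xR W) q = L2_inner xL xR (weak_dx xL xR v) q"
    using someI_ex[OF ex] unfolding W_def interp_def x_0 x_N by auto
  have cW: "continuous_on {xL..xR} W" using W(2) by (simp add: H1_def)
  interpret E: element "x n" "x (Suc n)" k "basis n" by (rule element[OF n])
  have "piece W n = ipol n (v (x n)) w"
  proof (rule E.interpolant_unique)
    show "poly (piece W n) (x n) = v (x n)"
      using piece_eq[OF W(1) cW n, of "x n"] W(3)[of n] n x_step[OF n] by simp
    show "degree (piece W n) \<le> k" by (rule piece_open(1)[OF W(1) n])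
    show "cf n (poly (pderiv (piece W n))) i = cf n w i" if i: "i < k" for i
      using W(4)[OF test_basis_in[OF n i]] vd[OF test_fun_L2, of n "basis n i"]
        weak_dx_pw_poly(1)[OF W(1) cW n, of "basis n i"] L2_inner_test_basis[OF n, of w i]
      by (simp add: E.coef_def)
  qed
  then show ?thesis using piece_eq[OF W(1) cW n y] by (simp add: W_def)
qed

text \<open>Testing the discrete derivatives against the errors themselves amounts to integrating a product
  rule over each element; the boundary terms telescope and vanish at the ends of the interval.\<close>

lemma skew_symmetry:
  assumes dg: "\<And>n. n < N \<Longrightarrow> degree (e n) \<le> k" "\<And>n. n < N \<Longrightarrow> degree (f n) \<le> k"
    and e: "\<And>n. n < N \<Longrightarrow> poly (e n) (x n) = E n" "\<And>n. n < N \<Longrightarrow> poly (e n) (x (Suc n)) = E (Suc n)"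
    and f: "\<And>n. n < N \<Longrightarrow> poly (f n) (x n) = F n" "\<And>n. n < N \<Longrightarrow> poly (f n) (x (Suc n)) = F (Suc n)"
    and zero: "E 0 = 0" "E N = 0"
  shows "(\<Sum>n<N. \<Sum>i<k. cf n (poly (e n)) i * cf n (poly (pderiv (f n))) i
      + cf n (poly (f n)) i * cf n (poly (pderiv (e n))) i) = 0"
proof -
  have "(\<Sum>i<k. cf n (poly (e n)) i * cf n (poly (pderiv (f n))) i
      + cf n (poly (f n)) i * cf n (poly (pderiv (e n))) i) = E (Suc n) * F (Suc n) - E n * F n" if n: "n < N" for n
  proof -
    interpret el: element "x n" "x (Suc n)" k "basis n" by (rule element[OF n])
    have d: "degree (pderiv (e n)) < k" "degree (pderiv (f n)) < k"
      using dg[OF n] k1 by (auto simp: degree_pderiv)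
    have "(\<Sum>i<k. cf n (poly (e n)) i * cf n (poly (pderiv (f n))) i
      + cf n (poly (f n)) i * cf n (poly (pderiv (e n))) i)
      = L2_inner (x n) (x (Suc n)) (poly (e n)) (poly (pderiv (f n))) + L2_inner (x n) (x (Suc n)) (poly (f n)) (poly (pderiv (e n)))"
      by (simp add: sum.distrib el.inner_low_degree[OF poly_L2_space d(1)] el.inner_low_degree[OF poly_L2_space d(2)])
    also have "\<dots> = integral {x n..x (Suc n)} (\<lambda>y. poly (e n) y * poly (pderiv (f n)) y)
        + integral {x n..x (Suc n)} (\<lambda>y. poly (f n) y * poly (pderiv (e n)) y)"
      by (simp add: L2_inner_eq_integral continuous_on_poly_fun)
    also have "\<dots> = integral {x n..x (Suc n)} (\<lambda>y. poly (e n) y * poly (pderiv (f n)) y + poly (f n) y * poly (pderiv (e n)) y)"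
      by (rule Henstock_Kurzweil_Integration.integral_add[symmetric])
         (intro integrable_continuous_real continuous_on_mult continuous_on_poly_fun)+
    also have "\<dots> = integral {x n..x (Suc n)} (poly (pderiv (e n * f n)))"
      by (intro integral_cong) (simp add: pderiv_mult)
    also have "\<dots> = poly (e n * f n) (x (Suc n)) - poly (e n * f n) (x n)"
    proof (rule integral_unique, rule fundamental_theorem_of_calculus)
      show "(poly (e n * f n) has_vector_derivative poly (pderiv (e n * f n)) y) (at y within {x n..x (Suc n)})" for y
        by (simp only: has_field_derivative_at_within[OF poly_DERIV] flip: has_real_derivative_iff_has_vector_derivative)
    qed (use x_step[OF n] in simp)
    finally show ?thesis using e[OF n] f[OF n] by simp
  qed
  then have "(\<Sum>n<N. \<Sum>i<k. cf n (poly (e n)) i * cf n (poly (pderiv (f n))) i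
      + cf n (poly (f n)) i * cf n (poly (pderiv (e n))) i) = (\<Sum>n<N. E (Suc n) * F (Suc n) - E n * F n)"
    by (intro sum.cong) auto
  also have "\<dots> = E N * F N - E 0 * F 0" by (rule sum_lessThan_telescope)
  finally show ?thesis using zero by simp
qed

end

section \<open>Residuals of the interpolant\<close>

context element
begin

text \<open>The moments of the interpolation error.\<close>

definition interp_residual :: "(nat \<Rightarrow> real \<Rightarrow> real) \<Rightarrow> nat \<Rightarrow> real" where
  "interp_residual U i = coef (U 0) i - coef (poly (interpolant (U 0 c) (U 1))) i"

text \<open>The moments of \<open>\<delta> (v - \<pi> I v)\<close> with \<open>v = U 0\<close>, \<open>\<pi>\<close> the projection and \<open>I v\<close> the interpolant, split into
  \<open>\<delta> (v - \<pi> v)\<close> and \<open>\<delta> \<pi> (v - I v)\<close>.\<close>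

definition weight_residual :: "(real \<Rightarrow> real) \<Rightarrow> (nat \<Rightarrow> real \<Rightarrow> real) \<Rightarrow> nat \<Rightarrow> real" where
  "weight_residual \<delta> U i = coef (\<lambda>y. \<delta> y * (U 0 y - poly (proj (U 0)) y)) i
     + (\<Sum>j<k. weight_matrix \<delta> i j * interp_residual U j)"

text \<open>A function \<open>U 0\<close> with its derivatives. Two orders are bounded: order \<open>k\<close> enters the projection error of
  \<open>U 0\<close>, order \<open>k + 1\<close> its interpolation error.\<close>

definition derivative_family :: "real \<Rightarrow> (nat \<Rightarrow> real \<Rightarrow> real) \<Rightarrow> bool" where
  "derivative_family \<kappa> U \<longleftrightarrow>
     (\<forall>j y. j < Suc k \<longrightarrow> y \<in> {c..d} \<longrightarrow> (U j has_real_derivative U (Suc j) y) (at y within {c..d})) \<and>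
     (\<forall>y\<in>{c..d}. \<bar>U k y\<bar> \<le> \<kappa> \<and> \<bar>U (Suc k) y\<bar> \<le> \<kappa>)"

lemma derivative_family_continuous:
  assumes "derivative_family \<kappa> U" "j \<le> 1"
  shows "continuous_on {c..d} (U j)"
proof (rule DERIV_continuous_on)
  show "(U j has_real_derivative U (Suc j) y) (at y within {c..d})" if "y \<in> {c..d}" for y
    using assms k1 that unfolding derivative_family_def by simp
qed

lemma derivative_family_nonneg: "derivative_family \<kappa> U \<Longrightarrow> 0 \<le> \<kappa>"
  using cd unfolding derivative_family_def by (auto dest!: bspec[of _ _ c])

lemma coef_interpolant:
  "coef (poly (interpolant a w)) i = a * coef (poly 1) i + (\<Sum>j<k. coef w j * coef (poly (shape j)) i)"
proof -
  have "poly (interpolant a w) = (\<lambda>y. a * poly 1 y + poly (\<Sum>j<k. smult (coef w j) (shape j)) y)"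
    by (rule ext) (simp add: interpolant_def)
  then have "coef (poly (interpolant a w)) i = coef (\<lambda>y. a * poly 1 y) i + coef (poly (\<Sum>j<k. smult (coef w j) (shape j))) i"
    using coef_add[OF L2_space_scale[OF poly_L2_space[of 1]] poly_L2_space] by simp
  then show ?thesis unfolding coef_scale coef_sum_poly .
qed

lemma interpolant_pointwise_error:
  assumes "derivative_family \<kappa> U" "y \<in> {c..d}" "d - c \<le> h"
  shows "\<bar>U 0 y - poly (interpolant (U 0 c) (U 1)) y\<bar> \<le> \<kappa> * h ^ (k + 1)"
proof -
  have "\<bar>U 0 y - poly (interpolant (U 0 c) (U 1)) y\<bar> \<le> \<kappa> * (d - c) ^ (k + 1)"
    using assms(1,2) unfolding derivative_family_def by (intro interpolant_error) auto
  also have "\<dots> \<le> \<kappa> * h ^ (k + 1)"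
    using cd assms(3) derivative_family_nonneg[OF assms(1)] by (intro mult_left_mono power_mono) auto
  finally show ?thesis .
qed

lemma interpolant_L2_error:
  assumes U: "derivative_family \<kappa> U" and h: "d - c \<le> h"
  shows "L2_inner c d (\<lambda>y. U 0 y - poly (interpolant (U 0 c) (U 1)) y) (\<lambda>y. U 0 y - poly (interpolant (U 0 c) (U 1)) y)
    \<le> (\<kappa> * h ^ (k + 1))\<^sup>2 * (d - c)"
  by (intro inner_self_bound continuous_on_diff continuous_on_poly_fun derivative_family_continuous[OF U]
      interpolant_pointwise_error[OF U _ h]) auto

lemma interp_residual_le:
  assumes U: "derivative_family \<kappa> U" and h: "d - c \<le> h"
  shows "(\<Sum>i<k. (interp_residual U i)\<^sup>2) \<le> (\<kappa> * h ^ (k + 1))\<^sup>2 * (d - c)"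
proof -
  note uL = L2_spaceI_continuous[OF derivative_family_continuous[OF U, of 0, simplified]]
  have "interp_residual U i = coef (\<lambda>y. U 0 y - poly (interpolant (U 0 c) (U 1)) y) i" for i
    unfolding interp_residual_def coef_diff[OF uL poly_L2_space] ..
  then have "(\<Sum>i<k. (interp_residual U i)\<^sup>2) = (\<Sum>i<k. (coef (\<lambda>y. U 0 y - poly (interpolant (U 0 c) (U 1)) y) i)\<^sup>2)"
    by (simp only:)
  also have "\<dots> \<le> (\<kappa> * h ^ (k + 1))\<^sup>2 * (d - c)"
    by (rule order_trans[OF Bessel[OF L2_space_diff[OF uL poly_L2_space]] interpolant_L2_error[OF U h]])
  finally show ?thesis .
qed

lemma weight_residual_le:
  assumes U: "derivative_family \<kappa> U" and h: "d - c \<le> h"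
    and \<delta>: "\<delta> \<in> Linf_space {c<..<d}" and B: "AE y in lborel. y \<in> {c<..<d} \<longrightarrow> \<bar>\<delta> y\<bar> \<le> B"
    and w: "weak_deriv c d \<delta> w" "w \<in> L2_space {c<..<d}"
    and M: "AE y in lborel. y \<in> {c<..<d} \<longrightarrow> \<bar>w y\<bar> \<le> M" "0 \<le> M"
  shows "(\<Sum>i<k. (weight_residual \<delta> U i)\<^sup>2) \<le> 2 * (M\<^sup>2 + B\<^sup>2) * ((\<kappa> * h ^ (k + 1))\<^sup>2 * (d - c))"
proof -
  let ?e = "\<lambda>y. U 0 y - poly (proj (U 0)) y"
  let ?p = "\<lambda>i. coef (\<lambda>y. \<delta> y * ?e y) i"
  let ?q = "\<lambda>i. \<Sum>j<k. weight_matrix \<delta> i j * interp_residual U j"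
  have k0: "0 \<le> \<kappa>" by (rule derivative_family_nonneg[OF U])
  have "L2_inner c d ?e ?e \<le> (\<kappa> * (d - c) ^ k)\<^sup>2 * (d - c)"
    using U unfolding derivative_family_def by (intro proj_error) auto
  then have "(M * (d - c))\<^sup>2 * L2_inner c d ?e ?e \<le> (M * (d - c))\<^sup>2 * ((\<kappa> * (d - c) ^ k)\<^sup>2 * (d - c))"
    by (intro mult_left_mono) auto
  also have "\<dots> = M\<^sup>2 * ((\<kappa> * (d - c) ^ (k + 1))\<^sup>2 * (d - c))"
    by (simp add: power_mult_distrib mult_ac)
  also have "\<dots> \<le> M\<^sup>2 * ((\<kappa> * h ^ (k + 1))\<^sup>2 * (d - c))"
    using cd h k0 by (intro mult_left_mono mult_right_mono power_mono mult_nonneg_nonneg) auto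
  finally have p: "(\<Sum>i<k. (?p i)\<^sup>2) \<le> M\<^sup>2 * ((\<kappa> * h ^ (k + 1))\<^sup>2 * (d - c))"
    using weighted_proj_error_le[OF \<delta> w M derivative_family_continuous[OF U, of 0]] by simp
  have q: "(\<Sum>i<k. (?q i)\<^sup>2) \<le> B\<^sup>2 * ((\<kappa> * h ^ (k + 1))\<^sup>2 * (d - c))"
    by (rule order_trans[OF weight_matrix_bound[OF \<delta> B] mult_left_mono[OF interp_residual_le[OF U h]]]) simp
  have "(\<Sum>i<k. (weight_residual \<delta> U i)\<^sup>2) \<le> (\<Sum>i<k. 2 * (?p i)\<^sup>2 + 2 * (?q i)\<^sup>2)"
  proof (rule sum_mono)
    fix i
    have "0 \<le> (?p i - ?q i)\<^sup>2" by simp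
    then show "(weight_residual \<delta> U i)\<^sup>2 \<le> 2 * (?p i)\<^sup>2 + 2 * (?q i)\<^sup>2"
      unfolding weight_residual_def power2_sum power2_diff by linarith
  qed
  also have "\<dots> = 2 * (\<Sum>i<k. (?p i)\<^sup>2) + 2 * (\<Sum>i<k. (?q i)\<^sup>2)"
    by (simp only: sum.distrib sum_distrib_left)
  also have "\<dots> \<le> 2 * (M\<^sup>2 * ((\<kappa> * h ^ (k + 1))\<^sup>2 * (d - c))) + 2 * (B\<^sup>2 * ((\<kappa> * h ^ (k + 1))\<^sup>2 * (d - c)))"
    by (intro add_mono mult_left_mono p q) auto
  also have "\<dots> = 2 * (M\<^sup>2 + B\<^sup>2) * ((\<kappa> * h ^ (k + 1))\<^sup>2 * (d - c))" by (simp only: distrib_left distrib_right mult_ac)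
  finally show ?thesis .
qed

lemma interp_residual_diff:
  assumes "\<And>j. j \<le> 1 \<Longrightarrow> continuous_on {c..d} (U j)" "\<And>j. j \<le> 1 \<Longrightarrow> continuous_on {c..d} (V j)"
  shows "interp_residual (\<lambda>j y. U j y - V j y) i = interp_residual U i - interp_residual V i"
proof -
  have L: "U j \<in> L2_space {c<..<d}" "V j \<in> L2_space {c<..<d}" if "j \<le> 1" for j
    using assms[OF that] by (auto intro: L2_spaceI_continuous)
  show ?thesis
    unfolding interp_residual_def coef_interpolant
    by (simp add: coef_diff L left_diff_distrib sum_subtractf)
qed

lemma weight_residual_diff:
  assumes U: "\<And>j. j \<le> 1 \<Longrightarrow> continuous_on {c..d} (U j)" and V: "\<And>j. j \<le> 1 \<Longrightarrow> continuous_on {c..d} (V j)"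
    and \<delta>: "\<delta> \<in> Linf_space {c<..<d}"
  shows "weight_residual \<delta> (\<lambda>j y. U j y - V j y) i = weight_residual \<delta> U i - weight_residual \<delta> V i"
proof -
  have L: "U 0 \<in> L2_space {c<..<d}" "V 0 \<in> L2_space {c<..<d}"
    using U[of 0] V[of 0] by (auto intro: L2_spaceI_continuous)
  have pd: "proj (\<lambda>y. U 0 y - V 0 y) = proj (U 0) - proj (V 0)"
    unfolding proj_def by (simp add: coef_diff[OF L] smult_diff_left sum_subtractf)
  have "(\<lambda>y. \<delta> y * (U 0 y - V 0 y - poly (proj (\<lambda>y. U 0 y - V 0 y)) y))
    = (\<lambda>y. \<delta> y * (U 0 y - poly (proj (U 0)) y) - \<delta> y * (V 0 y - poly (proj (V 0)) y))"
    unfolding pd by (rule ext) (simp add: algebra_simps)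
  then have "coef (\<lambda>y. \<delta> y * (U 0 y - V 0 y - poly (proj (\<lambda>y. U 0 y - V 0 y)) y)) i
    = coef (\<lambda>y. \<delta> y * (U 0 y - poly (proj (U 0)) y)) i - coef (\<lambda>y. \<delta> y * (V 0 y - poly (proj (V 0)) y)) i"
    by (simp only: coef_diff[OF Linf_mult_L2_space[OF \<delta> L2_space_diff[OF L(1) poly_L2_space]]
          Linf_mult_L2_space[OF \<delta> L2_space_diff[OF L(2) poly_L2_space]]])
  then show ?thesis
    unfolding weight_residual_def
    by (simp add: interp_residual_diff[OF U V] right_diff_distrib sum_subtractf)
qed

text \<open>Subtracting the discrete lower-order term of the interpolant from the exact one leaves exactly this
  residual in the error equation.\<close>

lemma weight_residual_eq:
  assumes u: "continuous_on {c..d} (U 0)" and \<delta>: "\<delta> \<in> Linf_space {c<..<d}"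
  shows "weight_residual \<delta> U i = coef (\<lambda>y. \<delta> y * U 0 y) i
    - (\<Sum>j<k. weight_matrix \<delta> i j * coef (poly (interpolant (U 0 c) (U 1))) j)"
proof -
  note uL = L2_spaceI_continuous[OF u]
  have "coef (\<lambda>y. \<delta> y * (U 0 y - poly (proj (U 0)) y)) i
    = coef (\<lambda>y. \<delta> y * U 0 y) i - coef (\<lambda>y. \<delta> y * poly (proj (U 0)) y) i"
    unfolding right_diff_distrib
    by (rule coef_diff[OF Linf_mult_L2_space[OF \<delta> uL] Linf_mult_L2_space[OF \<delta> poly_L2_space]])
  moreover have "coef (\<lambda>y. \<delta> y * poly (proj (U 0)) y) i = (\<Sum>j<k. weight_matrix \<delta> i j * coef (U 0) j)"
    unfolding proj_def by (rule weight_matrix_mult[OF \<delta>, symmetric])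
  ultimately show ?thesis
    by (simp add: weight_residual_def interp_residual_def right_diff_distrib sum_subtractf)
qed

lemma inner_self_diff_le:
  assumes "continuous_on {c..d} u" "continuous_on {c..d} v"
  shows "L2_inner c d (\<lambda>y. u y - v y) (\<lambda>y. u y - v y) \<le> 2 * L2_inner c d u u + 2 * L2_inner c d v v"
proof -
  have uv: "continuous_on {c..d} (\<lambda>y. u y - v y)" by (intro continuous_on_diff assms)
  have "L2_inner c d (\<lambda>y. u y - v y) (\<lambda>y. u y - v y) \<le> integral {c..d} (\<lambda>y. 2 * (u y * u y) + 2 * (v y * v y))"
    unfolding L2_inner_eq_integral[OF uv uv]
  proof (rule integral_le)
    fix y
    have "0 \<le> (u y + v y)\<^sup>2" by simp
    then show "(u y - v y) * (u y - v y) \<le> 2 * (u y * u y) + 2 * (v y * v y)"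
      by (simp add: power2_eq_square algebra_simps)
  qed (intro integrable_continuous_real continuous_on_add continuous_on_mult continuous_on_const uv assms)+
  also have "\<dots> = 2 * L2_inner c d u u + 2 * L2_inner c d v v"
    unfolding L2_inner_eq_integral[OF assms(1) assms(1)] L2_inner_eq_integral[OF assms(2) assms(2)]
    by (subst Henstock_Kurzweil_Integration.integral_add)
       (auto intro!: integrable_continuous_real continuous_on_mult continuous_on_const assms)
  finally show ?thesis .
qed

end

section \<open>Moments of the discrete solution as functions of time\<close>

lemma test_function_continuous:
  assumes "\<phi> \<in> test_functions \<alpha> \<beta>"
  shows "continuous_on S \<phi>" "continuous_on S (deriv \<phi>)"
proof -
  obtain D where D: "\<And>y. (\<phi> has_vector_derivative D y) (at y)" "continuous_on UNIV D"
    using assms unfolding test_functions_def C1_differentiable_on_def by auto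
  have d: "(\<phi> has_real_derivative D y) (at y)" for y
    using D(1) by (simp add: has_real_derivative_iff_has_vector_derivative)
  show "continuous_on S \<phi>" by (rule DERIV_continuous_on[OF has_field_derivative_at_within[OF d]])
  have "deriv \<phi> = D" using d by (intro ext DERIV_imp_deriv)
  then show "continuous_on S (deriv \<phi>)" using continuous_on_subset[OF D(2)] by simp
qed

lemma weak_deriv_sum:
  assumes "\<And>i. i \<in> I \<Longrightarrow> continuous_on {\<alpha>..\<beta>} (v i)" "\<And>i. i \<in> I \<Longrightarrow> w i \<in> L2_space {\<alpha><..<\<beta>}"
    and "\<And>i. i \<in> I \<Longrightarrow> weak_deriv \<alpha> \<beta> (v i) (w i)"
  shows "weak_deriv \<alpha> \<beta> (\<lambda>t. \<Sum>i\<in>I. r i * v i t) (\<lambda>t. \<Sum>i\<in>I. r i * w i t)"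
  unfolding weak_deriv_def
proof
  fix \<phi> assume \<phi>: "\<phi> \<in> test_functions \<alpha> \<beta>"
  have "L2_inner \<alpha> \<beta> (\<lambda>t. \<Sum>i\<in>I. r i * v i t) (deriv \<phi>) = (\<Sum>i\<in>I. r i * L2_inner \<alpha> \<beta> (v i) (deriv \<phi>))"
    by (intro L2_inner_sum_left L2_spaceI_continuous test_function_continuous[OF \<phi>] assms(1))
  also have "\<dots> = (\<Sum>i\<in>I. r i * - L2_inner \<alpha> \<beta> (w i) \<phi>)"
    using assms(3) \<phi> by (intro sum.cong) (auto simp: weak_deriv_def L2_inner_def)
  also have "\<dots> = - L2_inner \<alpha> \<beta> (\<lambda>t. \<Sum>i\<in>I. r i * w i t) \<phi>"
    using L2_inner_sum_left[of I w \<alpha> \<beta> \<phi> r, OF assms(2) L2_spaceI_continuous[OF test_function_continuous(1)[OF \<phi>]]]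
    by (simp add: sum_negf)
  finally show "(LINT t:{\<alpha><..<\<beta>}|lborel. (\<Sum>i\<in>I. r i * v i t) * deriv \<phi> t)
     = - (LINT t:{\<alpha><..<\<beta>}|lborel. (\<Sum>i\<in>I. r i * w i t) * \<phi> t)"
    by (simp add: L2_inner_def)
qed

lemma pderiv_sum_smult: "pderiv (\<Sum>i\<in>I. smult (a i) (p i)) = (\<Sum>i\<in>I. smult (a i) (pderiv (p i)))"
  by (induction I rule: infinite_finite_induct) (simp_all add: pderiv_add pderiv_smult)

context mesh
begin

text \<open>The \<open>k + 1\<close> equidistant points of the closed element determine a polynomial of degree \<open>k\<close>.\<close>

lemma piece_from_point_values:
  assumes "n < N"
  shows "\<exists>s L. (\<forall>l\<le>k. s l \<in> {x n..x (Suc n)}) \<and>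
    (\<forall>v. v \<in> pw_poly k N x \<longrightarrow> continuous_on {xL..xR} v \<longrightarrow> piece v n = (\<Sum>l\<le>k. smult (v (s l)) (L l)))"
proof -
  let ?h = "x (Suc n) - x n"
  have h: "0 < ?h" using x_step[OF assms] by simp
  define s where "s l = x n + ?h * (real l / real k)" for l
  have k0: "0 < real k" using k1 by simp
  have sin: "s l \<in> {x n..x (Suc n)}" if "l \<le> k" for l
  proof -
    define p where "p = ?h * (real l / real k)"
    have "real l / real k \<le> 1" using that k0 by simp
    then have "p \<le> ?h * 1" unfolding p_def using h by (intro mult_left_mono) auto
    moreover have "0 \<le> p" using h by (simp add: p_def)
    ultimately show ?thesis unfolding s_def p_def[symmetric] by simp
  qed
  have "inj_on s {..k}"
    using h k0 by (intro inj_onI) (simp add: s_def)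
  then obtain L where L: "\<And>e. degree e \<le> k \<Longrightarrow> e = (\<Sum>l\<le>k. smult (poly e (s l)) (L l))"
    using Lagrange_interpolation by blast
  have "piece v n = (\<Sum>l\<le>k. smult (v (s l)) (L l))" if v: "v \<in> pw_poly k N x" "continuous_on {xL..xR} v" for v
  proof -
    have "piece v n = (\<Sum>l\<le>k. smult (poly (piece v n) (s l)) (L l))"
      by (rule L[OF piece_open(1)[OF v(1) assms]])
    also have "\<dots> = (\<Sum>l\<le>k. smult (v (s l)) (L l))"
      by (intro sum.cong refl arg_cong2[where f=smult] piece_eq[OF v assms, symmetric] sin) simp
    finally show ?thesis .
  qed
  then show ?thesis using sin by blast
qed

lemma coef_piece:
  assumes "v \<in> pw_poly k N x" "n < N"
  shows "cf n v i = cf n (poly (piece v n)) i"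
  by (rule element.coef_cong[OF element[OF assms(2)]]) (rule piece_open(2)[OF assms])

definition fe_functions :: "(real \<Rightarrow> real) set" where
  "fe_functions = {v \<in> pw_poly k N x. continuous_on {xL..xR} v}"

lemma moment_from_point_values:
  assumes "n < N"
  shows "\<exists>s r r'. (\<forall>l\<le>k. s l \<in> {xL..xR}) \<and> (\<forall>v\<in>fe_functions.
      cf n v i = (\<Sum>l\<le>k. r l * v (s l)) \<and> cf n (poly (pderiv (piece v n))) i = (\<Sum>l\<le>k. r' l * v (s l)))"
proof -
  interpret e: element "x n" "x (Suc n)" k "basis n" by (rule element[OF assms])
  obtain s L where s: "\<And>l. l \<le> k \<Longrightarrow> s l \<in> {x n..x (Suc n)}"
    and L: "\<And>v. v \<in> fe_functions \<Longrightarrow> piece v n = (\<Sum>l\<le>k. smult (v (s l)) (L l))"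
    using piece_from_point_values[OF assms] unfolding fe_functions_def by blast
  have eqs: "cf n v i = (\<Sum>l\<le>k. cf n (poly (L l)) i * v (s l))"
    "cf n (poly (pderiv (piece v n))) i = (\<Sum>l\<le>k. cf n (poly (pderiv (L l))) i * v (s l))"
    if v: "v \<in> fe_functions" for v
  proof -
    have "cf n v i = cf n (poly (\<Sum>l\<le>k. smult (v (s l)) (L l))) i"
      using coef_piece[OF _ assms, of v] v L[OF v] by (simp add: fe_functions_def)
    then show "cf n v i = (\<Sum>l\<le>k. cf n (poly (L l)) i * v (s l))"
      unfolding e.coef_sum_poly by (simp add: mult.commute)
    show "cf n (poly (pderiv (piece v n))) i = (\<Sum>l\<le>k. cf n (poly (pderiv (L l))) i * v (s l))"
      unfolding L[OF v] pderiv_sum_smult e.coef_sum_poly by (simp add: mult.commute)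
  qed
  have "s l \<in> {xL..xR}" if "l \<le> k" for l
    using s[OF that] element_subset[OF assms] by blast
  then show ?thesis
    by (intro exI[of _ s] exI[of _ "\<lambda>l. cf n (poly (L l)) i"] exI[of _ "\<lambda>l. cf n (poly (pderiv (L l))) i"]
        conjI allI impI ballI eqs)
qed

lemma discrete_coef_continuous:
  assumes H: "H1_time T xL xR X u u'" and X: "X \<subseteq> fe_functions" and n: "n < N"
  shows "continuous_on {0..T} (\<lambda>t. cf n (u t) i)"
    and "continuous_on {0..T} (\<lambda>t. cf n (poly (pderiv (piece (u t) n))) i)"
proof -
  obtain s r r' where sr: "(\<forall>l\<le>k. s l \<in> {xL..xR}) \<and> (\<forall>v\<in>fe_functions.
      cf n v i = (\<Sum>l\<le>k. r l * v (s l)) \<and> cf n (poly (pderiv (piece v n))) i = (\<Sum>l\<le>k. r' l * v (s l)))"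
    using moment_from_point_values[OF n, of i] by (elim exE)
  have s: "s l \<in> {xL..xR}" if "l \<le> k" for l
    using conjunct1[OF sr] that by simp
  have r: "cf n v i = (\<Sum>l\<le>k. r l * v (s l))"
    "cf n (poly (pderiv (piece v n))) i = (\<Sum>l\<le>k. r' l * v (s l))" if "v \<in> fe_functions" for v
    by (rule conjunct1[OF bspec[OF conjunct2[OF sr] that]], rule conjunct2[OF bspec[OF conjunct2[OF sr] that]])
  have uX: "u t \<in> fe_functions" if "t \<in> {0..T}" for t
    using H X that unfolding H1_time_def by blast
  have c: "continuous_on {0..T} (\<lambda>t. \<Sum>l\<le>k. q l * u t (s l))" for q
    using H s unfolding H1_time_def by (intro continuous_on_sum continuous_on_mult continuous_on_const) auto
  show "continuous_on {0..T} (\<lambda>t. cf n (u t) i)"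
    by (rule continuous_on_eq[OF c[of r]]) (simp add: r(1)[OF uX])
  show "continuous_on {0..T} (\<lambda>t. cf n (poly (pderiv (piece (u t) n))) i)"
    by (rule continuous_on_eq[OF c[of r']]) (simp add: r(2)[OF uX])
qed

text \<open>A moment is a fixed combination of point values, hence weakly differentiable in time. If the equations
  identify its weak derivative with a continuous function, the derivative is classical.\<close>

lemma discrete_coef_has_derivative:
  assumes H: "H1_time T xL xR X u u'" and X: "X \<subseteq> fe_functions" and n: "n < N" and T: "0 < T"
    and g: "continuous_on {0..T} g"
    and eq: "AE t in lborel. t \<in> {0<..<T} \<longrightarrow> cf n (u' t) i = g t"
    and t: "t \<in> {0..T}"
  shows "((\<lambda>t. cf n (u t) i) has_real_derivative g t) (at t within {0..T})"
proof -
  obtain s r r' where sr: "(\<forall>l\<le>k. s l \<in> {xL..xR}) \<and> (\<forall>v\<in>fe_functions.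
      cf n v i = (\<Sum>l\<le>k. r l * v (s l)) \<and> cf n (poly (pderiv (piece v n))) i = (\<Sum>l\<le>k. r' l * v (s l)))"
    using moment_from_point_values[OF n, of i] by (elim exE)
  have s: "s l \<in> {xL..xR}" if "l \<le> k" for l
    using conjunct1[OF sr] that by simp
  have r: "cf n v i = (\<Sum>l\<le>k. r l * v (s l))" if "v \<in> fe_functions" for v
    by (rule conjunct1[OF bspec[OF conjunct2[OF sr] that]])
  have uX: "u t \<in> fe_functions" "u' t \<in> fe_functions" if "t \<in> {0..T}" for t
    using H X that unfolding H1_time_def by blast+
  have c: "continuous_on {0..T} (\<lambda>t. u t (s l))" and L: "(\<lambda>t. u' t (s l)) \<in> L2_space {0<..<T}"
    and w: "weak_deriv 0 T (\<lambda>t. u t (s l)) (\<lambda>t. u' t (s l))" if "l \<le> k" for l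
    using H s[OF that] unfolding H1_time_def by blast+
  have wL: "(\<lambda>t. \<Sum>l\<le>k. r l * u' t (s l)) \<in> L2_space {0<..<T}"
    by (intro L2_space_sum L2_space_scale L) simp
  have "((\<lambda>t. \<Sum>l\<le>k. r l * u t (s l)) has_real_derivative g t) (at t within {0..T})"
  proof (rule has_derivative_if_weak_deriv_continuous[OF T _ weak_deriv_sum _ g _ t])
    show "continuous_on {0..T} (\<lambda>t. \<Sum>l\<le>k. r l * u t (s l))"
      by (intro continuous_on_sum continuous_on_mult continuous_on_const c) simp
    show "set_borel_measurable lborel {0<..<T} (\<lambda>t. \<Sum>l\<le>k. r l * u' t (s l))"
      using wL by (simp add: L2_space_def)
    show "AE t in lborel. t \<in> {0<..<T} \<longrightarrow> (\<Sum>l\<le>k. r l * u' t (s l)) = g t"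
      using eq by (rule eventually_mono) (use r[OF uX(2)] in auto)
  qed (use c L w in auto)
  then show ?thesis
    by (rule has_field_derivative_transform_within[OF _ zero_less_one t]) (simp add: r[OF uX(1)])
qed

end

section \<open>Error equations and error estimate\<close>

text \<open>The array of partial derivatives whose existence \<open>Cr_norm_le\<close> asserts, made available as an object.\<close>

definition smooth_array ::
  "nat \<Rightarrow> real \<Rightarrow> real \<Rightarrow> real \<Rightarrow> (nat \<Rightarrow> nat \<Rightarrow> real \<Rightarrow> real \<Rightarrow> real) \<Rightarrow> real \<Rightarrow> bool"
where
  "smooth_array r T \<alpha> \<beta> D K \<longleftrightarrow>
     (\<forall>i j. i + j < r \<longrightarrow> (\<forall>t\<in>{0..T}. \<forall>y\<in>{\<alpha>..\<beta>}.
        ((\<lambda>s. D i j s y) has_real_derivative D (Suc i) j t y) (at t within {0..T}) \<and>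
        ((\<lambda>z. D i j t z) has_real_derivative D i (Suc j) t y) (at y within {\<alpha>..\<beta>}))) \<and>
     (\<forall>i j. i + j \<le> r \<longrightarrow>
        continuous_on ({0..T} \<times> {\<alpha>..\<beta>}) (\<lambda>(t, y). D i j t y) \<and>
        (\<forall>t\<in>{0..T}. \<forall>y\<in>{\<alpha>..\<beta>}. \<bar>D i j t y\<bar> \<le> K))"

lemma smooth_arrayD:
  assumes "smooth_array r T \<alpha> \<beta> D K"
  shows "i + j < r \<Longrightarrow> t \<in> {0..T} \<Longrightarrow> y \<in> {\<alpha>..\<beta>} \<Longrightarrow>
      ((\<lambda>s. D i j s y) has_real_derivative D (Suc i) j t y) (at t within {0..T})"
    and "i + j < r \<Longrightarrow> t \<in> {0..T} \<Longrightarrow> y \<in> {\<alpha>..\<beta>} \<Longrightarrow>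
      (D i j t has_real_derivative D i (Suc j) t y) (at y within {\<alpha>..\<beta>})"
    and "i + j \<le> r \<Longrightarrow> continuous_on ({0..T} \<times> {\<alpha>..\<beta>}) (\<lambda>(t, y). D i j t y)"
    and "i + j \<le> r \<Longrightarrow> t \<in> {0..T} \<Longrightarrow> y \<in> {\<alpha>..\<beta>} \<Longrightarrow> \<bar>D i j t y\<bar> \<le> K"
    and "i + j \<le> r \<Longrightarrow> t \<in> {0..T} \<Longrightarrow> continuous_on {\<alpha>..\<beta>} (D i j t)"
  using assms continuous_on_section[of "{0..T}" "{\<alpha>..\<beta>}" "\<lambda>t y. D i j t y" t]
  unfolding smooth_array_def by simp_all

lemma Cr_norm_le_iff:
  "Cr_norm_le r T \<alpha> \<beta> u K \<longleftrightarrow>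
    (\<exists>D. (\<forall>t\<in>{0..T}. \<forall>y\<in>{\<alpha>..\<beta>}. D 0 0 t y = u t y) \<and> smooth_array r T \<alpha> \<beta> D K)"
  unfolding Cr_norm_le_def smooth_array_def by (simp only:)

context mesh
begin

abbreviation "family n \<equiv> element.derivative_family (x n) (x (Suc n)) k"
abbreviation "ires n \<equiv> element.interp_residual (x n) (x (Suc n)) k (basis n)"
abbreviation "wres n \<equiv> element.weight_residual (x n) (x (Suc n)) k (basis n)"

lemma smooth_array_element_continuous:
  assumes "smooth_array r T xL xR D K" "i + j \<le> r" "t \<in> {0..T}" "n < N"
  shows "continuous_on {x n..x (Suc n)} (D i j t)"
  by (rule continuous_on_subset[OF smooth_arrayD(5)[OF assms(1-3)] element_subset[OF assms(4)]])

lemma smooth_array_family: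
  assumes D: "smooth_array (k + 3) T xL xR D K" and s: "s \<le> 1" and t: "t \<in> {0..T}" and n: "n < N"
  shows "family n K (\<lambda>j. D s j t)"
  unfolding element.derivative_family_def[OF element[OF n]]
proof (intro conjI allI impI ballI)
  fix j y assume j: "j < Suc k" and y: "y \<in> {x n..x (Suc n)}"
  have "(D s j t has_real_derivative D s (Suc j) t y) (at y within {xL..xR})"
    by (rule smooth_arrayD(2)[OF D _ t]) (use j s y element_subset[OF n] in auto)
  then show "(D s j t has_real_derivative D s (Suc j) t y) (at y within {x n..x (Suc n)})"
    by (rule has_field_derivative_subset[OF _ element_subset[OF n]])
next
  fix y assume y: "y \<in> {x n..x (Suc n)}"
  then have y': "y \<in> {xL..xR}" using element_subset[OF n] by blast
  show "\<bar>D s k t y\<bar> \<le> K" "\<bar>D s (Suc k) t y\<bar> \<le> K"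
    using s by (intro smooth_arrayD(4)[OF D _ t y']; simp)+
qed

lemma smooth_array_lipschitz:
  assumes D: "smooth_array (k + 3) T xL xR D K" and ij: "i + j < k + 3"
    and t: "t \<in> {0..T}" "t' \<in> {0..T}" and y: "y \<in> {xL..xR}"
  shows "\<bar>D i j t y - D i j t' y\<bar> \<le> K * \<bar>t - t'\<bar>"
  using field_differentiable_bound[of "{0..T}" "\<lambda>s. D i j s y" "\<lambda>s. D (Suc i) j s y" K t t']
    smooth_arrayD(1)[OF D ij _ y] smooth_arrayD(4)[OF D, of "Suc i" j _ y] ij t y by simp

text \<open>One more time derivative bounds time differences, which are again families of derivatives in space.\<close>

lemma smooth_array_family_diff:
  assumes D: "smooth_array (k + 3) T xL xR D K" and s: "s \<le> 1"
    and t: "t \<in> {0..T}" "t' \<in> {0..T}" and n: "n < N"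
  shows "family n (K * \<bar>t - t'\<bar>) (\<lambda>j y. D s j t y - D s j t' y)"
  unfolding element.derivative_family_def[OF element[OF n]]
proof (intro conjI allI impI ballI)
  fix j y assume j: "j < Suc k" and y: "y \<in> {x n..x (Suc n)}"
  have "(D s j r has_real_derivative D s (Suc j) r y) (at y within {x n..x (Suc n)})" if "r \<in> {0..T}" for r
    by (rule has_field_derivative_subset[OF smooth_arrayD(2)[OF D _ that] element_subset[OF n]])
       (use j s y element_subset[OF n] in auto)
  then show "((\<lambda>y. D s j t y - D s j t' y) has_real_derivative D s (Suc j) t y - D s (Suc j) t' y) (at y within {x n..x (Suc n)})"
    using t by (intro DERIV_diff) auto
next
  fix y assume y: "y \<in> {x n..x (Suc n)}"
  then have y': "y \<in> {xL..xR}" using element_subset[OF n] by blast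
  show "\<bar>D s k t y - D s k t' y\<bar> \<le> K * \<bar>t - t'\<bar>" "\<bar>D s (Suc k) t y - D s (Suc k) t' y\<bar> \<le> K * \<bar>t - t'\<bar>"
    using s by (intro smooth_array_lipschitz[OF D _ t y']; simp)+
qed

lemma coef_smooth_has_derivative:
  assumes D: "smooth_array r T xL xR D K" and ij: "i + j < r" and t: "t \<in> {0..T}" and n: "n < N"
  shows "((\<lambda>s. cf n (D i j s) l) has_real_derivative cf n (D (Suc i) j t) l) (at t within {0..T})"
proof (rule element.coef_has_derivative[OF element[OF n] _ _ _ t])
  show "((\<lambda>s. D i j s y) has_real_derivative D (Suc i) j s y) (at s within {0..T})"
    if "s \<in> {0..T}" "y \<in> {x n..x (Suc n)}" for s y
    by (rule smooth_arrayD(1)[OF D ij that(1)]) (use that element_subset[OF n] in blast)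
  show "continuous_on {x n..x (Suc n)} (D i j s)" if "s \<in> {0..T}" for s
    using ij by (intro smooth_array_element_continuous[OF D _ that n]) simp
  show "continuous_on ({0..T} \<times> {x n..x (Suc n)}) (\<lambda>(s, y). D (Suc i) j s y)"
    by (rule continuous_on_subset[OF smooth_arrayD(3)[OF D]]) (use ij element_subset[OF n] in auto)
qed

lemma coef_smooth_continuous:
  assumes D: "smooth_array r T xL xR D K" and ij: "i + j \<le> r" and n: "n < N"
  shows "continuous_on {0..T} (\<lambda>s. cf n (D i j s) l)"
  by (rule element.coef_continuous[OF element[OF n]])
     (rule continuous_on_subset[OF smooth_arrayD(3)[OF D ij]], use element_subset[OF n] in auto)

lemma interpolant_has_derivative:
  assumes D: "smooth_array (k + 3) T xL xR D K" and t: "t \<in> {0..T}" and n: "n < N"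
  shows "((\<lambda>t. cf n (poly (ipol n (D 0 0 t (x n)) (D 0 1 t))) i) has_real_derivative
     cf n (poly (ipol n (D 1 0 t (x n)) (D 1 1 t))) i) (at t within {0..T})"
proof -
  have "((\<lambda>s. D 0 0 s (x n)) has_real_derivative D 1 0 t (x n)) (at t within {0..T})"
    using smooth_arrayD(1)[OF D, of 0 0 t "x n"] t node_in[of n] n by simp
  moreover have "((\<lambda>s. cf n (D 0 1 s) j) has_real_derivative cf n (D 1 1 t) j) (at t within {0..T})" for j
    using coef_smooth_has_derivative[OF D _ t n, of 0 1 j] by simp
  ultimately show ?thesis
    unfolding element.coef_interpolant[OF element[OF n]]
    by (intro DERIV_add DERIV_cmult_right DERIV_sum)
qed

lemma sum_interp_residual_le:
  assumes U: "\<And>n. n < N \<Longrightarrow> family n \<kappa> U"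
  shows "(\<Sum>n<N. \<Sum>i<k. (ires n U i)\<^sup>2) \<le> (\<kappa> * mesh_size N x ^ (k + 1))\<^sup>2 * (xR - xL)"
proof -
  have "(\<Sum>n<N. \<Sum>i<k. (ires n U i)\<^sup>2) \<le> (\<Sum>n<N. (\<kappa> * mesh_size N x ^ (k + 1))\<^sup>2 * (x (Suc n) - x n))"
    by (intro sum_mono element.interp_residual_le element U mesh_size_ge) auto
  then show ?thesis by (simp only: sum_distrib_left[symmetric] sum_element_lengths)
qed

lemma sum_weight_residual_le:
  assumes U: "\<And>n. n < N \<Longrightarrow> family n \<kappa> U"
    and w: "\<And>n. n < N \<Longrightarrow> \<exists>w\<in>L2_space {x n<..<x (Suc n)}. weak_deriv (x n) (x (Suc n)) \<delta> w \<and>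
       (AE y in lborel. y \<in> {x n<..<x (Suc n)} \<longrightarrow> \<bar>w y\<bar> \<le> M)" and M: "0 \<le> M"
    and \<delta>n: "\<And>n. n < N \<Longrightarrow> \<delta> \<in> Linf_space {x n<..<x (Suc n)}"
    and Bn: "\<And>n. n < N \<Longrightarrow> AE y in lborel. y \<in> {x n<..<x (Suc n)} \<longrightarrow> \<bar>\<delta> y\<bar> \<le> B"
  shows "(\<Sum>n<N. \<Sum>i<k. (wres n \<delta> U i)\<^sup>2) \<le> 2 * (M\<^sup>2 + B\<^sup>2) * ((\<kappa> * mesh_size N x ^ (k + 1))\<^sup>2 * (xR - xL))"
proof -
  have "(\<Sum>n<N. \<Sum>i<k. (wres n \<delta> U i)\<^sup>2)
    \<le> (\<Sum>n<N. 2 * (M\<^sup>2 + B\<^sup>2) * ((\<kappa> * mesh_size N x ^ (k + 1))\<^sup>2 * (x (Suc n) - x n)))"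
  proof (rule sum_mono)
    fix n assume "n \<in> {..<N}"
    then have n: "n < N" by simp
    obtain w where "w \<in> L2_space {x n<..<x (Suc n)}" "weak_deriv (x n) (x (Suc n)) \<delta> w"
       "AE y in lborel. y \<in> {x n<..<x (Suc n)} \<longrightarrow> \<bar>w y\<bar> \<le> M" using w[OF n] by blast
    then show "(\<Sum>i<k. (wres n \<delta> U i)\<^sup>2) \<le> 2 * (M\<^sup>2 + B\<^sup>2) * ((\<kappa> * mesh_size N x ^ (k + 1))\<^sup>2 * (x (Suc n) - x n))"
      using M by (intro element.weight_residual_le[OF element[OF n] U[OF n] mesh_size_ge[OF n] \<delta>n[OF n] Bn[OF n]])
  qed
  then show ?thesis by (simp only: sum_distrib_left[symmetric] sum_element_lengths)
qed

lemma Linf_space_element: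
  assumes "\<delta> \<in> Linf_space {xL<..<xR}" "n < N"
  shows "\<delta> \<in> Linf_space {x n<..<x (Suc n)}"
proof -
  have m: "(\<lambda>y. indicat_real {xL<..<xR} y *\<^sub>R \<delta> y) \<in> borel_measurable lborel"
    using assms(1) by (simp only: Linf_space_def set_borel_measurable_def mem_Collect_eq)
  have "(\<lambda>y. indicat_real {x n<..<x (Suc n)} y *\<^sub>R (indicat_real {xL<..<xR} y *\<^sub>R \<delta> y)) \<in> borel_measurable lborel"
    by (rule borel_measurable_scaleR[OF borel_measurable_indicator m]) simp
  moreover have "(\<lambda>y. indicat_real {x n<..<x (Suc n)} y *\<^sub>R (indicat_real {xL<..<xR} y *\<^sub>R \<delta> y))
      = (\<lambda>y. indicat_real {x n<..<x (Suc n)} y *\<^sub>R \<delta> y)"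
    using open_element_subset[OF assms(2)] by (intro ext) (auto simp: indicator_def)
  moreover obtain c where "AE y in lborel. y \<in> {xL<..<xR} \<longrightarrow> \<bar>\<delta> y\<bar> \<le> c"
    using assms(1) unfolding Linf_space_def by blast
  then have "AE y in lborel. y \<in> {x n<..<x (Suc n)} \<longrightarrow> \<bar>\<delta> y\<bar> \<le> c"
    by (rule eventually_mono) (use open_element_subset[OF assms(2)] in blast)
  ultimately show ?thesis unfolding Linf_space_def set_borel_measurable_def by auto
qed

end

text \<open>The equations of the method, tested with the basis of each element, after the right-hand sides have been
  replaced by the exact solution. The arrays \<open>Dp\<close> and \<open>Dm\<close> contain the derivatives of the exact solution, \<open>B\<close> bounds
  the weight and \<open>M\<close> its derivative on each element.\<close>

locale semidiscrete_error = mesh xL xR N x k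
  for xL xR :: real and N :: nat and x :: "nat \<Rightarrow> real" and k :: nat +
  fixes a b B M T K :: real and \<delta> :: "real \<Rightarrow> real"
    and Dp Dm :: "nat \<Rightarrow> nat \<Rightarrow> real \<Rightarrow> real \<Rightarrow> real" and ph ph' mh mh' :: "real \<Rightarrow> real \<Rightarrow> real"
  assumes ab: "0 < a" "0 < b" and T: "0 < T" and M0: "0 \<le> M"
    and \<delta>: "\<delta> \<in> Linf_space {xL<..<xR}"
    and \<delta>B: "AE y in lborel. y \<in> {xL<..<xR} \<longrightarrow> 0 \<le> \<delta> y \<and> \<bar>\<delta> y\<bar> \<le> B"
    and \<delta>M: "\<And>n. n < N \<Longrightarrow> \<exists>w\<in>L2_space {x n<..<x (Suc n)}. weak_deriv (x n) (x (Suc n)) \<delta> w \<and>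
       (AE y in lborel. y \<in> {x n<..<x (Suc n)} \<longrightarrow> \<bar>w y\<bar> \<le> M)"
    and Dp: "smooth_array (k + 3) T xL xR Dp K" and Dm: "smooth_array (k + 3) T xL xR Dm K"
    and boundary: "\<And>t. t \<in> {0..T} \<Longrightarrow> Dp 0 0 t xL = 0" "\<And>t. t \<in> {0..T} \<Longrightarrow> Dp 0 0 t xR = 0"
    and ph: "H1_time T xL xR (Q_space k N x) ph ph'" and mh: "H1_time T xL xR (V_space k N x) mh mh'"
    and init_p: "\<And>n y. n < N \<Longrightarrow> y \<in> {x n..x (Suc n)} \<Longrightarrow> ph 0 y = poly (ipol n (Dp 0 0 0 (x n)) (Dp 0 1 0)) y"
    and init_m: "\<And>n y. n < N \<Longrightarrow> y \<in> {x n..x (Suc n)} \<Longrightarrow> mh 0 y = poly (ipol n (Dm 0 0 0 (x n)) (Dm 0 1 0)) y"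
    and eq_p: "\<And>n i. n < N \<Longrightarrow> i < k \<Longrightarrow> AE t in lborel. t \<in> {0<..<T} \<longrightarrow>
       a * cf n (ph' t) i + cf n (poly (pderiv (piece (mh t) n))) i = a * cf n (Dp 1 0 t) i + cf n (Dm 0 1 t) i"
    and eq_m: "\<And>n i. n < N \<Longrightarrow> i < k \<Longrightarrow> AE t in lborel. t \<in> {0<..<T} \<longrightarrow>
       b * cf n (mh' t) i + cf n (poly (pderiv (piece (ph t) n))) i + (\<Sum>l<k. wmat n \<delta> i l * cf n (mh t) l)
       = b * cf n (Dm 1 0 t) i + cf n (Dp 0 1 t) i + cf n (\<lambda>y. \<delta> y * Dm 0 0 t y) i"
begin

lemma \<delta>_element:
  assumes "n < N"
  shows "\<delta> \<in> Linf_space {x n<..<x (Suc n)}" "AE y in lborel. y \<in> {x n<..<x (Suc n)} \<longrightarrow> \<bar>\<delta> y\<bar> \<le> B"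
    "AE y in lborel. y \<in> {x n<..<x (Suc n)} \<longrightarrow> 0 \<le> \<delta> y"
proof -
  show "\<delta> \<in> Linf_space {x n<..<x (Suc n)}" by (rule Linf_space_element[OF \<delta> assms])
  show "AE y in lborel. y \<in> {x n<..<x (Suc n)} \<longrightarrow> \<bar>\<delta> y\<bar> \<le> B"
    "AE y in lborel. y \<in> {x n<..<x (Suc n)} \<longrightarrow> 0 \<le> \<delta> y"
    using \<delta>B by (rule eventually_mono; use open_element_subset[OF assms] in blast)+
qed

lemma fe_subsets: "Q_space k N x \<subseteq> fe_functions" "V_space k N x \<subseteq> fe_functions"
  unfolding Q_space_def V_space_def fe_functions_def H10_def H1_def x_0 x_N by auto

lemma ph_fe: "t \<in> {0..T} \<Longrightarrow> ph t \<in> pw_poly k N x" "t \<in> {0..T} \<Longrightarrow> continuous_on {xL..xR} (ph t)"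
  and mh_fe: "t \<in> {0..T} \<Longrightarrow> mh t \<in> pw_poly k N x" "t \<in> {0..T} \<Longrightarrow> continuous_on {xL..xR} (mh t)"
  and ph_boundary: "t \<in> {0..T} \<Longrightarrow> ph t xL = 0" "t \<in> {0..T} \<Longrightarrow> ph t xR = 0"
  using ph mh unfolding H1_time_def Q_space_def V_space_def H10_def H1_def x_0 x_N by auto

lemma K0: "0 \<le> K"
  using smooth_arrayD(4)[OF Dp, of 0 0 0 xL] T xL_less_xR by simp

text \<open>The difference of the discrete solution and the interpolant of the exact one, on each element a
  polynomial; likewise \<open>err_m\<close>.\<close>

definition err_p :: "real \<Rightarrow> nat \<Rightarrow> real poly" where
  "err_p t n = piece (ph t) n - ipol n (Dp 0 0 t (x n)) (Dp 0 1 t)"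

definition err_m :: "real \<Rightarrow> nat \<Rightarrow> real poly" where
  "err_m t n = piece (mh t) n - ipol n (Dm 0 0 t (x n)) (Dm 0 1 t)"

lemma degree_err:
  assumes "t \<in> {0..T}" "n < N"
  shows "degree (err_p t n) \<le> k" "degree (err_m t n) \<le> k"
  unfolding err_p_def err_m_def
  by (intro degree_diff_le piece_open(1) ph_fe mh_fe element.degree_interpolant element assms)+

lemma coef_poly_diff:
  assumes "n < N"
  shows "cf n (poly (p - q)) i = cf n (poly p) i - cf n (poly q) i"
  using L2_inner_poly_diff by (simp add: element.coef_def[OF element[OF assms]])

lemma coef_err:
  assumes "t \<in> {0..T}" "n < N"
  shows "cf n (poly (err_p t n)) i = cf n (ph t) i - cf n (poly (ipol n (Dp 0 0 t (x n)) (Dp 0 1 t))) i"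
    and "cf n (poly (err_m t n)) i = cf n (mh t) i - cf n (poly (ipol n (Dm 0 0 t (x n)) (Dm 0 1 t))) i"
  unfolding err_p_def err_m_def coef_poly_diff[OF assms(2)]
    coef_piece[OF ph_fe(1)[OF assms(1)] assms(2)] coef_piece[OF mh_fe(1)[OF assms(1)] assms(2)] by simp_all

lemma coef_pderiv_err:
  assumes "t \<in> {0..T}" "n < N" "i < k"
  shows "cf n (poly (pderiv (err_p t n))) i = cf n (poly (pderiv (piece (ph t) n))) i - cf n (Dp 0 1 t) i"
    and "cf n (poly (pderiv (err_m t n))) i = cf n (poly (pderiv (piece (mh t) n))) i - cf n (Dm 0 1 t) i"
  unfolding err_p_def err_m_def pderiv_diff coef_poly_diff[OF assms(2)]
    element.pderiv_interpolant[OF element[OF assms(2)]] element.coef_proj[OF element[OF assms(2)] assms(3)] by simp_all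

lemma err_nodes:
  assumes t: "t \<in> {0..T}" and n: "n < N"
  shows "poly (err_p t n) (x n) = ph t (x n) - Dp 0 0 t (x n)"
    and "poly (err_p t n) (x (Suc n)) = ph t (x (Suc n)) - Dp 0 0 t (x (Suc n))"
    and "poly (err_m t n) (x n) = mh t (x n) - Dm 0 0 t (x n)"
    and "poly (err_m t n) (x (Suc n)) = mh t (x (Suc n)) - Dm 0 0 t (x (Suc n))"
proof -
  have in_el: "x n \<in> {x n..x (Suc n)}" "x (Suc n) \<in> {x n..x (Suc n)}" using x_step[OF n] by auto
  have right: "poly (ipol n (D 0 0 t (x n)) (D 0 1 t)) (x (Suc n)) = D 0 0 t (x (Suc n))"
    if D: "smooth_array (k + 3) T xL xR D K" for D
  proof (rule element.poly_interpolant_right[OF element[OF n]])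
    show "(D 0 0 t has_real_derivative D 0 1 t y) (at y within {x n..x (Suc n)})" if "y \<in> {x n..x (Suc n)}" for y
      using has_field_derivative_subset[OF smooth_arrayD(2)[OF D _ t] element_subset[OF n], of 0 0 y]
        that element_subset[OF n] by auto
    show "continuous_on {x n..x (Suc n)} (D 0 1 t)"
      by (rule smooth_array_element_continuous[OF D _ t n]) simp
  qed
  note left = element.poly_interpolant_left[OF element[OF n]]
  show "poly (err_p t n) (x n) = ph t (x n) - Dp 0 0 t (x n)"
    "poly (err_p t n) (x (Suc n)) = ph t (x (Suc n)) - Dp 0 0 t (x (Suc n))"
    "poly (err_m t n) (x n) = mh t (x n) - Dm 0 0 t (x n)"
    "poly (err_m t n) (x (Suc n)) = mh t (x (Suc n)) - Dm 0 0 t (x (Suc n))"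
    unfolding err_p_def err_m_def poly_diff left right[OF Dp] right[OF Dm]
      piece_eq[OF ph_fe[OF t] n in_el(1)] piece_eq[OF ph_fe[OF t] n in_el(2)]
      piece_eq[OF mh_fe[OF t] n in_el(1)] piece_eq[OF mh_fe[OF t] n in_el(2)] by simp_all
qed

text \<open>The derivative of the interpolation error in space has no moments, since the derivative of the
  interpolant is the projection. Only the interpolation error of the time derivative remains as a residual.\<close>

lemma coef_p_has_derivative:
  assumes t: "t \<in> {0..T}" and n: "n < N" and i: "i < k"
  shows "((\<lambda>t. cf n (poly (err_p t n)) i) has_real_derivative
    (a * ires n (\<lambda>j. Dp 1 j t) i - cf n (poly (pderiv (err_m t n))) i) / a) (at t within {0..T})"
proof -
  define g where "g t = cf n (Dp 1 0 t) i + (cf n (Dm 0 1 t) i - cf n (poly (pderiv (piece (mh t) n))) i) / a" for t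
  have cg: "continuous_on {0..T} g"
    unfolding g_def[abs_def] using ab
    by (intro continuous_on_add continuous_on_divide continuous_on_diff continuous_on_const
        coef_smooth_continuous[OF Dp _ n] coef_smooth_continuous[OF Dm _ n]
        discrete_coef_continuous(2)[OF mh fe_subsets(2) n]) auto
  have "((\<lambda>t. cf n (ph t) i) has_real_derivative g t) (at t within {0..T})"
  proof (rule discrete_coef_has_derivative[OF ph fe_subsets(1) n T cg _ t])
    show "AE t in lborel. t \<in> {0<..<T} \<longrightarrow> cf n (ph' t) i = g t"
      using eq_p[OF n i] by (rule eventually_mono) (use ab in \<open>auto simp: g_def field_simps\<close>)
  qed
  then have "((\<lambda>t. cf n (ph t) i - cf n (poly (ipol n (Dp 0 0 t (x n)) (Dp 0 1 t))) i) has_real_derivative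
     g t - cf n (poly (ipol n (Dp 1 0 t (x n)) (Dp 1 1 t))) i) (at t within {0..T})"
    by (rule DERIV_diff[OF _ interpolant_has_derivative[OF Dp t n]])
  then have "((\<lambda>t. cf n (poly (err_p t n)) i) has_real_derivative
     g t - cf n (poly (ipol n (Dp 1 0 t (x n)) (Dp 1 1 t))) i) (at t within {0..T})"
    by (rule has_field_derivative_transform_within[OF _ zero_less_one t]) (simp add: coef_err[OF _ n])
  moreover have "g t - cf n (poly (ipol n (Dp 1 0 t (x n)) (Dp 1 1 t))) i
     = (a * ires n (\<lambda>j. Dp 1 j t) i - cf n (poly (pderiv (err_m t n))) i) / a"
    unfolding coef_pderiv_err(2)[OF t n i] element.interp_residual_def[OF element[OF n]] g_def
    using ab by (simp add: field_simps)
  ultimately show ?thesis by simp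
qed

text \<open>The weight is only bounded, so continuity comes from the Lipschitz bound in time of the second
  factor.\<close>

lemma weighted_coef_continuous:
  assumes n: "n < N" and i: "i < k"
  shows "continuous_on {0..T} (\<lambda>t. cf n (\<lambda>y. \<delta> y * Dm 0 0 t y) i)"
proof -
  interpret e: element "x n" "x (Suc n)" k "basis n" by (rule element[OF n])
  let ?h = "x (Suc n) - x n"
  have h: "0 < ?h" using x_step[OF n] by simp
  have "dist (cf n (\<lambda>y. \<delta> y * Dm 0 0 t y) i) (cf n (\<lambda>y. \<delta> y * Dm 0 0 s y) i) \<le> (\<bar>B\<bar> * K * sqrt ?h) * dist t s"
    if ts: "t \<in> {0..T}" "s \<in> {0..T}" for t s
  proof -
    have c: "continuous_on {x n..x (Suc n)} (Dm 0 0 r)" if "r \<in> {0..T}" for r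
      by (rule smooth_array_element_continuous[OF Dm _ that n]) simp
    note L = L2_spaceI_continuous[OF c[OF ts(1)]] L2_spaceI_continuous[OF c[OF ts(2)]]
    let ?u = "\<lambda>y. Dm 0 0 t y - Dm 0 0 s y"
    have "cf n (\<lambda>y. \<delta> y * Dm 0 0 t y) i - cf n (\<lambda>y. \<delta> y * Dm 0 0 s y) i = cf n (\<lambda>y. \<delta> y * ?u y) i"
      unfolding right_diff_distrib
      by (rule e.coef_diff[symmetric]) (intro Linf_mult_L2_space \<delta>_element n L)+
    moreover have "(cf n (\<lambda>y. \<delta> y * ?u y) i)\<^sup>2 \<le> (\<Sum>i<k. (cf n (\<lambda>y. \<delta> y * ?u y) i)\<^sup>2)"
      using i by (intro member_le_sum[of i "{..<k}" "\<lambda>i. (cf n (\<lambda>y. \<delta> y * ?u y) i)\<^sup>2"]) auto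
    moreover have "\<dots> \<le> B\<^sup>2 * L2_inner (x n) (x (Suc n)) ?u ?u"
      by (intro e.weighted_coef_le \<delta>_element n L2_space_diff L)
    moreover have "\<dots> \<le> B\<^sup>2 * ((K * \<bar>t - s\<bar>)\<^sup>2 * ?h)"
      using smooth_array_lipschitz[OF Dm _ ts, of 0 0] element_subset[OF n]
      by (intro mult_left_mono e.inner_self_bound continuous_on_diff c ts) auto
    moreover have "\<dots> = (\<bar>B\<bar> * K * sqrt ?h * \<bar>t - s\<bar>)\<^sup>2"
      using h by (simp add: power_mult_distrib mult_ac)
    ultimately have "(cf n (\<lambda>y. \<delta> y * Dm 0 0 t y) i - cf n (\<lambda>y. \<delta> y * Dm 0 0 s y) i)\<^sup>2 \<le> (\<bar>B\<bar> * K * sqrt ?h * \<bar>t - s\<bar>)\<^sup>2"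
      by simp
    moreover have "0 \<le> \<bar>B\<bar> * K * sqrt ?h * \<bar>t - s\<bar>" using K0 h by simp
    ultimately show ?thesis unfolding dist_real_def using abs_le_square_iff[of _ "\<bar>B\<bar> * K * sqrt ?h * \<bar>t - s\<bar>"] by simp
  qed
  then have "(\<bar>B\<bar> * K * sqrt ?h)-lipschitz_on {0..T} (\<lambda>t. cf n (\<lambda>y. \<delta> y * Dm 0 0 t y) i)"
    using K0 h by (intro lipschitz_onI) auto
  then show ?thesis by (rule lipschitz_on_continuous_on)
qed

lemma coef_m_has_derivative:
  assumes t: "t \<in> {0..T}" and n: "n < N" and i: "i < k"
  shows "((\<lambda>t. cf n (poly (err_m t n)) i) has_real_derivative
    ((b * ires n (\<lambda>j. Dm 1 j t) i + wres n \<delta> (\<lambda>j. Dm 0 j t) i) - cf n (poly (pderiv (err_p t n))) i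
      - (\<Sum>l<k. wmat n \<delta> i l * cf n (poly (err_m t n)) l)) / b) (at t within {0..T})"
proof -
  define g where "g t = cf n (Dm 1 0 t) i + (cf n (Dp 0 1 t) i - cf n (poly (pderiv (piece (ph t) n))) i
    + cf n (\<lambda>y. \<delta> y * Dm 0 0 t y) i - (\<Sum>l<k. wmat n \<delta> i l * cf n (mh t) l)) / b" for t
  have cg: "continuous_on {0..T} g"
    unfolding g_def[abs_def] using ab
    by (intro continuous_on_add continuous_on_divide continuous_on_diff continuous_on_const continuous_on_sum continuous_on_mult
        coef_smooth_continuous[OF Dp _ n] coef_smooth_continuous[OF Dm _ n] weighted_coef_continuous[OF n i]
        discrete_coef_continuous(2)[OF ph fe_subsets(1) n] discrete_coef_continuous(1)[OF mh fe_subsets(2) n]) auto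
  have "((\<lambda>t. cf n (mh t) i) has_real_derivative g t) (at t within {0..T})"
  proof (rule discrete_coef_has_derivative[OF mh fe_subsets(2) n T cg _ t])
    show "AE t in lborel. t \<in> {0<..<T} \<longrightarrow> cf n (mh' t) i = g t"
      using eq_m[OF n i] by (rule eventually_mono) (use ab in \<open>auto simp: g_def field_simps\<close>)
  qed
  then have "((\<lambda>t. cf n (mh t) i - cf n (poly (ipol n (Dm 0 0 t (x n)) (Dm 0 1 t))) i) has_real_derivative
     g t - cf n (poly (ipol n (Dm 1 0 t (x n)) (Dm 1 1 t))) i) (at t within {0..T})"
    by (rule DERIV_diff[OF _ interpolant_has_derivative[OF Dm t n]])
  then have "((\<lambda>t. cf n (poly (err_m t n)) i) has_real_derivative
     g t - cf n (poly (ipol n (Dm 1 0 t (x n)) (Dm 1 1 t))) i) (at t within {0..T})"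
    by (rule has_field_derivative_transform_within[OF _ zero_less_one t]) (simp add: coef_err[OF _ n])
  moreover have "g t - cf n (poly (ipol n (Dm 1 0 t (x n)) (Dm 1 1 t))) i
     = ((b * ires n (\<lambda>j. Dm 1 j t) i + wres n \<delta> (\<lambda>j. Dm 0 j t) i) - cf n (poly (pderiv (err_p t n))) i
      - (\<Sum>l<k. wmat n \<delta> i l * cf n (poly (err_m t n)) l)) / b"
  proof -
    have "continuous_on {x n..x (Suc n)} (Dm 0 0 t)"
      by (rule smooth_array_element_continuous[OF Dm _ t n]) simp
    then have "wres n \<delta> (\<lambda>j. Dm 0 j t) i = cf n (\<lambda>y. \<delta> y * Dm 0 0 t y) i
       - (\<Sum>l<k. wmat n \<delta> i l * cf n (poly (ipol n (Dm 0 0 t (x n)) (Dm 0 1 t))) l)"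
      by (rule element.weight_residual_eq[OF element[OF n] _ \<delta>_element(1)[OF n]])
    moreover have "(\<Sum>l<k. wmat n \<delta> i l * cf n (poly (err_m t n)) l) = (\<Sum>l<k. wmat n \<delta> i l * cf n (mh t) l)
       - (\<Sum>l<k. wmat n \<delta> i l * cf n (poly (ipol n (Dm 0 0 t (x n)) (Dm 0 1 t))) l)"
      by (simp add: coef_err(2)[OF t n] right_diff_distrib sum_subtractf)
    ultimately show ?thesis
      unfolding coef_pderiv_err(1)[OF t n i] element.interp_residual_def[OF element[OF n]] g_def
      using ab by (simp add: field_simps)
  qed
  ultimately show ?thesis by simp
qed

text \<open>Chosen such that one number bounds the residuals of both equations.\<close>

definition residual_const :: real where
  "residual_const = sqrt ((a\<^sup>2 + 2 * b\<^sup>2 + 4 * (M\<^sup>2 + B\<^sup>2)) * (xR - xL))"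

lemma residual_bounds:
  assumes U: "\<And>n. n < N \<Longrightarrow> family n \<kappa> U" and V: "\<And>n. n < N \<Longrightarrow> family n \<kappa> V"
  shows "(\<Sum>n<N. \<Sum>i<k. (a * ires n U i)\<^sup>2) \<le> (\<kappa> * (mesh_size N x ^ (k + 1) * residual_const))\<^sup>2"
    and "(\<Sum>n<N. \<Sum>i<k. (b * ires n U i + wres n \<delta> V i)\<^sup>2) \<le> (\<kappa> * (mesh_size N x ^ (k + 1) * residual_const))\<^sup>2"
proof -
  let ?R = "(\<kappa> * mesh_size N x ^ (k + 1))\<^sup>2 * (xR - xL)"
  have R0: "0 \<le> ?R" using xL_less_xR by simp
  have eq: "(\<kappa> * (mesh_size N x ^ (k + 1) * residual_const))\<^sup>2 = (a\<^sup>2 + 2 * b\<^sup>2 + 4 * (M\<^sup>2 + B\<^sup>2)) * ?R"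
    using xL_less_xR unfolding residual_const_def power_mult_distrib by (simp add: mult_ac)
  have "(\<Sum>n<N. \<Sum>i<k. (a * ires n U i)\<^sup>2) = a\<^sup>2 * (\<Sum>n<N. \<Sum>i<k. (ires n U i)\<^sup>2)"
    by (simp only: power_mult_distrib sum_distrib_left)
  also have "\<dots> \<le> a\<^sup>2 * ?R" by (intro mult_left_mono sum_interp_residual_le U) auto
  also have "\<dots> \<le> (a\<^sup>2 + 2 * b\<^sup>2 + 4 * (M\<^sup>2 + B\<^sup>2)) * ?R" using R0 by (intro mult_right_mono) auto
  finally show "(\<Sum>n<N. \<Sum>i<k. (a * ires n U i)\<^sup>2) \<le> (\<kappa> * (mesh_size N x ^ (k + 1) * residual_const))\<^sup>2"
    by (simp only: eq)
  have "(\<Sum>n<N. \<Sum>i<k. (b * ires n U i + wres n \<delta> V i)\<^sup>2) \<le> (\<Sum>n<N. \<Sum>i<k. 2 * b\<^sup>2 * (ires n U i)\<^sup>2 + 2 * (wres n \<delta> V i)\<^sup>2)"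
  proof (intro sum_mono)
    fix n i
    have "0 \<le> (b * ires n U i - wres n \<delta> V i)\<^sup>2" by simp
    then show "(b * ires n U i + wres n \<delta> V i)\<^sup>2 \<le> 2 * b\<^sup>2 * (ires n U i)\<^sup>2 + 2 * (wres n \<delta> V i)\<^sup>2"
      by (simp only: power2_sum power2_diff power_mult_distrib)
  qed
  also have "\<dots> = 2 * b\<^sup>2 * (\<Sum>n<N. \<Sum>i<k. (ires n U i)\<^sup>2) + 2 * (\<Sum>n<N. \<Sum>i<k. (wres n \<delta> V i)\<^sup>2)"
    by (simp only: sum.distrib sum_distrib_left)
  also have "\<dots> \<le> 2 * b\<^sup>2 * ?R + 2 * (2 * (M\<^sup>2 + B\<^sup>2) * ?R)"
    by (intro add_mono mult_left_mono sum_interp_residual_le sum_weight_residual_le U V \<delta>M M0 \<delta>_element) auto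
  also have "\<dots> \<le> (a\<^sup>2 + 2 * b\<^sup>2 + 4 * (M\<^sup>2 + B\<^sup>2)) * ?R"
  proof -
    have "2 * b\<^sup>2 * ?R + 2 * (2 * (M\<^sup>2 + B\<^sup>2) * ?R) = (2 * b\<^sup>2 + 4 * (M\<^sup>2 + B\<^sup>2)) * ?R" by (simp only: distrib_right)
    also have "\<dots> \<le> (a\<^sup>2 + 2 * b\<^sup>2 + 4 * (M\<^sup>2 + B\<^sup>2)) * ?R" using R0 by (intro mult_right_mono) auto
    finally show ?thesis .
  qed
  finally show "(\<Sum>n<N. \<Sum>i<k. (b * ires n U i + wres n \<delta> V i)\<^sup>2) \<le> (\<kappa> * (mesh_size N x ^ (k + 1) * residual_const))\<^sup>2"
    by (simp only: eq)
qed

lemma sum_pairs: "(\<Sum>j\<in>{..<N} \<times> {..<k}. h (fst j) (snd j)) = (\<Sum>n<N. \<Sum>i<k. h n i)"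
  by (simp add: sum.cartesian_product case_prod_beta)

lemma moments_bound:
  assumes t: "t \<in> {0..T}"
  shows "(\<Sum>n<N. \<Sum>i<k. (cf n (poly (err_p t n)) i)\<^sup>2) + (\<Sum>n<N. \<Sum>i<k. (cf n (poly (err_m t n)) i)\<^sup>2)
      + (\<Sum>n<N. \<Sum>i<k. (cf n (poly (pderiv (err_m t n))) i)\<^sup>2) + (\<Sum>n<N. \<Sum>i<k. (cf n (poly (pderiv (err_p t n))) i)\<^sup>2)
    \<le> stability_const a b B T * (K * (mesh_size N x ^ (k + 1) * residual_const))\<^sup>2"
proof -
  define J where "J = {..<N} \<times> {..<k}"
  have J: "fst j < N" "snd j < k" if "j \<in> J" for j using that by (auto simp: J_def)
  note sumJ = sum_pairs[folded J_def]
  define W where "W u j = (\<Sum>l<k. wmat (fst j) \<delta> (snd j) l * u (fst j, l))" for u :: "nat \<times> nat \<Rightarrow> real" and j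
  let ?z = "\<lambda>t j. cf (fst j) (poly (err_p t (fst j))) (snd j)"
  let ?y = "\<lambda>t j. cf (fst j) (poly (err_m t (fst j))) (snd j)"
  let ?\<alpha> = "\<lambda>t j. cf (fst j) (poly (pderiv (err_p t (fst j)))) (snd j)"
  let ?\<beta> = "\<lambda>t j. cf (fst j) (poly (pderiv (err_m t (fst j)))) (snd j)"
  let ?\<rho> = "\<lambda>t j. a * ires (fst j) (\<lambda>l. Dp 1 l t) (snd j)"
  let ?\<sigma> = "\<lambda>t j. b * ires (fst j) (\<lambda>l. Dm 1 l t) (snd j) + wres (fst j) \<delta> (\<lambda>l. Dm 0 l t) (snd j)"
  let ?G = "K * (mesh_size N x ^ (k + 1) * residual_const)"
  have cont: "continuous_on {x n..x (Suc n)} (D s l r)"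
    if "smooth_array (k + 3) T xL xR D K" "s \<le> 1" "l \<le> 1" "r \<in> {0..T}" "n < N" for D s l r n
    using that k1 by (intro smooth_array_element_continuous[OF that(1)]) auto
  have "(\<Sum>j\<in>J. (?z t j)\<^sup>2) + (\<Sum>j\<in>J. (?y t j)\<^sup>2) + (\<Sum>j\<in>J. (?\<beta> t j)\<^sup>2) + (\<Sum>j\<in>J. (?\<alpha> t j)\<^sup>2)
    \<le> stability_const a b B T * ?G\<^sup>2"
  proof (rule stability[OF ab T, where W=W and z="?z" and y="?y" and \<alpha>="?\<alpha>" and \<beta>="?\<beta>" and \<rho>="?\<rho>" and \<sigma>="?\<sigma>"])
    show "0 \<le> ?G"
      using K0 mesh_size_nonneg xL_less_xR by (simp add: residual_const_def)
    show "0 \<le> (\<Sum>j\<in>J. W u j * u j)" for u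
    proof -
      have "(\<Sum>j\<in>J. W u j * u j) = (\<Sum>n<N. \<Sum>i<k. (\<Sum>l<k. wmat n \<delta> i l * u (n, l)) * u (n, i))"
        using sumJ[of "\<lambda>n i. (\<Sum>l<k. wmat n \<delta> i l * u (n, l)) * u (n, i)"] by (simp add: W_def)
      also have "0 \<le> \<dots>"
        by (intro sum_nonneg element.weight_matrix_nonneg element \<delta>_element) auto
      finally show ?thesis .
    qed
    show "W (\<lambda>i. u i - v i) j = W u j - W v j" for u v j
      by (simp add: W_def right_diff_distrib sum_subtractf)
    show "(\<Sum>j\<in>J. (W u j)\<^sup>2) \<le> B\<^sup>2 * (\<Sum>j\<in>J. (u j)\<^sup>2)" for u
    proof -
      have "(\<Sum>j\<in>J. (W u j)\<^sup>2) = (\<Sum>n<N. \<Sum>i<k. (\<Sum>l<k. wmat n \<delta> i l * u (n, l))\<^sup>2)"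
        using sumJ[of "\<lambda>n i. (\<Sum>l<k. wmat n \<delta> i l * u (n, l))\<^sup>2"] by (simp add: W_def)
      also have "\<dots> \<le> (\<Sum>n<N. B\<^sup>2 * (\<Sum>i<k. (u (n, i))\<^sup>2))"
        by (intro sum_mono element.weight_matrix_bound element \<delta>_element) auto
      also have "\<dots> = B\<^sup>2 * (\<Sum>j\<in>J. (u j)\<^sup>2)"
        using sumJ[of "\<lambda>n i. (u (n, i))\<^sup>2"] by (simp add: sum_distrib_left)
      finally show ?thesis .
    qed
    fix s assume s: "s \<in> {0..T}"
    show "((\<lambda>s. ?z s j) has_real_derivative (?\<rho> s j - ?\<beta> s j) / a) (at s within {0..T})" if "j \<in> J" for j
      by (rule coef_p_has_derivative[OF s J[OF that]])
    show "((\<lambda>s. ?y s j) has_real_derivative (?\<sigma> s j - ?\<alpha> s j - W (?y s) j) / b) (at s within {0..T})" if "j \<in> J" for j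
      using coef_m_has_derivative[OF s J[OF that]] by (simp add: W_def)
    show "(\<Sum>j\<in>J. ?z s j * ?\<beta> s j + ?y s j * ?\<alpha> s j) = 0"
      unfolding sumJ[of "\<lambda>n i. cf n (poly (err_p s n)) i * cf n (poly (pderiv (err_m s n))) i
          + cf n (poly (err_m s n)) i * cf n (poly (pderiv (err_p s n))) i"]
      by (rule skew_symmetry[where E="\<lambda>n. ph s (x n) - Dp 0 0 s (x n)" and F="\<lambda>n. mh s (x n) - Dm 0 0 s (x n)"])
         (simp_all add: degree_err[OF s] err_nodes[OF s] x_0 x_N ph_boundary[OF s] boundary[OF s])
    show "(\<Sum>j\<in>J. (?\<rho> s j)\<^sup>2) \<le> ?G\<^sup>2"
      unfolding sumJ[of "\<lambda>n i. (a * ires n (\<lambda>l. Dp 1 l s) i)\<^sup>2"]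
      by (intro residual_bounds(1)[where V="\<lambda>l. Dm 0 l s"] smooth_array_family[OF Dp _ s] smooth_array_family[OF Dm _ s]) auto
    show "(\<Sum>j\<in>J. (?\<sigma> s j)\<^sup>2) \<le> ?G\<^sup>2"
      unfolding sumJ[of "\<lambda>n i. (b * ires n (\<lambda>l. Dm 1 l s) i + wres n \<delta> (\<lambda>l. Dm 0 l s) i)\<^sup>2"]
      by (intro residual_bounds(2) smooth_array_family[OF Dm _ s]) auto
    fix t assume t: "t \<in> {0..T}"
    show "(\<Sum>j\<in>J. (?z t j - ?z s j) * (?\<beta> t j - ?\<beta> s j) + (?y t j - ?y s j) * (?\<alpha> t j - ?\<alpha> s j)) = 0"
      unfolding sumJ[of "\<lambda>n i. (cf n (poly (err_p t n)) i - cf n (poly (err_p s n)) i) * (cf n (poly (pderiv (err_m t n))) i - cf n (poly (pderiv (err_m s n))) i)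
          + (cf n (poly (err_m t n)) i - cf n (poly (err_m s n)) i) * (cf n (poly (pderiv (err_p t n))) i - cf n (poly (pderiv (err_p s n))) i)"]
    proof -
      have "(\<Sum>n<N. \<Sum>i<k. cf n (poly (err_p t n - err_p s n)) i * cf n (poly (pderiv (err_m t n - err_m s n))) i
          + cf n (poly (err_m t n - err_m s n)) i * cf n (poly (pderiv (err_p t n - err_p s n))) i) = 0"
        by (rule skew_symmetry[where E="\<lambda>n. (ph t (x n) - Dp 0 0 t (x n)) - (ph s (x n) - Dp 0 0 s (x n))"
             and F="\<lambda>n. (mh t (x n) - Dm 0 0 t (x n)) - (mh s (x n) - Dm 0 0 s (x n))"])
           (simp_all add: degree_err[OF s] degree_err[OF t] err_nodes[OF s] err_nodes[OF t] x_0 x_N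
             ph_boundary[OF s] ph_boundary[OF t] boundary[OF s] boundary[OF t] degree_diff_le)
      then show "(\<Sum>n<N. \<Sum>i<k. (cf n (poly (err_p t n)) i - cf n (poly (err_p s n)) i) * (cf n (poly (pderiv (err_m t n))) i - cf n (poly (pderiv (err_m s n))) i)
          + (cf n (poly (err_m t n)) i - cf n (poly (err_m s n)) i) * (cf n (poly (pderiv (err_p t n))) i - cf n (poly (pderiv (err_p s n))) i)) = 0"
        by (simp add: pderiv_diff coef_poly_diff)
    qed
    have dp: "?\<rho> t j - ?\<rho> s j = a * ires (fst j) (\<lambda>l y. Dp 1 l t y - Dp 1 l s y) (snd j)" if "j \<in> J" for j
      using element.interp_residual_diff[OF element[OF J(1)[OF that]], of "\<lambda>l. Dp 1 l t" "\<lambda>l. Dp 1 l s"]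
        cont[OF Dp _ _ t J(1)[OF that]] cont[OF Dp _ _ s J(1)[OF that]] by (simp add: right_diff_distrib)
    have dm: "?\<sigma> t j - ?\<sigma> s j = b * ires (fst j) (\<lambda>l y. Dm 1 l t y - Dm 1 l s y) (snd j)
        + wres (fst j) \<delta> (\<lambda>l y. Dm 0 l t y - Dm 0 l s y) (snd j)" if "j \<in> J" for j
      using element.interp_residual_diff[OF element[OF J(1)[OF that]], of "\<lambda>l. Dm 1 l t" "\<lambda>l. Dm 1 l s"]
        element.weight_residual_diff[OF element[OF J(1)[OF that]] _ _ \<delta>_element(1)[OF J(1)[OF that]], of "\<lambda>l. Dm 0 l t" "\<lambda>l. Dm 0 l s"]
        cont[OF Dm _ _ t J(1)[OF that]] cont[OF Dm _ _ s J(1)[OF that]] by (simp add: right_diff_distrib)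
    have Gd: "(?G * \<bar>t - s\<bar>)\<^sup>2 = (K * \<bar>t - s\<bar> * (mesh_size N x ^ (k + 1) * residual_const))\<^sup>2" by (simp only: mult_ac)
    have "(\<Sum>j\<in>J. (?\<rho> t j - ?\<rho> s j)\<^sup>2) = (\<Sum>j\<in>J. (a * ires (fst j) (\<lambda>l y. Dp 1 l t y - Dp 1 l s y) (snd j))\<^sup>2)"
      by (intro sum.cong refl) (simp only: dp)
    also have "\<dots> \<le> (?G * \<bar>t - s\<bar>)\<^sup>2"
      unfolding sumJ[of "\<lambda>n i. (a * ires n (\<lambda>l y. Dp 1 l t y - Dp 1 l s y) i)\<^sup>2"] Gd
      by (intro residual_bounds(1)[where V="\<lambda>l y. Dm 0 l t y - Dm 0 l s y"] smooth_array_family_diff[OF Dp _ t s]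
          smooth_array_family_diff[OF Dm _ t s]) auto
    finally show "(\<Sum>j\<in>J. (?\<rho> t j - ?\<rho> s j)\<^sup>2) \<le> (?G * \<bar>t - s\<bar>)\<^sup>2" .
    have "(\<Sum>j\<in>J. (?\<sigma> t j - ?\<sigma> s j)\<^sup>2) = (\<Sum>j\<in>J. (b * ires (fst j) (\<lambda>l y. Dm 1 l t y - Dm 1 l s y) (snd j)
        + wres (fst j) \<delta> (\<lambda>l y. Dm 0 l t y - Dm 0 l s y) (snd j))\<^sup>2)"
      by (intro sum.cong refl) (simp only: dm)
    also have "\<dots> \<le> (?G * \<bar>t - s\<bar>)\<^sup>2"
      unfolding sumJ[of "\<lambda>n i. (b * ires n (\<lambda>l y. Dm 1 l t y - Dm 1 l s y) i + wres n \<delta> (\<lambda>l y. Dm 0 l t y - Dm 0 l s y) i)\<^sup>2"] Gd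
      by (intro residual_bounds(2) smooth_array_family_diff[OF Dm _ t s]) auto
    finally show "(\<Sum>j\<in>J. (?\<sigma> t j - ?\<sigma> s j)\<^sup>2) \<le> (?G * \<bar>t - s\<bar>)\<^sup>2" .
  next
    have T0: "0 \<in> {0..T}" using T by simp
    show "?z 0 j = 0" if "j \<in> J" for j
      unfolding coef_err(1)[OF T0 J(1)[OF that]]
      using element.coef_cong[OF element[OF J(1)[OF that]], of "ph 0" _ "snd j"] init_p[OF J(1)[OF that]] by simp
    show "?y 0 j = 0" if "j \<in> J" for j
      unfolding coef_err(2)[OF T0 J(1)[OF that]]
      using element.coef_cong[OF element[OF J(1)[OF that]], of "mh 0" _ "snd j"] init_m[OF J(1)[OF that]] by simp
  qed (rule t)
  then show ?thesis
    unfolding sumJ[of "\<lambda>n i. (cf n (poly (err_p t n)) i)\<^sup>2"] sumJ[of "\<lambda>n i. (cf n (poly (err_m t n)) i)\<^sup>2"]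
      sumJ[of "\<lambda>n i. (cf n (poly (pderiv (err_p t n))) i)\<^sup>2"] sumJ[of "\<lambda>n i. (cf n (poly (pderiv (err_m t n))) i)\<^sup>2"] .
qed

text \<open>Interpolation error plus discrete error; the latter is measured by its moments and those of its derivative.\<close>

lemma error_split:
  assumes t: "t \<in> {0..T}" and D: "smooth_array (k + 3) T xL xR D K"
    and v: "v \<in> pw_poly k N x" "continuous_on {xL..xR} v"
    and e: "\<And>n. n < N \<Longrightarrow> e n = piece v n - ipol n (D 0 0 t (x n)) (D 0 1 t)"
  shows "L2_inner xL xR (\<lambda>y. D 0 0 t y - v y) (\<lambda>y. D 0 0 t y - v y)
    \<le> 2 * ((K * mesh_size N x ^ (k + 1))\<^sup>2 * (xR - xL))
      + 2 * ((\<Sum>n<N. \<Sum>i<k. (cf n (poly (e n)) i)\<^sup>2) + (xR - xL)\<^sup>2 * (\<Sum>n<N. \<Sum>i<k. (cf n (poly (pderiv (e n))) i)\<^sup>2))"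
proof -
  let ?f = "\<lambda>y. D 0 0 t y - v y"
  have cD: "continuous_on {xL..xR} (D 0 0 t)" by (rule smooth_arrayD(5)[OF D _ t]) simp
  have fL: "?f \<in> L2_space {xL<..<xR}" by (intro L2_spaceI_continuous continuous_on_diff cD v)
  have "L2_inner (x n) (x (Suc n)) ?f ?f \<le> 2 * ((K * mesh_size N x ^ (k + 1))\<^sup>2 * (x (Suc n) - x n))
     + 2 * ((\<Sum>i<k. (cf n (poly (e n)) i)\<^sup>2) + (xR - xL)\<^sup>2 * (\<Sum>i<k. (cf n (poly (pderiv (e n))) i)\<^sup>2))" if n: "n < N" for n
  proof -
    interpret el: element "x n" "x (Suc n)" k "basis n" by (rule element[OF n])
    let ?I = "ipol n (D 0 0 t (x n)) (D 0 1 t)"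
    let ?u = "\<lambda>y. D 0 0 t y - poly ?I y"
    have cu: "continuous_on {x n..x (Suc n)} ?u"
      by (intro continuous_on_diff continuous_on_poly_fun continuous_on_subset[OF cD element_subset[OF n]])
    have "L2_inner (x n) (x (Suc n)) ?f ?f = L2_inner (x n) (x (Suc n)) (\<lambda>y. ?u y - poly (e n) y) (\<lambda>y. ?u y - poly (e n) y)"
      by (rule L2_inner_cong) (simp_all add: e[OF n] piece_open(2)[OF v(1) n])
    also have "\<dots> \<le> 2 * L2_inner (x n) (x (Suc n)) ?u ?u + 2 * L2_inner (x n) (x (Suc n)) (poly (e n)) (poly (e n))"
      by (rule el.inner_self_diff_le[OF cu continuous_on_poly_fun])
    also have "\<dots> \<le> 2 * ((K * mesh_size N x ^ (k + 1))\<^sup>2 * (x (Suc n) - x n))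
     + 2 * ((\<Sum>i<k. (cf n (poly (e n)) i)\<^sup>2) + (x (Suc n) - x n)\<^sup>2 * (\<Sum>i<k. (cf n (poly (pderiv (e n))) i)\<^sup>2))"
    proof (intro add_mono mult_left_mono)
      show "L2_inner (x n) (x (Suc n)) ?u ?u \<le> (K * mesh_size N x ^ (k + 1))\<^sup>2 * (x (Suc n) - x n)"
        using el.interpolant_L2_error[OF smooth_array_family[OF D _ t n, of 0] mesh_size_ge[OF n]] by simp
      have "degree (e n) \<le> k"
        unfolding e[OF n] by (intro degree_diff_le piece_open(1)[OF v(1) n] el.degree_interpolant)
      then show "L2_inner (x n) (x (Suc n)) (poly (e n)) (poly (e n))
        \<le> (\<Sum>i<k. (cf n (poly (e n)) i)\<^sup>2) + (x (Suc n) - x n)\<^sup>2 * (\<Sum>i<k. (cf n (poly (pderiv (e n))) i)\<^sup>2)"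
        by (rule el.inner_self_poly_le)
    qed auto
    also have "\<dots> \<le> 2 * ((K * mesh_size N x ^ (k + 1))\<^sup>2 * (x (Suc n) - x n))
     + 2 * ((\<Sum>i<k. (cf n (poly (e n)) i)\<^sup>2) + (xR - xL)\<^sup>2 * (\<Sum>i<k. (cf n (poly (pderiv (e n))) i)\<^sup>2))"
      using x_step[OF n] node_in[of n] node_in[of "Suc n"] n
      by (intro add_mono mult_left_mono mult_right_mono power_mono sum_nonneg) auto
    finally show ?thesis .
  qed
  then have "L2_inner xL xR ?f ?f \<le> (\<Sum>n<N. 2 * ((K * mesh_size N x ^ (k + 1))\<^sup>2 * (x (Suc n) - x n))
     + 2 * ((\<Sum>i<k. (cf n (poly (e n)) i)\<^sup>2) + (xR - xL)\<^sup>2 * (\<Sum>i<k. (cf n (poly (pderiv (e n))) i)\<^sup>2)))"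
    unfolding L2_inner_split[OF fL fL] by (intro sum_mono) auto
  also have "\<dots> = 2 * ((K * mesh_size N x ^ (k + 1))\<^sup>2 * (xR - xL))
      + 2 * ((\<Sum>n<N. \<Sum>i<k. (cf n (poly (e n)) i)\<^sup>2) + (xR - xL)\<^sup>2 * (\<Sum>n<N. \<Sum>i<k. (cf n (poly (pderiv (e n))) i)\<^sup>2))"
    by (simp only: sum.distrib sum_distrib_left[symmetric] sum_element_lengths)
  finally show ?thesis .
qed

end

text \<open>The first summand comes from the interpolation error, the second from the bound for the moments.\<close>

definition error_const :: "real \<Rightarrow> real \<Rightarrow> real \<Rightarrow> real \<Rightarrow> real \<Rightarrow> real \<Rightarrow> real \<Rightarrow> real" where
  "error_const a b B M T K \<omega> = 2 * K\<^sup>2 * \<omega>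
    + 2 * (1 + \<omega>\<^sup>2) * (stability_const a b B T * (K\<^sup>2 * ((a\<^sup>2 + 2 * b\<^sup>2 + 4 * (M\<^sup>2 + B\<^sup>2)) * \<omega>)))"

context semidiscrete_error
begin

lemma error_estimate:
  assumes t: "t \<in> {0..T}"
  shows "L2_inner xL xR (\<lambda>y. Dp 0 0 t y - ph t y) (\<lambda>y. Dp 0 0 t y - ph t y)
      \<le> error_const a b B M T K (xR - xL) * (mesh_size N x ^ (k + 1))\<^sup>2"
    and "L2_inner xL xR (\<lambda>y. Dm 0 0 t y - mh t y) (\<lambda>y. Dm 0 0 t y - mh t y)
      \<le> error_const a b B M T K (xR - xL) * (mesh_size N x ^ (k + 1))\<^sup>2"
proof -
  let ?S = "stability_const a b B T * (K * (mesh_size N x ^ (k + 1) * residual_const))\<^sup>2"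
  let ?\<omega> = "xR - xL"
  let ?R = "2 * ((K * mesh_size N x ^ (k + 1))\<^sup>2 * ?\<omega>)"
  have nn: "0 \<le> (\<Sum>n<N. \<Sum>i<k. (h n i)\<^sup>2)" for h :: "nat \<Rightarrow> nat \<Rightarrow> real" by (intro sum_nonneg) simp
  note mb = moments_bound[OF t]
  have comb: "Z + ?\<omega>\<^sup>2 * A \<le> (1 + ?\<omega>\<^sup>2) * ?S" if "Z \<le> ?S" "A \<le> ?S" for Z A :: real
    using add_mono[OF that(1) mult_left_mono[OF that(2), of "?\<omega>\<^sup>2"]] by (simp add: distrib_right)
  have rc: "residual_const\<^sup>2 = (a\<^sup>2 + 2 * b\<^sup>2 + 4 * (M\<^sup>2 + B\<^sup>2)) * ?\<omega>"
    using xL_less_xR by (simp add: residual_const_def)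
  have eq: "?R + 2 * ((1 + ?\<omega>\<^sup>2) * ?S) = error_const a b B M T K ?\<omega> * (mesh_size N x ^ (k + 1))\<^sup>2"
    unfolding error_const_def power_mult_distrib rc by (simp only: distrib_left distrib_right mult_ac)
  have "(\<Sum>n<N. \<Sum>i<k. (cf n (poly (err_p t n)) i)\<^sup>2) \<le> ?S" "(\<Sum>n<N. \<Sum>i<k. (cf n (poly (pderiv (err_p t n))) i)\<^sup>2) \<le> ?S"
    "(\<Sum>n<N. \<Sum>i<k. (cf n (poly (err_m t n)) i)\<^sup>2) \<le> ?S" "(\<Sum>n<N. \<Sum>i<k. (cf n (poly (pderiv (err_m t n))) i)\<^sup>2) \<le> ?S"
    using mb nn[of "\<lambda>n i. cf n (poly (err_p t n)) i"] nn[of "\<lambda>n i. cf n (poly (err_m t n)) i"]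
      nn[of "\<lambda>n i. cf n (poly (pderiv (err_p t n))) i"] nn[of "\<lambda>n i. cf n (poly (pderiv (err_m t n))) i"]
    by linarith+
  note parts = comb[OF this(1,2)] comb[OF this(3,4)]
  show "L2_inner xL xR (\<lambda>y. Dp 0 0 t y - ph t y) (\<lambda>y. Dp 0 0 t y - ph t y)
      \<le> error_const a b B M T K (xR - xL) * (mesh_size N x ^ (k + 1))\<^sup>2"
    unfolding eq[symmetric]
    by (rule order_trans[OF error_split[OF t Dp ph_fe[OF t] err_p_def] add_left_mono[OF mult_left_mono[OF parts(1)]]]) simp
  show "L2_inner xL xR (\<lambda>y. Dm 0 0 t y - mh t y) (\<lambda>y. Dm 0 0 t y - mh t y)
      \<le> error_const a b B M T K (xR - xL) * (mesh_size N x ^ (k + 1))\<^sup>2"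
    unfolding eq[symmetric]
    by (rule order_trans[OF error_split[OF t Dm mh_fe[OF t] err_m_def] add_left_mono[OF mult_left_mono[OF parts(2)]]]) simp
qed

end

context mesh
begin

text \<open>The norm is an infimum of essential bounds, so some essential bound lies below \<open>M + 1\<close>. Uniqueness of weak
  derivatives makes the chosen derivative essentially bounded, so that the infimum is taken over a
  nonempty set.\<close>

lemma W1inf_mesh_derivative_bound:
  assumes d: "d \<in> W1inf_mesh N x" and M: "W1inf_mesh_norm N x d \<le> M" and n: "n < N"
  shows "\<exists>w\<in>L2_space {x n<..<x (Suc n)}. weak_deriv (x n) (x (Suc n)) d w \<and>
     (AE y in lborel. y \<in> {x n<..<x (Suc n)} \<longrightarrow> \<bar>w y\<bar> \<le> max 0 (M + 1))"
proof -
  let ?I = "{x n<..<x (Suc n)}"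
  have "Suc n \<in> {1..N}" using n by simp
  then have dW: "d \<in> W1inf (x n) (x (Suc n))"
    and le: "W1inf_norm (x n) (x (Suc n)) d \<le> W1inf_mesh_norm N x d"
  proof -
    show "d \<in> W1inf (x n) (x (Suc n))"
      using d \<open>Suc n \<in> {1..N}\<close> unfolding W1inf_mesh_def by fastforce
    have "W1inf_norm (x (Suc n - 1)) (x (Suc n)) d \<le> W1inf_mesh_norm N x d"
      unfolding W1inf_mesh_norm_def using \<open>Suc n \<in> {1..N}\<close>
      by (intro Max_ge finite_imageI finite_atLeastAtMost) (rule imageI)
    then show "W1inf_norm (x n) (x (Suc n)) d \<le> W1inf_mesh_norm N x d" by simp
  qed
  obtain w where w: "w \<in> Linf_space ?I" "weak_deriv (x n) (x (Suc n)) d w"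
    using dW unfolding W1inf_def by blast
  let ?w = "weak_dx (x n) (x (Suc n)) d"
  note wd = weak_dx_AE_eq[OF x_step[OF n] Linf_subset_L2[OF w(1)] w(2)]
  obtain c where c: "AE y in lborel. y \<in> ?I \<longrightarrow> \<bar>w y\<bar> \<le> c"
    using w(1) unfolding Linf_space_def by blast
  let ?B = "{c. 0 \<le> c \<and> (AE y in lborel. y \<in> ?I \<longrightarrow> \<bar>?w y\<bar> \<le> c)}"
  have "AE y in lborel. y \<in> ?I \<longrightarrow> \<bar>?w y\<bar> \<le> max 0 c"
    using c wd(3) by eventually_elim auto
  then have ne: "?B \<noteq> {}" by (auto intro!: exI[of _ "max 0 c"])
  have "Linf_norm ?I ?w \<le> M" using le M unfolding W1inf_norm_def by simp
  then have "Inf ?B < M + 1" unfolding Linf_norm_def by simp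
  then obtain c' where "c' \<in> ?B" "c' < M + 1" using cInf_lessD[OF ne] by blast
  then have "AE y in lborel. y \<in> ?I \<longrightarrow> \<bar>?w y\<bar> \<le> c'" and c': "c' \<le> max 0 (M + 1)" by auto
  from this(1) have "AE y in lborel. y \<in> ?I \<longrightarrow> \<bar>?w y\<bar> \<le> max 0 (M + 1)"
    by (rule eventually_mono) (use c' in auto)
  then show ?thesis using wd(1,2) by blast
qed

lemma smooth_interp_eq:
  assumes D: "smooth_array (k + 3) T xL xR D K" and T: "0 < T"
    and u: "\<And>y. y \<in> {xL..xR} \<Longrightarrow> D 0 0 0 y = u y"
    and n: "n < N" and y: "y \<in> {x n..x (Suc n)}"
  shows "interp k N x u y = poly (ipol n (D 0 0 0 (x n)) (D 0 1 0)) y"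
proof -
  have T0: "0 \<in> {0..T}" using T by simp
  have "interp k N x u y = poly (ipol n (u (x n)) (D 0 1 0)) y"
  proof (rule interp_eq[OF _ _ n y])
    show "(u has_real_derivative D 0 1 0 z) (at z within {xL..xR})" if z: "z \<in> {xL..xR}" for z
    proof -
      have "(D 0 0 0 has_real_derivative D 0 1 0 z) (at z within {xL..xR})"
        using smooth_arrayD(2)[OF D _ T0 z, of 0 0] by simp
      then show ?thesis
        by (rule has_field_derivative_transform_within[OF _ zero_less_one z]) (rule u)
    qed
    show "continuous_on {xL..xR} (D 0 1 0)" by (rule smooth_arrayD(5)[OF D _ T0]) simp
  qed
  then show ?thesis using u[OF node_in[of n]] n by simp
qed

text \<open>The inexact lower-order term sees the discrete solution only through its moments.\<close>

lemma weighted_L2_proj_moment: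
  assumes \<delta>: "\<delta> \<in> Linf_space {xL<..<xR}" and v: "v \<in> L2_space {xL<..<xR}" and n: "n < N"
  shows "L2_inner xL xR (\<lambda>y. \<delta> y * L2_proj (k - 1) N x v y) (test_fun n (basis n i)) = (\<Sum>l<k. wmat n \<delta> i l * cf n v l)"
proof -
  interpret e: element "x n" "x (Suc n)" k "basis n" by (rule element[OF n])
  have "L2_inner xL xR (\<lambda>y. \<delta> y * L2_proj (k - 1) N x v y) (test_fun n (basis n i))
    = cf n (\<lambda>y. \<delta> y * L2_proj (k - 1) N x v y) i" by (rule L2_inner_test_basis[OF n])
  also have "\<dots> = cf n (\<lambda>y. \<delta> y * poly (pr n v) y) i"
    by (rule e.coef_cong) (simp only: L2_proj_eq[OF v n])
  also have "\<dots> = (\<Sum>l<k. wmat n \<delta> i l * cf n v l)"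
    unfolding e.proj_def by (rule e.weight_matrix_mult[OF Linf_space_element[OF \<delta> n], symmetric])
  finally show ?thesis .
qed

end

lemma L2_space_section:
  assumes f: "(\<lambda>(t, y). f t y) \<in> L2_space ({0<..<T} \<times> {\<alpha><..<\<beta>})" and t: "t \<in> {0<..<T}"
  shows "set_borel_measurable lborel {\<alpha><..<\<beta>} (f t :: real \<Rightarrow> real)"
proof -
  have m: "(\<lambda>p. indicat_real ({0<..<T} \<times> {\<alpha><..<\<beta>}) p *\<^sub>R (case p of (t, y) \<Rightarrow> f t y)) \<in> borel_measurable borel"
    using f unfolding L2_space_def set_borel_measurable_def by simp
  have "(\<lambda>y. (t, y)) \<in> borel_measurable borel"
    by (intro borel_measurable_continuous_onI continuous_on_Pair continuous_on_const continuous_on_id)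
  from measurable_compose[OF this m]
  have "(\<lambda>y. indicat_real ({0<..<T} \<times> {\<alpha><..<\<beta>}) (t, y) *\<^sub>R f t y) \<in> borel_measurable borel" by simp
  moreover have "(\<lambda>y. indicat_real ({0<..<T} \<times> {\<alpha><..<\<beta>}) (t, y) *\<^sub>R f t y) = (\<lambda>y. indicat_real {\<alpha><..<\<beta>} y *\<^sub>R f t y)"
    using t by (intro ext) (simp add: indicator_def)
  ultimately show ?thesis unfolding set_borel_measurable_def by simp
qed

lemma smooth_array_deriv:
  assumes D: "smooth_array r T \<alpha> \<beta> D K" and r: "0 < r"
    and u: "\<And>t y. t \<in> {0..T} \<Longrightarrow> y \<in> {\<alpha>..\<beta>} \<Longrightarrow> D 0 0 t y = u t y"
    and t: "t \<in> {0<..<T}" and y: "y \<in> {\<alpha><..<\<beta>}"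
  shows "deriv (\<lambda>s. u s y) t = D 1 0 t y" and "deriv (u t) y = D 0 1 t y"
proof -
  have t': "t \<in> {0..T}" and y': "y \<in> {\<alpha>..\<beta>}" using t y by auto
  have "((\<lambda>s. D 0 0 s y) has_real_derivative D 1 0 t y) (at t)"
    using smooth_arrayD(1)[OF D _ t' y', of 0 0] r at_within_interior[of t "{0..T}"] t by simp
  then have "((\<lambda>s. u s y) has_real_derivative D 1 0 t y) (at t)"
    by (rule has_field_derivative_transform_within_open[OF _ open_greaterThanLessThan t]) (use u y' in auto)
  then show "deriv (\<lambda>s. u s y) t = D 1 0 t y" by (rule DERIV_imp_deriv)
  have "(D 0 0 t has_real_derivative D 0 1 t y) (at y)"
    using smooth_arrayD(2)[OF D _ t' y', of 0 0] r at_within_interior[of y "{\<alpha>..\<beta>}"] y by simp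
  then have "(u t has_real_derivative D 0 1 t y) (at y)"
    by (rule has_field_derivative_transform_within_open[OF _ open_greaterThanLessThan y]) (use u t' in auto)
  then show "deriv (u t) y = D 0 1 t y" by (rule DERIV_imp_deriv)
qed

context mesh
begin

lemma semidiscrete_error_if_solutions:
  assumes ab: "0 < a" "0 < b" and dl: "0 < dl" and T: "0 < T"
    and d: "d \<in> Linf_space {xL<..<xR}"
    and dlu: "AE y in lborel. y \<in> {xL<..<xR} \<longrightarrow> dl \<le> d y \<and> d y \<le> du"
    and f: "(\<lambda>(t, y). f t y) \<in> L2_space ({0<..<T} \<times> {xL<..<xR})"
    and g: "(\<lambda>(t, y). g t y) \<in> L2_space ({0<..<T} \<times> {xL<..<xR})"
    and Dp: "smooth_array (k + 3) T xL xR Dp K" and Dm: "smooth_array (k + 3) T xL xR Dm K"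
    and p: "\<And>t y. t \<in> {0..T} \<Longrightarrow> y \<in> {xL..xR} \<Longrightarrow> Dp 0 0 t y = p t y"
    and m: "\<And>t y. t \<in> {0..T} \<Longrightarrow> y \<in> {xL..xR} \<Longrightarrow> Dm 0 0 t y = m t y"
    and exact: "exact_solution a b d xL xR T f g p m"
    and dW: "d \<in> W1inf_mesh N x" "W1inf_mesh_norm N x d \<le> M"
    and pg: "petrov_galerkin_solution a b d xL xR T f g (p 0) (m 0) k N x ph mh"
  shows "\<exists>ph' mh'. semidiscrete_error xL xR N x k a b \<bar>du\<bar> (max 0 (M + 1)) T K d Dp Dm ph ph' mh mh'"
proof -
  obtain ph' mh' where ph: "H1_time T xL xR (Q_space k N x) ph ph'" and mh: "H1_time T xL xR (V_space k N x) mh mh'"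
    and init: "\<forall>y\<in>{xL..xR}. ph 0 y = interp k N x (p 0) y \<and> mh 0 y = interp k N x (m 0) y"
    and eqs: "AE t in lborel. t \<in> {0<..<T} \<longrightarrow>
        (\<forall>q\<in>pw_poly (k - 1) N x.
           L2_inner xL xR (\<lambda>y. a * ph' t y) q + L2_inner xL xR (weak_dx xL xR (mh t)) q
             = L2_inner xL xR (f t) q) \<and>
        (\<forall>v\<in>pw_poly (k - 1) N x.
           L2_inner xL xR (\<lambda>y. b * mh' t y) v + L2_inner xL xR (weak_dx xL xR (ph t)) v
             + L2_inner xL xR (\<lambda>y. d y * L2_proj (k - 1) N x (mh t) y) v
             = L2_inner xL xR (g t) v)"
    using pg unfolding petrov_galerkin_solution_def by (elim exE conjE) (rule that)
  have fe: "ph t \<in> pw_poly k N x" "continuous_on {xL..xR} (ph t)" "mh t \<in> pw_poly k N x" "continuous_on {xL..xR} (mh t)"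
    if "t \<in> {0..T}" for t
    using ph mh that unfolding H1_time_def Q_space_def V_space_def H10_def H1_def x_0 x_N by auto
  have eqs_exact: "AE t in lborel. t \<in> {0<..<T} \<longrightarrow> (AE y in lborel. y \<in> {xL<..<xR} \<longrightarrow>
        a * Dp 1 0 t y + Dm 0 1 t y = f t y \<and> b * Dm 1 0 t y + Dp 0 1 t y + d y * Dm 0 0 t y = g t y)"
  proof -
    have "AE t in lborel. t \<in> {0<..<T} \<longrightarrow> (AE y in lborel. y \<in> {xL<..<xR} \<longrightarrow>
        a * deriv (\<lambda>s. p s y) t + deriv (m t) y = f t y \<and>
        b * deriv (\<lambda>s. m s y) t + deriv (p t) y + d y * m t y = g t y)"
      using exact unfolding exact_solution_def by (rule conjunct1)
    then show ?thesis
    proof (rule eventually_mono, intro impI)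
      fix t assume *: "t \<in> {0<..<T} \<longrightarrow> (AE y in lborel. y \<in> {xL<..<xR} \<longrightarrow>
        a * deriv (\<lambda>s. p s y) t + deriv (m t) y = f t y \<and>
        b * deriv (\<lambda>s. m s y) t + deriv (p t) y + d y * m t y = g t y)" and t: "t \<in> {0<..<T}"
      from *[rule_format, OF t]
      show "AE y in lborel. y \<in> {xL<..<xR} \<longrightarrow>
        a * Dp 1 0 t y + Dm 0 1 t y = f t y \<and> b * Dm 1 0 t y + Dp 0 1 t y + d y * Dm 0 0 t y = g t y"
      proof (rule eventually_mono, intro impI)
        fix y assume e: "y \<in> {xL<..<xR} \<longrightarrow>
          a * deriv (\<lambda>s. p s y) t + deriv (m t) y = f t y \<and>
          b * deriv (\<lambda>s. m s y) t + deriv (p t) y + d y * m t y = g t y" and y: "y \<in> {xL<..<xR}"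
        have "Dm 0 0 t y = m t y" using m t y by simp
        then show "a * Dp 1 0 t y + Dm 0 1 t y = f t y \<and> b * Dm 1 0 t y + Dp 0 1 t y + d y * Dm 0 0 t y = g t y"
          using e[rule_format, OF y] smooth_array_deriv[OF Dp _ p t y] smooth_array_deriv[OF Dm _ m t y] by simp
      qed
    qed
  qed
  have L: "D i j t \<in> L2_space {xL<..<xR}" if "smooth_array (k + 3) T xL xR D K" "i + j \<le> k + 3" "t \<in> {0..T}" for D i j t
    by (rule L2_spaceI_continuous[OF smooth_arrayD(5)[OF that]])
  have "semidiscrete_error xL xR N x k a b \<bar>du\<bar> (max 0 (M + 1)) T K d Dp Dm ph ph' mh mh'"
  proof unfold_locales
    show "AE y in lborel. y \<in> {xL<..<xR} \<longrightarrow> 0 \<le> d y \<and> \<bar>d y\<bar> \<le> \<bar>du\<bar>"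
      using dlu by (rule eventually_mono) (use dl in auto)
    show "Dp 0 0 t xL = 0" "Dp 0 0 t xR = 0" if "t \<in> {0..T}" for t
      using exact that p[of t xL] p[of t xR] xL_less_xR unfolding exact_solution_def by auto
    have T0: "0 \<in> {0..T}" using T by simp
    show "ph 0 y = poly (ipol n (Dp 0 0 0 (x n)) (Dp 0 1 0)) y" if "n < N" "y \<in> {x n..x (Suc n)}" for n y
      using init smooth_interp_eq[OF Dp T p[OF T0] that] element_subset[OF that(1)] that(2) by auto
    show "mh 0 y = poly (ipol n (Dm 0 0 0 (x n)) (Dm 0 1 0)) y" if "n < N" "y \<in> {x n..x (Suc n)}" for n y
      using init smooth_interp_eq[OF Dm T m[OF T0] that] element_subset[OF that(1)] that(2) by auto
    fix n i assume n: "n < N" and i: "i < k"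
    interpret e: element "x n" "x (Suc n)" k "basis n" by (rule element[OF n])
    let ?q = "test_fun n (basis n i)"
    note q = test_basis_in[OF n i]
    have qm: "set_borel_measurable lborel {xL<..<xR} ?q" using test_fun_L2 by (simp add: L2_space_def)
    show "AE t in lborel. t \<in> {0<..<T} \<longrightarrow>
       a * cf n (ph' t) i + cf n (poly (pderiv (piece (mh t) n))) i = a * cf n (Dp 1 0 t) i + cf n (Dm 0 1 t) i"
      using eqs eqs_exact
    proof eventually_elim
      case (elim t)
      show ?case
      proof
        assume t: "t \<in> {0<..<T}"
        then have t': "t \<in> {0..T}" by simp
        have F: "L2_inner xL xR (\<lambda>y. a * ph' t y) ?q + L2_inner xL xR (weak_dx xL xR (mh t)) ?q = L2_inner xL xR (f t) ?q"
          using elim(1) t q by blast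
        have R: "(\<lambda>y. a * Dp 1 0 t y + Dm 0 1 t y) \<in> L2_space {xL<..<xR}"
          by (intro L2_space_add L2_space_scale L[OF Dp _ t'] L[OF Dm _ t']) auto
        have ae: "AE y in lborel. y \<in> {xL<..<xR} \<longrightarrow>
          a * Dp 1 0 t y + Dm 0 1 t y = f t y \<and> b * Dm 1 0 t y + Dp 0 1 t y + d y * Dm 0 0 t y = g t y"
          using elim(2) t by blast
        have "L2_inner xL xR (\<lambda>y. a * Dp 1 0 t y + Dm 0 1 t y) ?q = L2_inner xL xR (f t) ?q"
          using R by (intro L2_inner_cong_AE L2_space_section[OF f t] qm eventually_mono[OF ae]) (auto simp: L2_space_def)
        then have "L2_inner xL xR (f t) ?q = cf n (\<lambda>y. a * Dp 1 0 t y + Dm 0 1 t y) i"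
          by (simp add: L2_inner_test_basis[OF n])
        also have "\<dots> = a * cf n (Dp 1 0 t) i + cf n (Dm 0 1 t) i"
          using e.coef_add[OF L2_space_scale[OF L2_space_element[OF L[OF Dp _ t'] n]] L2_space_element[OF L[OF Dm _ t'] n], of 1 0 0 1]
          by (simp add: e.coef_scale)
        finally show "a * cf n (ph' t) i + cf n (poly (pderiv (piece (mh t) n))) i = a * cf n (Dp 1 0 t) i + cf n (Dm 0 1 t) i"
          using F weak_dx_pw_poly(1)[OF fe(3,4)[OF t'] n, of "basis n i"]
          by (simp add: L2_inner_scale_left L2_inner_test_basis[OF n] e.coef_def)
      qed
    qed
    show "AE t in lborel. t \<in> {0<..<T} \<longrightarrow>
       b * cf n (mh' t) i + cf n (poly (pderiv (piece (ph t) n))) i + (\<Sum>l<k. wmat n d i l * cf n (mh t) l)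
       = b * cf n (Dm 1 0 t) i + cf n (Dp 0 1 t) i + cf n (\<lambda>y. d y * Dm 0 0 t y) i"
      using eqs eqs_exact
    proof eventually_elim
      case (elim t)
      show ?case
      proof
        assume t: "t \<in> {0<..<T}"
        then have t': "t \<in> {0..T}" by simp
        have F: "L2_inner xL xR (\<lambda>y. b * mh' t y) ?q + L2_inner xL xR (weak_dx xL xR (ph t)) ?q
               + L2_inner xL xR (\<lambda>y. d y * L2_proj (k - 1) N x (mh t) y) ?q = L2_inner xL xR (g t) ?q"
          using elim(1) t q by blast
        have R: "(\<lambda>y. b * Dm 1 0 t y + Dp 0 1 t y + d y * Dm 0 0 t y) \<in> L2_space {xL<..<xR}"
          by (intro L2_space_add L2_space_scale Linf_mult_L2_space d L[OF Dp _ t'] L[OF Dm _ t']) auto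
        have ae: "AE y in lborel. y \<in> {xL<..<xR} \<longrightarrow>
          a * Dp 1 0 t y + Dm 0 1 t y = f t y \<and> b * Dm 1 0 t y + Dp 0 1 t y + d y * Dm 0 0 t y = g t y"
          using elim(2) t by blast
        have "L2_inner xL xR (\<lambda>y. b * Dm 1 0 t y + Dp 0 1 t y + d y * Dm 0 0 t y) ?q = L2_inner xL xR (g t) ?q"
          using R by (intro L2_inner_cong_AE L2_space_section[OF g t] qm eventually_mono[OF ae]) (auto simp: L2_space_def)
        then have "L2_inner xL xR (g t) ?q = cf n (\<lambda>y. b * Dm 1 0 t y + Dp 0 1 t y + d y * Dm 0 0 t y) i"
          by (simp add: L2_inner_test_basis[OF n])
        also have "\<dots> = cf n (\<lambda>y. b * Dm 1 0 t y + Dp 0 1 t y) i + cf n (\<lambda>y. d y * Dm 0 0 t y) i"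
          by (intro e.coef_add L2_space_add L2_space_scale Linf_mult_L2_space Linf_space_element[OF d n]
              L2_space_element[OF _ n] L[OF Dp _ t'] L[OF Dm _ t']) auto
        also have "cf n (\<lambda>y. b * Dm 1 0 t y + Dp 0 1 t y) i = b * cf n (Dm 1 0 t) i + cf n (Dp 0 1 t) i"
          using e.coef_add[OF L2_space_scale[OF L2_space_element[OF L[OF Dm _ t'] n]] L2_space_element[OF L[OF Dp _ t'] n], of 1 0 0 1]
          by (simp add: e.coef_scale)
        finally show "b * cf n (mh' t) i + cf n (poly (pderiv (piece (ph t) n))) i + (\<Sum>l<k. wmat n d i l * cf n (mh t) l)
         = b * cf n (Dm 1 0 t) i + cf n (Dp 0 1 t) i + cf n (\<lambda>y. d y * Dm 0 0 t y) i"
          using F weak_dx_pw_poly(1)[OF fe(1,2)[OF t'] n, of "basis n i"]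
            weighted_L2_proj_moment[OF d L2_spaceI_continuous[OF fe(4)[OF t']] n, of i]
          by (simp add: L2_inner_scale_left L2_inner_test_basis[OF n] e.coef_def)
      qed
    qed
  qed (use ab T d Dp Dm ph mh W1inf_mesh_derivative_bound[OF dW] in auto)
  then show ?thesis by blast
qed

end

theorem theorem1:
  fixes k :: nat
  assumes "1 \<le> k"
  shows "\<exists>r::nat. \<forall>(a::real) (b::real) (dl::real) (du::real) (M::real) (xL::real) (xR::real) (T::real) (K::real).
    0 < a \<longrightarrow> 0 < b \<longrightarrow> 0 < dl \<longrightarrow> xL < xR \<longrightarrow> 0 < T \<longrightarrow>
    (\<exists>C::real. \<forall>(d :: real \<Rightarrow> real) (f :: real \<Rightarrow> real \<Rightarrow> real) (g :: real \<Rightarrow> real \<Rightarrow> real)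
        (p :: real \<Rightarrow> real \<Rightarrow> real) (m :: real \<Rightarrow> real \<Rightarrow> real)
        (N::nat) (x :: nat \<Rightarrow> real) (ph :: real \<Rightarrow> real \<Rightarrow> real) (mh :: real \<Rightarrow> real \<Rightarrow> real).
      d \<in> Linf_space {xL<..<xR} \<longrightarrow>
      (AE y in lborel. y \<in> {xL<..<xR} \<longrightarrow> dl \<le> d y \<and> d y \<le> du) \<longrightarrow>
      (\<lambda>(t, y). f t y) \<in> L2_space ({0<..<T} \<times> {xL<..<xR}) \<longrightarrow>
      (\<lambda>(t, y). g t y) \<in> L2_space ({0<..<T} \<times> {xL<..<xR}) \<longrightarrow>
      p 0 \<in> H10 xL xR \<longrightarrow> m 0 \<in> H1 xL xR \<longrightarrow>
      Cr_norm_le r T xL xR p K \<longrightarrow> Cr_norm_le r T xL xR m K \<longrightarrow>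
      exact_solution a b d xL xR T f g p m \<longrightarrow>
      is_mesh xL xR N x \<longrightarrow>
      d \<in> W1inf_mesh N x \<longrightarrow> W1inf_mesh_norm N x d \<le> M \<longrightarrow>
      petrov_galerkin_solution a b d xL xR T f g (p 0) (m 0) k N x ph mh \<longrightarrow>
      (\<forall>t\<in>{0..T}.
         L2_norm xL xR (\<lambda>y. p t y - ph t y) + L2_norm xL xR (\<lambda>y. m t y - mh t y)
           \<le> C * mesh_size N x ^ (k + 1)))"
\<comment> \<open>The residuals involve the time derivative of the solution with up to \<open>k + 1\<close> derivatives in space;
  their differences in time need one more time derivative.\<close>
proof (rule exI[of _ "k + 3"], intro allI impI)
  fix a b dl du M xL xR T K :: real
  assume a: "0 < a" and b: "0 < b" and dl: "0 < dl" and "xL < xR" and T: "0 < T"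
  define C where "C = sqrt (error_const a b \<bar>du\<bar> (max 0 (M + 1)) T K (xR - xL))"
  show "\<exists>C::real. \<forall>(d :: real \<Rightarrow> real) (f :: real \<Rightarrow> real \<Rightarrow> real) (g :: real \<Rightarrow> real \<Rightarrow> real)
        (p :: real \<Rightarrow> real \<Rightarrow> real) (m :: real \<Rightarrow> real \<Rightarrow> real)
        (N::nat) (x :: nat \<Rightarrow> real) (ph :: real \<Rightarrow> real \<Rightarrow> real) (mh :: real \<Rightarrow> real \<Rightarrow> real).
      d \<in> Linf_space {xL<..<xR} \<longrightarrow>
      (AE y in lborel. y \<in> {xL<..<xR} \<longrightarrow> dl \<le> d y \<and> d y \<le> du) \<longrightarrow>
      (\<lambda>(t, y). f t y) \<in> L2_space ({0<..<T} \<times> {xL<..<xR}) \<longrightarrow>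
      (\<lambda>(t, y). g t y) \<in> L2_space ({0<..<T} \<times> {xL<..<xR}) \<longrightarrow>
      p 0 \<in> H10 xL xR \<longrightarrow> m 0 \<in> H1 xL xR \<longrightarrow>
      Cr_norm_le (k + 3) T xL xR p K \<longrightarrow> Cr_norm_le (k + 3) T xL xR m K \<longrightarrow>
      exact_solution a b d xL xR T f g p m \<longrightarrow>
      is_mesh xL xR N x \<longrightarrow>
      d \<in> W1inf_mesh N x \<longrightarrow> W1inf_mesh_norm N x d \<le> M \<longrightarrow>
      petrov_galerkin_solution a b d xL xR T f g (p 0) (m 0) k N x ph mh \<longrightarrow>
      (\<forall>t\<in>{0..T}.
         L2_norm xL xR (\<lambda>y. p t y - ph t y) + L2_norm xL xR (\<lambda>y. m t y - mh t y)
           \<le> C * mesh_size N x ^ (k + 1))"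
  proof (rule exI[of _ "2 * C"], intro allI impI ballI)
    fix d f g p m and N :: nat and x ph mh t
    assume d: "d \<in> Linf_space {xL<..<xR}"
      and dlu: "AE y in lborel. y \<in> {xL<..<xR} \<longrightarrow> dl \<le> d y \<and> d y \<le> du"
      and f: "(\<lambda>(t, y). f t y) \<in> L2_space ({0<..<T} \<times> {xL<..<xR})"
      and g: "(\<lambda>(t, y). g t y) \<in> L2_space ({0<..<T} \<times> {xL<..<xR})"
      and p: "Cr_norm_le (k + 3) T xL xR p K" and m: "Cr_norm_le (k + 3) T xL xR m K"
      and exact: "exact_solution a b d xL xR T f g p m"
      and mesh: "is_mesh xL xR N x"
      and dW: "d \<in> W1inf_mesh N x" "W1inf_mesh_norm N x d \<le> M"
      and pg: "petrov_galerkin_solution a b d xL xR T f g (p 0) (m 0) k N x ph mh"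
      and t: "t \<in> {0..T}"
    obtain Dp where ext_p: "\<forall>t\<in>{0..T}. \<forall>y\<in>{xL..xR}. Dp 0 0 t y = p t y" "smooth_array (k + 3) T xL xR Dp K"
      using p unfolding Cr_norm_le_iff by blast
    obtain Dm where ext_m: "\<forall>t\<in>{0..T}. \<forall>y\<in>{xL..xR}. Dm 0 0 t y = m t y" "smooth_array (k + 3) T xL xR Dm K"
      using m unfolding Cr_norm_le_iff by blast
    interpret mesh xL xR N x k by unfold_locales (fact mesh assms)+
    obtain ph' mh' where "semidiscrete_error xL xR N x k a b \<bar>du\<bar> (max 0 (M + 1)) T K d Dp Dm ph ph' mh mh'"
      using semidiscrete_error_if_solutions[OF a b dl T d dlu f g ext_p(2) ext_m(2) _ _ exact dW pg] ext_p(1) ext_m(1) by blast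
    then interpret semidiscrete_error xL xR N x k a b "\<bar>du\<bar>" "max 0 (M + 1)" T K d Dp Dm ph ph' mh mh' .
    have norm_le: "L2_norm xL xR e \<le> C * mesh_size N x ^ (k + 1)"
      if "L2_inner xL xR e e \<le> error_const a b \<bar>du\<bar> (max 0 (M + 1)) T K (xR - xL) * (mesh_size N x ^ (k + 1))\<^sup>2" for e
    proof -
      have "0 \<le> mesh_size N x ^ (k + 1)" using mesh_size_nonneg by simp
      then show ?thesis
        using real_sqrt_le_mono[OF that] unfolding L2_norm_def C_def by (simp only: real_sqrt_mult real_sqrt_abs abs_of_nonneg)
    qed
    have "L2_inner xL xR (\<lambda>y. p t y - ph t y) (\<lambda>y. p t y - ph t y) = L2_inner xL xR (\<lambda>y. Dp 0 0 t y - ph t y) (\<lambda>y. Dp 0 0 t y - ph t y)"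
      by (rule L2_inner_cong) (simp_all add: bspec[OF bspec[OF ext_p(1) t]])
    moreover have "L2_inner xL xR (\<lambda>y. m t y - mh t y) (\<lambda>y. m t y - mh t y) = L2_inner xL xR (\<lambda>y. Dm 0 0 t y - mh t y) (\<lambda>y. Dm 0 0 t y - mh t y)"
      by (rule L2_inner_cong) (simp_all add: bspec[OF bspec[OF ext_m(1) t]])
    ultimately show "L2_norm xL xR (\<lambda>y. p t y - ph t y) + L2_norm xL xR (\<lambda>y. m t y - mh t y)
           \<le> 2 * C * mesh_size N x ^ (k + 1)"
      using norm_le[of "\<lambda>y. p t y - ph t y"] norm_le[of "\<lambda>y. m t y - mh t y"] error_estimate[OF t] by simp
  qed
qed

end
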